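(* Let $(M,\langle\cdot,\cdot\rangle)$ be a Riemannian manifold and let $(\widetilde\varphi,\widetilde\xi,\widetilde\eta,\widetilde G)$ be a $g$-natural paracontact metric structure on $T_1M$, constructed from a $g$-natural metric $\widetilde G$ (with constants $a,b,c,d$) with $a\neq0$. The following properties are equivalent: (i) $(\widetilde\varphi,\widetilde\xi,\widetilde\eta,\widetilde G)$ is paraSasakian; (ii) $(\widetilde\varphi,\widetilde\xi,\widetilde\eta,\widetilde G)$ is $K$-paracontact; (iii) $b=0$ and the base manifold $(M,\langle\cdot,\cdot\rangle)$ has constant sectional curvature $\bar c=\frac{a+c}{a}<0$.
   Context: $(M,\langle\cdot,\cdot\rangle)$ is a Riemannian manifold of dimension $n+1$ with $n\ge1$, with Levi-Civita connection $\nabla$; $M_x$ is its tangent space at $x$. $T_1M=\{(x,u)\in TM:\langle u,u\rangle=1\}$, of dimension $2n+1$. For $X\in M_x$, $X^h$ and $X^v$ denote the horizontal (with respect to $\nabla$) and vertical lifts to $(x,u)$; $u^h$ is the geodesic flow vector field. The tangent space of $T_1M$ at $(x,u)$ is $\{X^h+Y^v: X,Y\in M_x,\ Y\perp u\}$. A $g$-natural metric $\widetilde G$ on $T_1M$ is determined by four real constants $a,b,c,d$ through $$\widetilde G_{(x,u)}(X_1^h,X_2^h)=(a+c)\langle X_1,X_2\rangle+d\langle X_1,u\rangle\langle X_2,u\rangle,\quad \widetilde G_{(x,u)}(X_1^h,Y_1^v)=b\langle X_1,Y_1\rangle,\quad \widetilde G_{(x,u)}(Y_1^v,Y_2^v)=a\langle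 Y_1,Y_2\rangle,$$ for $X_i,Y_i\in M_x$ with $Y_i\perp u$. Put $\alpha=a(a+c)-b^2$, $\phi=a(a+c+d)-b^2$. The tangential lift is $X^{t_G}=X^v-\langle X,u\rangle u^v+\frac{b}{a+c+d}\langle X,u\rangle u^h$ (so $Y^{t_G}=Y^v$ if $Y\perp u$). An almost paracontact structure $(\varphi,\xi,\eta)$ on a $(2n+1)$-manifold satisfies $\eta(\xi)=1$, $\varphi^2=I-\eta\otimes\xi$, and the eigendistributions of $\varphi$ for $\pm1$ both have dimension $n$. $(\varphi,\xi,\eta,g)$ is a paracontact metric structure if moreover the pseudo-Riemannian metric $g$ satisfies $g(\varphi X,\varphi Y)=-g(X,Y)+\eta(X)\eta(Y)$ and $d\eta(X,Y)=g(X,\varphi Y)$, with $2\,d\eta(X,Y)=X\eta(Y)-Y\eta(X)-\eta([X,Y])$. It is $K$-paracontact if $\xi$ is a Killing vector field (equivalently $h=\frac12L_\xi\varphi=0$, $L$ the Lie derivative), and paraSasakian if $[\varphi,\varphi]-2d\eta\otimes\xi=0$ (equivalently $(\nabla_Z\varphi)W=-g(Z,W)\xi+\eta(W)Z$ for all vector fields $Z,W$, with $\nabla$ the Levi-Civita connection of $g$), where $[\varphi,\varphi]$ is the Nijenhuis torsion of $\varphi$. A $g$-natural paracontact metric structure on $T_1M$ is a paracontact metric structure $(\widetilde\varphi,\widetilde\xi,\widetilde\eta,\widetilde G)$ where $\widetilde G$ is a $g$-natural metric with constants $a,b,c,d$ and, for some real constant $\rho>0$, $$\widetilde\xi=\rho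 u^h,\quad \widetilde\eta(X^h)=\tfrac1\rho\langle X,u\rangle,\quad \widetilde\eta(Y^{t_G})=b\rho\langle Y,u\rangle,$$ $$\widetilde\varphi(X^h)=\tfrac{1}{2\rho\alpha}\big(-bX^h+(a+c)X^{t_G}+\tfrac{bd}{a+c+d}\langle X,u\rangle u^h\big),\quad \widetilde\varphi(Y^{t_G})=\tfrac{1}{2\rho\alpha}\big(-aY^h+bY^{t_G}+\tfrac{\phi}{a+c+d}\langle Y,u\rangle u^h\big)$$ for all $X,Y\in M_x$, with $a+c+d=-4\alpha=\frac1{\rho^2}$. *)

theory Defs
  imports "HOL-Analysis.Analysis" "HOL-Library.Function_Algebras"
begin

(* Pointwise vector space structure on functions.  It is used for tangent vectors (functionals on
   functions) and for vector fields. *)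

instantiation "fun" :: (type, real_vector) real_vector
begin

definition scaleR_fun :: "real \<Rightarrow> ('a \<Rightarrow> 'b) \<Rightarrow> 'a \<Rightarrow> 'b" where
  "scaleR_fun r f = (\<lambda>x. r *\<^sub>R f x)"

instance
  by standard (auto simp: scaleR_fun_def plus_fun_def fun_eq_iff algebra_simps)

end

definition linear_on :: "'u::real_vector set \<Rightarrow> ('u \<Rightarrow> 'v::real_vector) \<Rightarrow> bool" where
  "linear_on T F \<longleftrightarrow>
     (\<forall>u\<in>T. \<forall>v\<in>T. F (u + v) = F u + F v) \<and> (\<forall>r. \<forall>u\<in>T. F (r *\<^sub>R u) = r *\<^sub>R F u)"


section \<open>Smooth manifolds\<close>

(* To be used for open S only: the derivatives are taken at x, not within S. *)

primrec Ck_on ::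
  "nat \<Rightarrow> 'e::real_normed_vector set \<Rightarrow> ('e \<Rightarrow> 'f::real_normed_vector) \<Rightarrow> bool" where
  "Ck_on 0 S f \<longleftrightarrow> continuous_on S f"
| "Ck_on (Suc k) S f \<longleftrightarrow>
     (\<forall>x\<in>S. f differentiable (at x)) \<and> (\<forall>v. Ck_on k S (\<lambda>x. frechet_derivative f (at x) v))"

definition smooth_on ::
  "'e::real_normed_vector set \<Rightarrow> ('e \<Rightarrow> 'f::real_normed_vector) \<Rightarrow> bool" where
  "smooth_on S f \<longleftrightarrow> (\<forall>k. Ck_on k S f)"

(* The charts of a space may live on a larger manifold of which the points form an embedded
   submanifold.  For a manifold proper, the chart domains cover exactly the points. *)

record ('p, 'e) space =
  points :: "'p set"
  charts :: "('p set \<times> ('p \<Rightarrow> 'e)) set"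

(* The topology is determined by the atlas, so it is not part of the data. *)

definition smooth_manifold :: "('p, 'e::euclidean_space) space \<Rightarrow> bool" where
  "smooth_manifold N \<longleftrightarrow>
     points N \<noteq> {} \<and> \<Union>(fst ` charts N) = points N \<and>
     (\<exists>X. topspace X = points N \<and> Hausdorff_space X \<and> second_countable X \<and>
        (\<forall>(U, \<phi>)\<in>charts N. openin X U \<and> open (\<phi> ` U) \<and>
            homeomorphic_map (subtopology X U) (top_of_set (\<phi> ` U)) \<phi>)) \<and>
     (\<forall>(U, \<phi>)\<in>charts N. \<forall>(V, \<psi>)\<in>charts N. smooth_on (\<phi> ` (U \<inter> V)) (\<psi> \<circ> inv_into U \<phi>))"

definition near :: "('p, 'e::euclidean_space) space \<Rightarrow> 'p \<Rightarrow> ('p \<Rightarrow> bool) \<Rightarrow> bool" where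
  "near N p P \<longleftrightarrow> p \<in> points N \<and>
     (\<exists>(U, \<phi>)\<in>charts N. p \<in> U \<and>
        (\<exists>W. open W \<and> \<phi> p \<in> W \<and> (\<forall>q \<in> U \<inter> points N. \<phi> q \<in> W \<longrightarrow> P q)))"

(* f is smooth on some neighbourhood of p in N; if the points of N are a submanifold of the charted
   manifold this means that f locally extends to a smooth function of the coordinates. *)

definition smooth_near :: "('p, 'e::euclidean_space) space \<Rightarrow> 'p \<Rightarrow> ('p \<Rightarrow> real) \<Rightarrow> bool" where
  "smooth_near N p f \<longleftrightarrow> p \<in> points N \<and>
     (\<exists>(U, \<phi>)\<in>charts N. p \<in> U \<and>
        (\<exists>W F. open W \<and> \<phi> p \<in> W \<and> smooth_on W F \<and>
           (\<forall>q \<in> U \<inter> points N. \<phi> q \<in> W \<longrightarrow> f q = F (\<phi> q))))"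

(* A tangent vector at p is a derivation on the functions that are smooth near p, extended by 0 to
   all other functions.  Locality (dependence on the germ only) follows from the Leibniz rule applied
   to indicator functions of neighbourhoods of p. *)

type_synonym 'p tvec = "('p \<Rightarrow> real) \<Rightarrow> real"

definition tangent_space :: "('p, 'e::euclidean_space) space \<Rightarrow> 'p \<Rightarrow> 'p tvec set" where
  "tangent_space N p =
     {v. (\<forall>f. \<not> smooth_near N p f \<longrightarrow> v f = 0) \<and>
         linear_on {f. smooth_near N p f} v \<and>
         (\<forall>f h. smooth_near N p f \<and> smooth_near N p h \<longrightarrow>
            v (\<lambda>q. f q * h q) = f p * v h + h p * v f)}"

lemma subspace_tangent_space: "subspace (tangent_space N p)"
  by (auto simp: subspace_def tangent_space_def linear_on_def scaleR_fun_def algebra_simps)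

definition vector_field_near :: "('p, 'e::euclidean_space) space \<Rightarrow> 'p \<Rightarrow> ('p \<Rightarrow> 'p tvec) \<Rightarrow> bool" where
  "vector_field_near N p V \<longleftrightarrow>
     near N p (\<lambda>q. V q \<in> tangent_space N q) \<and>
     (\<forall>f. smooth_near N p f \<longrightarrow> smooth_near N p (\<lambda>q. V q f))"

definition lie_bracket ::
  "('p, 'e::euclidean_space) space \<Rightarrow> ('p \<Rightarrow> 'p tvec) \<Rightarrow> ('p \<Rightarrow> 'p tvec) \<Rightarrow> 'p \<Rightarrow> 'p tvec" where
  "lie_bracket N V W p =
     (\<lambda>f. if smooth_near N p f then V p (\<lambda>q. W q f) - W p (\<lambda>q. V q f) else 0)"


section \<open>Riemannian geometry\<close>

definition pseudo_riemannian_metric ::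
  "('p, 'e::euclidean_space) space \<Rightarrow> ('p \<Rightarrow> 'p tvec \<Rightarrow> 'p tvec \<Rightarrow> real) \<Rightarrow> bool" where
  "pseudo_riemannian_metric N g \<longleftrightarrow>
     (\<forall>p\<in>points N.
        (\<forall>u\<in>tangent_space N p. linear_on (tangent_space N p) (g p u)) \<and>
        (\<forall>u\<in>tangent_space N p. \<forall>v\<in>tangent_space N p. g p u v = g p v u) \<and>
        (\<forall>u\<in>tangent_space N p. (\<forall>v\<in>tangent_space N p. g p u v = 0) \<longrightarrow> u = 0) \<and>
        (\<forall>V W. vector_field_near N p V \<and> vector_field_near N p W \<longrightarrow>
           smooth_near N p (\<lambda>q. g q (V q) (W q))))"

definition riemannian_metric ::
  "('p, 'e::euclidean_space) space \<Rightarrow> ('p \<Rightarrow> 'p tvec \<Rightarrow> 'p tvec \<Rightarrow> real) \<Rightarrow> bool" where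
  "riemannian_metric N g \<longleftrightarrow> pseudo_riemannian_metric N g \<and>
     (\<forall>p\<in>points N. \<forall>u\<in>tangent_space N p. u \<noteq> 0 \<longrightarrow> g p u u > 0)"

(* D x v Y is the covariant derivative at x of the field Y in direction v.  Y need only be defined
   and smooth near x; independence of the values of Y away from x follows from the Leibniz rule. *)

type_synonym 'p connection = "'p \<Rightarrow> 'p tvec \<Rightarrow> ('p \<Rightarrow> 'p tvec) \<Rightarrow> 'p tvec"

definition affine_connection :: "('p, 'e::euclidean_space) space \<Rightarrow> 'p connection \<Rightarrow> bool" where
  "affine_connection N D \<longleftrightarrow>
     (\<forall>x\<in>points N. \<forall>Y. vector_field_near N x Y \<longrightarrow>
        (\<forall>v\<in>tangent_space N x. D x v Y \<in> tangent_space N x) \<and>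
        linear_on (tangent_space N x) (\<lambda>v. D x v Y) \<and>
        (\<forall>Z. \<forall>v\<in>tangent_space N x. vector_field_near N x Z \<longrightarrow>
           D x v (Y + Z) = D x v Y + D x v Z) \<and>
        (\<forall>f. \<forall>v\<in>tangent_space N x. smooth_near N x f \<longrightarrow>
           D x v (\<lambda>y. f y *\<^sub>R Y y) = f x *\<^sub>R D x v Y + v f *\<^sub>R Y x) \<and>
        (\<forall>V. vector_field_near N x V \<longrightarrow> vector_field_near N x (\<lambda>y. D y (V y) Y)))"

definition levi_civita ::
  "('p, 'e::euclidean_space) space \<Rightarrow> ('p \<Rightarrow> 'p tvec \<Rightarrow> 'p tvec \<Rightarrow> real) \<Rightarrow> 'p connection \<Rightarrow> bool" where
  "levi_civita N g D \<longleftrightarrow> affine_connection N D \<and>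
     (\<forall>x\<in>points N. \<forall>Y Z. vector_field_near N x Y \<and> vector_field_near N x Z \<longrightarrow>
        D x (Y x) Z - D x (Z x) Y = lie_bracket N Y Z x \<and>
        (\<forall>v\<in>tangent_space N x.
           v (\<lambda>y. g y (Y y) (Z y)) = g x (D x v Y) (Z x) + g x (Y x) (D x v Z)))"

definition curvature ::
  "('p, 'e::euclidean_space) space \<Rightarrow> 'p connection \<Rightarrow>
   ('p \<Rightarrow> 'p tvec) \<Rightarrow> ('p \<Rightarrow> 'p tvec) \<Rightarrow> ('p \<Rightarrow> 'p tvec) \<Rightarrow> 'p \<Rightarrow> 'p tvec" where
  "curvature N D X Y Z x =
     D x (X x) (\<lambda>y. D y (Y y) Z) - D x (Y x) (\<lambda>y. D y (X y) Z) - D x (lie_bracket N X Y x) Z"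

definition sectional_curvature ::
  "('p, 'e::euclidean_space) space \<Rightarrow> ('p \<Rightarrow> 'p tvec \<Rightarrow> 'p tvec \<Rightarrow> real) \<Rightarrow> 'p connection \<Rightarrow>
   ('p \<Rightarrow> 'p tvec) \<Rightarrow> ('p \<Rightarrow> 'p tvec) \<Rightarrow> 'p \<Rightarrow> real" where
  "sectional_curvature N g D X Y x =
     g x (curvature N D X Y Y x) (X x) /
       (g x (X x) (X x) * g x (Y x) (Y x) - (g x (X x) (Y x))\<^sup>2)"

definition constant_sectional_curvature ::
  "('p, 'e::euclidean_space) space \<Rightarrow> ('p \<Rightarrow> 'p tvec \<Rightarrow> 'p tvec \<Rightarrow> real) \<Rightarrow> 'p connection \<Rightarrow>
   real \<Rightarrow> bool" where
  "constant_sectional_curvature N g D \<kappa> \<longleftrightarrow>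
     (\<forall>x\<in>points N. \<forall>X Y. vector_field_near N x X \<and> vector_field_near N x Y \<and>
        X x \<noteq> Y x \<and> independent {X x, Y x} \<longrightarrow> sectional_curvature N g D X Y x = \<kappa>)"


section \<open>Paracontact metric structures\<close>

type_synonym 'p endo_field = "'p \<Rightarrow> 'p tvec \<Rightarrow> 'p tvec"

definition app_field :: "'p endo_field \<Rightarrow> ('p \<Rightarrow> 'p tvec) \<Rightarrow> 'p \<Rightarrow> 'p tvec" where
  "app_field \<phi> V = (\<lambda>q. \<phi> q (V q))"

definition exterior_derivative ::
  "('p, 'e::euclidean_space) space \<Rightarrow> ('p \<Rightarrow> 'p tvec \<Rightarrow> real) \<Rightarrow>
   ('p \<Rightarrow> 'p tvec) \<Rightarrow> ('p \<Rightarrow> 'p tvec) \<Rightarrow> 'p \<Rightarrow> real" where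
  "exterior_derivative N \<eta> V W p =
     (V p (\<lambda>q. \<eta> q (W q)) - W p (\<lambda>q. \<eta> q (V q)) - \<eta> p (lie_bracket N V W p)) / 2"

definition lie_derivative_metric ::
  "('p, 'e::euclidean_space) space \<Rightarrow> ('p \<Rightarrow> 'p tvec) \<Rightarrow> ('p \<Rightarrow> 'p tvec \<Rightarrow> 'p tvec \<Rightarrow> real) \<Rightarrow>
   ('p \<Rightarrow> 'p tvec) \<Rightarrow> ('p \<Rightarrow> 'p tvec) \<Rightarrow> 'p \<Rightarrow> real" where
  "lie_derivative_metric N \<xi> g V W p =
     \<xi> p (\<lambda>q. g q (V q) (W q)) - g p (lie_bracket N \<xi> V p) (W p) - g p (V p) (lie_bracket N \<xi> W p)"

definition killing_field ::
  "('p, 'e::euclidean_space) space \<Rightarrow> ('p \<Rightarrow> 'p tvec \<Rightarrow> 'p tvec \<Rightarrow> real) \<Rightarrow> ('p \<Rightarrow> 'p tvec) \<Rightarrow> bool" where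
  "killing_field N g \<xi> \<longleftrightarrow>
     (\<forall>p\<in>points N. vector_field_near N p \<xi> \<and>
        (\<forall>V W. vector_field_near N p V \<and> vector_field_near N p W \<longrightarrow>
           lie_derivative_metric N \<xi> g V W p = 0))"

definition nijenhuis ::
  "('p, 'e::euclidean_space) space \<Rightarrow> 'p endo_field \<Rightarrow>
   ('p \<Rightarrow> 'p tvec) \<Rightarrow> ('p \<Rightarrow> 'p tvec) \<Rightarrow> 'p \<Rightarrow> 'p tvec" where
  "nijenhuis N \<phi> V W p =
     \<phi> p (\<phi> p (lie_bracket N V W p)) + lie_bracket N (app_field \<phi> V) (app_field \<phi> W) p
       - \<phi> p (lie_bracket N (app_field \<phi> V) W p) - \<phi> p (lie_bracket N V (app_field \<phi> W) p)"

definition almost_paracontact ::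
  "('p, 'e::euclidean_space) space \<Rightarrow> nat \<Rightarrow>
   'p endo_field \<Rightarrow> ('p \<Rightarrow> 'p tvec) \<Rightarrow> ('p \<Rightarrow> 'p tvec \<Rightarrow> real) \<Rightarrow> bool" where
  "almost_paracontact N n \<phi> \<xi> \<eta> \<longleftrightarrow>
     (\<forall>p\<in>points N. let T = tangent_space N p in
        dim T = 2 * n + 1 \<and>
        linear_on T (\<phi> p) \<and> \<phi> p ` T \<subseteq> T \<and> linear_on T (\<eta> p) \<and>
        vector_field_near N p \<xi> \<and>
        (\<forall>V. vector_field_near N p V \<longrightarrow>
           vector_field_near N p (app_field \<phi> V) \<and> smooth_near N p (\<lambda>q. \<eta> q (V q))) \<and>
        \<eta> p (\<xi> p) = 1 \<and>
        (\<forall>v\<in>T. \<phi> p (\<phi> p v) = v - \<eta> p v *\<^sub>R \<xi> p) \<and>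
        dim {v\<in>T. \<phi> p v = v} = n \<and> dim {v\<in>T. \<phi> p v = - v} = n)"

definition paracontact_metric ::
  "('p, 'e::euclidean_space) space \<Rightarrow> nat \<Rightarrow>
   'p endo_field \<Rightarrow> ('p \<Rightarrow> 'p tvec) \<Rightarrow> ('p \<Rightarrow> 'p tvec \<Rightarrow> real) \<Rightarrow>
   ('p \<Rightarrow> 'p tvec \<Rightarrow> 'p tvec \<Rightarrow> real) \<Rightarrow> bool" where
  "paracontact_metric N n \<phi> \<xi> \<eta> g \<longleftrightarrow>
     almost_paracontact N n \<phi> \<xi> \<eta> \<and> pseudo_riemannian_metric N g \<and>
     (\<forall>p\<in>points N.
        (\<forall>v\<in>tangent_space N p. \<forall>w\<in>tangent_space N p.
           g p (\<phi> p v) (\<phi> p w) = - g p v w + \<eta> p v * \<eta> p w) \<and>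
        (\<forall>V W. vector_field_near N p V \<and> vector_field_near N p W \<longrightarrow>
           exterior_derivative N \<eta> V W p = g p (V p) (\<phi> p (W p))))"

definition k_paracontact ::
  "('p, 'e::euclidean_space) space \<Rightarrow> nat \<Rightarrow>
   'p endo_field \<Rightarrow> ('p \<Rightarrow> 'p tvec) \<Rightarrow> ('p \<Rightarrow> 'p tvec \<Rightarrow> real) \<Rightarrow>
   ('p \<Rightarrow> 'p tvec \<Rightarrow> 'p tvec \<Rightarrow> real) \<Rightarrow> bool" where
  "k_paracontact N n \<phi> \<xi> \<eta> g \<longleftrightarrow> paracontact_metric N n \<phi> \<xi> \<eta> g \<and> killing_field N g \<xi>"

definition para_sasakian ::
  "('p, 'e::euclidean_space) space \<Rightarrow> nat \<Rightarrow>
   'p endo_field \<Rightarrow> ('p \<Rightarrow> 'p tvec) \<Rightarrow> ('p \<Rightarrow> 'p tvec \<Rightarrow> real) \<Rightarrow>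
   ('p \<Rightarrow> 'p tvec \<Rightarrow> 'p tvec \<Rightarrow> real) \<Rightarrow> bool" where
  "para_sasakian N n \<phi> \<xi> \<eta> g \<longleftrightarrow> paracontact_metric N n \<phi> \<xi> \<eta> g \<and>
     (\<forall>p\<in>points N. \<forall>V W. vector_field_near N p V \<and> vector_field_near N p W \<longrightarrow>
        nijenhuis N \<phi> V W p - (2 * exterior_derivative N \<eta> V W p) *\<^sub>R \<xi> p = 0)"


section \<open>The tangent bundle and the unit tangent sphere bundle\<close>

(* A chart \<phi> of M induces the chart (x, u) \<mapsto> (\<phi> x, u \<phi>), where u acts on \<phi> componentwise. *)

definition tangent_bundle ::
  "('a, 'e::euclidean_space) space \<Rightarrow> ('a \<times> 'a tvec, 'e \<times> 'e) space" where
  "tangent_bundle M =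
     \<lparr> points = Sigma (points M) (tangent_space M),
       charts = (\<lambda>(U, \<phi>). (Sigma U (tangent_space M),
                  \<lambda>(x, u). (\<phi> x, \<Sum>i\<in>Basis. u (\<lambda>y. \<phi> y \<bullet> i) *\<^sub>R i))) ` charts M \<rparr>"

definition unit_tangent_bundle ::
  "('a, 'e::euclidean_space) space \<Rightarrow> ('a \<Rightarrow> 'a tvec \<Rightarrow> 'a tvec \<Rightarrow> real) \<Rightarrow>
   ('a \<times> 'a tvec, 'e \<times> 'e) space" where
  "unit_tangent_bundle M g =
     (tangent_bundle M) \<lparr> points := {(x, u) \<in> points (tangent_bundle M). g x u u = 1} \<rparr>"

definition vertical_lift ::
  "('a, 'e::euclidean_space) space \<Rightarrow> 'a \<times> 'a tvec \<Rightarrow> 'a tvec \<Rightarrow> ('a \<times> 'a tvec) tvec" where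
  "vertical_lift M = (\<lambda>(x, u) Y F.
     if smooth_near (tangent_bundle M) (x, u) F then deriv (\<lambda>t::real. F (x, u + t *\<^sub>R Y)) 0 else 0)"

(* The horizontal lift of X to (x, u) is the image of X under the differential of a section Z of the
   tangent bundle with Z x = u that is parallel at x; it does not depend on the choice of Z. *)

definition horizontal_lift ::
  "('a, 'e::euclidean_space) space \<Rightarrow> 'a connection \<Rightarrow> 'a \<times> 'a tvec \<Rightarrow> 'a tvec \<Rightarrow>
   ('a \<times> 'a tvec) tvec" where
  "horizontal_lift M D = (\<lambda>(x, u) X F.
     let Z = (SOME Z. vector_field_near M x Z \<and> Z x = u \<and> (\<forall>v\<in>tangent_space M x. D x v Z = 0))
     in if smooth_near (tangent_bundle M) (x, u) F then X (\<lambda>y. F (y, Z y)) else 0)"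

(* A vector W of the tangent bundle at a unit vector p that is tangent to the unit tangent bundle acts
   on a function f on the unit tangent bundle through an arbitrary local extension of f; the extension
   used here is the one that is constant along rays.  For vectors W that are not tangent to the unit
   tangent bundle the radial component is discarded. *)

definition to_unit ::
  "('a, 'e::euclidean_space) space \<Rightarrow> ('a \<Rightarrow> 'a tvec \<Rightarrow> 'a tvec \<Rightarrow> real) \<Rightarrow> 'a \<times> 'a tvec \<Rightarrow>
   ('a \<times> 'a tvec) tvec \<Rightarrow> ('a \<times> 'a tvec) tvec" where
  "to_unit M g p W = (\<lambda>f. if smooth_near (unit_tangent_bundle M g) p f
     then W (\<lambda>(y, v). f (y, v /\<^sub>R sqrt (g y v v))) else 0)"

definition unit_hlift ::
  "('a, 'e::euclidean_space) space \<Rightarrow> ('a \<Rightarrow> 'a tvec \<Rightarrow> 'a tvec \<Rightarrow> real) \<Rightarrow> 'a connection \<Rightarrow>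
   'a \<times> 'a tvec \<Rightarrow> 'a tvec \<Rightarrow> ('a \<times> 'a tvec) tvec" where
  "unit_hlift M g D p X = to_unit M g p (horizontal_lift M D p X)"

(* Equal to the vertical lift only for Y orthogonal to the unit vector at which the lift is taken. *)

definition unit_vlift ::
  "('a, 'e::euclidean_space) space \<Rightarrow> ('a \<Rightarrow> 'a tvec \<Rightarrow> 'a tvec \<Rightarrow> real) \<Rightarrow>
   'a \<times> 'a tvec \<Rightarrow> 'a tvec \<Rightarrow> ('a \<times> 'a tvec) tvec" where
  "unit_vlift M g p Y = to_unit M g p (vertical_lift M p Y)"

definition tangential_lift ::
  "('a, 'e::euclidean_space) space \<Rightarrow> ('a \<Rightarrow> 'a tvec \<Rightarrow> 'a tvec \<Rightarrow> real) \<Rightarrow> 'a connection \<Rightarrow>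
   real \<Rightarrow> real \<Rightarrow> real \<Rightarrow> real \<Rightarrow> 'a \<times> 'a tvec \<Rightarrow> 'a tvec \<Rightarrow> ('a \<times> 'a tvec) tvec" where
  "tangential_lift M g D a b c d = (\<lambda>(x, u) X.
     to_unit M g (x, u)
       (vertical_lift M (x, u) X - g x X u *\<^sub>R vertical_lift M (x, u) u
          + (b / (a + c + d) * g x X u) *\<^sub>R horizontal_lift M D (x, u) u))"

definition g_natural_metric ::
  "('a, 'e::euclidean_space) space \<Rightarrow> ('a \<Rightarrow> 'a tvec \<Rightarrow> 'a tvec \<Rightarrow> real) \<Rightarrow> 'a connection \<Rightarrow>
   real \<Rightarrow> real \<Rightarrow> real \<Rightarrow> real \<Rightarrow>
   ('a \<times> 'a tvec \<Rightarrow> ('a \<times> 'a tvec) tvec \<Rightarrow> ('a \<times> 'a tvec) tvec \<Rightarrow> real) \<Rightarrow> bool" where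
  "g_natural_metric M g D a b c d G \<longleftrightarrow>
     pseudo_riemannian_metric (unit_tangent_bundle M g) G \<and>
     (\<forall>(x, u) \<in> points (unit_tangent_bundle M g).
        let H = unit_hlift M g D (x, u); V = unit_vlift M g (x, u) in
        (\<forall>X\<in>tangent_space M x. \<forall>X'\<in>tangent_space M x.
           G (x, u) (H X) (H X') = (a + c) * g x X X' + d * g x X u * g x X' u) \<and>
        (\<forall>X\<in>tangent_space M x. \<forall>Y\<in>tangent_space M x. g x Y u = 0 \<longrightarrow>
           G (x, u) (H X) (V Y) = b * g x X Y) \<and>
        (\<forall>Y\<in>tangent_space M x. \<forall>Y'\<in>tangent_space M x. g x Y u = 0 \<and> g x Y' u = 0 \<longrightarrow>
           G (x, u) (V Y) (V Y') = a * g x Y Y'))"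

definition g_natural_paracontact_metric ::
  "('a, 'e::euclidean_space) space \<Rightarrow> nat \<Rightarrow> ('a \<Rightarrow> 'a tvec \<Rightarrow> 'a tvec \<Rightarrow> real) \<Rightarrow> 'a connection \<Rightarrow>
   real \<Rightarrow> real \<Rightarrow> real \<Rightarrow> real \<Rightarrow>
   ('a \<times> 'a tvec) endo_field \<Rightarrow> ('a \<times> 'a tvec \<Rightarrow> ('a \<times> 'a tvec) tvec) \<Rightarrow>
   ('a \<times> 'a tvec \<Rightarrow> ('a \<times> 'a tvec) tvec \<Rightarrow> real) \<Rightarrow>
   ('a \<times> 'a tvec \<Rightarrow> ('a \<times> 'a tvec) tvec \<Rightarrow> ('a \<times> 'a tvec) tvec \<Rightarrow> real) \<Rightarrow> bool" where
  "g_natural_paracontact_metric M n g D a b c d \<phi> \<xi> \<eta> G \<longleftrightarrow>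
     paracontact_metric (unit_tangent_bundle M g) n \<phi> \<xi> \<eta> G \<and>
     g_natural_metric M g D a b c d G \<and>
     (\<exists>\<rho>>0. let \<alpha> = a * (a + c) - b\<^sup>2; \<phi>\<^sub>0 = a * (a + c + d) - b\<^sup>2 in
        a + c + d = - 4 * \<alpha> \<and> a + c + d = 1 / \<rho>\<^sup>2 \<and>
        (\<forall>(x, u) \<in> points (unit_tangent_bundle M g).
           let H = unit_hlift M g D (x, u); T = tangential_lift M g D a b c d (x, u) in
           \<xi> (x, u) = \<rho> *\<^sub>R H u \<and>
           (\<forall>X\<in>tangent_space M x.
              \<eta> (x, u) (H X) = 1 / \<rho> * g x X u \<and>
              \<eta> (x, u) (T X) = b * \<rho> * g x X u \<and>
              \<phi> (x, u) (H X) = (1 / (2 * \<rho> * \<alpha>)) *\<^sub>R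
                (- b *\<^sub>R H X + (a + c) *\<^sub>R T X + (b * d / (a + c + d) * g x X u) *\<^sub>R H u) \<and>
              \<phi> (x, u) (T X) = (1 / (2 * \<rho> * \<alpha>)) *\<^sub>R
                (- a *\<^sub>R H X + b *\<^sub>R T X + (\<phi>\<^sub>0 / (a + c + d) * g x X u) *\<^sub>R H u))))"

end

theory Submission
  imports Defs
begin

text \<open>A tangent vector of the unit tangent bundle is determined by its action on the functions \<open>f \<circ> \<pi>\<close>
  and on the fibrewise linear functions \<open>u \<mapsto> \<langle>Z, u\<rangle>\<close>.  Horizontal lifts send these to \<open>X f\<close> and
  \<open>\<langle>\<nabla>\<^sub>X Z, u\<rangle>\<close>, vertical lifts to \<open>0\<close> and \<open>\<langle>X, Z\<rangle> - \<langle>X, u\<rangle> \<langle>Z, u\<rangle>\<close>.  All brackets of lifts follow;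
  the curvature of \<open>M\<close> enters as the vertical part of the bracket of two horizontal lifts.

  The implication from paraSasakian to \<open>K\<close>-paracontact holds for all paracontact metric structures: the
  torsion evaluated at \<open>(V, \<xi>)\<close> shows \<open>L\<^sub>\<xi> \<phi> = 0\<close>, and \<open>L\<^sub>\<xi> (d\<eta>) = 0\<close> then makes \<open>\<xi>\<close> Killing.
  If \<open>\<xi>\<close> is Killing, then for \<open>Y\<close> orthogonal to \<open>u\<close> the equation \<open>L\<^sub>\<xi> G = 0\<close> reads
  \<open>b \<langle>Y, Y\<rangle> = 0\<close> on the pair \<open>(Y\<^sup>v, Y\<^sup>v)\<close> and, for \<open>b = 0\<close>,
  \<open>a \<langle>R(Y, u)u, Y\<rangle> = (a + c) \<langle>Y, Y\<rangle>\<close> on the pair \<open>(Y\<^sup>h, Y\<^sup>v)\<close>.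
  Conversely, if \<open>b = 0\<close> and \<open>M\<close> has constant curvature \<open>(a + c) / a\<close>, then the torsion vanishes on pairs of
  horizontal lifts, and this is enough since \<open>X\<^sup>h\<close> and \<open>\<phi> X\<^sup>h\<close> span the tangent spaces.\<close>

section \<open>Calculus of smooth functions\<close>

text \<open>Tangent vectors are derivations, so an identity between vectors is checked on
  sufficiently many functions; that coordinate functions suffice is Hadamard's lemma. The unit
  tangent bundle keeps the charts of the tangent bundle and only has fewer points, so its charts
  have one coordinate too many. In place of a coordinate frame it is spanned by lifts of coordinate
  fields of \<open>M\<close>, which are linearly dependent. The geodesic flow lifts \<open>u\<close>
  itself and is not the lift of a field on \<open>M\<close>; its brackets come from expanding it in
  lifted coordinate fields with the fibre coordinates as coefficients. The curvature value stems
  from one constant. For \<open>b = 0\<close>, \<phi> sends X^h to \<open>k1\<close> times X^v, and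
  the normalisation of the structure gives k1^2 = -(a + c)/a. In the torsion of X^h and Y^h, the
  bracket of the horizontal lifts contributes the vertical lift of -R(X,Y)u, and that of the
  vertical lifts contributes k1^2 (<X,u> Y^v - <Y,u> X^v); these cancel for curvature (a + c)/a. The
  same normalisation makes a (a + c) negative.\<close>

lemma Ck_on_transfer:
  "Ck_on k S f \<Longrightarrow> open S \<Longrightarrow> (\<And>x. x \<in> S \<Longrightarrow> f x = h x) \<Longrightarrow> Ck_on k S h"
proof (induction k arbitrary: f h)
  case 0
  then show ?case using continuous_on_eq by auto
next
  case (Suc k)
  have d: "(f has_derivative frechet_derivative f (at x)) (at x)" if "x \<in> S" for x
    using Suc.prems(1) that frechet_derivative_works by auto
  have dh: "(h has_derivative frechet_derivative f (at x)) (at x)" if "x \<in> S" for x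
    using has_derivative_transform_within_open[OF d[OF that] Suc.prems(2) that] Suc.prems(3) by auto
  have eq: "frechet_derivative h (at x) = frechet_derivative f (at x)" if "x \<in> S" for x
    using frechet_derivative_at[OF dh[OF that]] by simp
  have "Ck_on k S (\<lambda>x. frechet_derivative h (at x) v)" for v
    using Suc.IH[of "\<lambda>x. frechet_derivative f (at x) v"] Suc.prems eq by auto
  then show ?case using dh by (auto simp: differentiable_def)
qed

text \<open>Derivatives are unique, so any explicitly given family \<open>f'\<close> may replace
  \<open>frechet_derivative\<close> in the recursion. All closure properties below go through this
  rule.\<close>

lemma Ck_on_SucI:
  assumes "open S" "\<And>x. x \<in> S \<Longrightarrow> (f has_derivative f' x) (at x)"
    and "\<And>v. Ck_on k S (\<lambda>x. f' x v)"
  shows "Ck_on (Suc k) S f"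
proof -
  have eq: "f' x = frechet_derivative f (at x)" if "x \<in> S" for x
    using frechet_derivative_at[OF assms(2)[OF that]] .
  have "Ck_on k S (\<lambda>x. frechet_derivative f (at x) v)" for v
    by (rule Ck_on_transfer[OF assms(3)[of v] assms(1)]) (simp add: eq)
  then show ?thesis using assms(2) by (auto simp: differentiable_def)
qed

lemma Ck_on_has_derivative:
  "Ck_on (Suc k) S f \<Longrightarrow> x \<in> S \<Longrightarrow> (f has_derivative frechet_derivative f (at x)) (at x)"
  using frechet_derivative_works by auto

lemma Ck_on_subset: "Ck_on k S f \<Longrightarrow> T \<subseteq> S \<Longrightarrow> Ck_on k T f"
  by (induction k arbitrary: f) (auto intro: continuous_on_subset)

lemma Ck_on_Suc_imp: "Ck_on (Suc k) S f \<Longrightarrow> Ck_on k S f"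
proof (induction k arbitrary: f)
  case 0
  then show ?case
    by (auto intro!: continuous_at_imp_continuous_on differentiable_imp_continuous_within)
qed auto

lemma Ck_on_const: "open S \<Longrightarrow> Ck_on k S (\<lambda>x. c)"
proof (induction k arbitrary: c)
  case (Suc k)
  show ?case by (rule Ck_on_SucI[where f' = "\<lambda>x v. 0"]) (use Suc in auto)
qed auto

lemma Ck_on_linear: "bounded_linear f \<Longrightarrow> open S \<Longrightarrow> Ck_on k S f"
proof (cases k)
  case 0
  assume "bounded_linear f"
  then show ?thesis using 0 by (simp add: linear_continuous_on)
next
  case (Suc m)
  assume "bounded_linear f" "open S"
  then show ?thesis unfolding Suc
    by (intro Ck_on_SucI[where f' = "\<lambda>x v. f v"] bounded_linear_imp_has_derivative Ck_on_const)
qed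

lemma Ck_on_add: "Ck_on k S f \<Longrightarrow> Ck_on k S h \<Longrightarrow> open S \<Longrightarrow> Ck_on k S (\<lambda>x. f x + h x)"
proof (induction k arbitrary: f h)
  case (Suc k)
  show ?case
    by (rule Ck_on_SucI[where f' = "\<lambda>x v. frechet_derivative f (at x) v + frechet_derivative h (at x) v"])
      (use Suc in \<open>auto intro!: derivative_intros Ck_on_has_derivative[OF Suc.prems(1)]
          Ck_on_has_derivative[OF Suc.prems(2)]\<close>)
qed (auto intro: continuous_intros)

lemma Ck_on_bilinear:
  assumes "bounded_bilinear B"
  shows "Ck_on k S f \<Longrightarrow> Ck_on k S h \<Longrightarrow> open S \<Longrightarrow> Ck_on k S (\<lambda>x. B (f x) (h x))"
proof (induction k arbitrary: f h)
  case 0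
  then show ?case using bounded_bilinear.continuous_on[OF assms] by auto
next
  case (Suc k)
  show ?case
  proof (rule Ck_on_SucI[where f' = "\<lambda>x v. B (f x) (frechet_derivative h (at x) v)
        + B (frechet_derivative f (at x) v) (h x)"])
    show "open S" by fact
    fix x assume "x \<in> S"
    then show "((\<lambda>x. B (f x) (h x)) has_derivative (\<lambda>v. B (f x) (frechet_derivative h (at x) v)
        + B (frechet_derivative f (at x) v) (h x))) (at x)"
      by (intro bounded_bilinear.FDERIV[OF assms] Ck_on_has_derivative[OF Suc.prems(1)]
          Ck_on_has_derivative[OF Suc.prems(2)])
  next
    fix v
    have f: "Ck_on k S f" and h: "Ck_on k S h" using Suc.prems(1,2)[THEN Ck_on_Suc_imp] .
    show "Ck_on k S (\<lambda>x. B (f x) (frechet_derivative h (at x) v) + B (frechet_derivative f (at x) v) (h x))"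
      by (rule Ck_on_add[OF Suc.IH[OF f _ Suc.prems(3)] Suc.IH[OF _ h Suc.prems(3)] Suc.prems(3)])
        (use Suc.prems in auto)
  qed
qed

lemmas Ck_on_scaleR = Ck_on_bilinear[OF bounded_bilinear_scaleR]

lemma Ck_on_sum:
  "finite I \<Longrightarrow> open S \<Longrightarrow> (\<And>i. i \<in> I \<Longrightarrow> Ck_on k S (f i)) \<Longrightarrow> Ck_on k S (\<lambda>x. \<Sum>i\<in>I. f i x)"
  by (induction I rule: finite_induct) (auto intro: Ck_on_const Ck_on_add)

lemma Ck_on_compose:
  fixes f :: "'b::euclidean_space \<Rightarrow> 'c::real_normed_vector" and h :: "'a::real_normed_vector \<Rightarrow> 'b"
  shows "Ck_on k T f \<Longrightarrow> Ck_on k S h \<Longrightarrow> open S \<Longrightarrow> open T \<Longrightarrow> h ` S \<subseteq> T \<Longrightarrow> Ck_on k S (\<lambda>x. f (h x))"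
proof (induction k arbitrary: f h)
  case 0
  then show ?case by (auto intro: continuous_on_compose2)
next
  case (Suc k)
  \<comment> \<open>The direction \<open>frechet_derivative h (at x) v\<close> in the chain rule
    moves with \<open>x\<close>, whereas \<open>Ck_on\<close> speaks of derivatives in a fixed
    direction. Expanding it in the basis leaves only fixed directions.\<close>
  define f' where "f' x v = (\<Sum>i\<in>Basis. (frechet_derivative h (at x) v \<bullet> i) *\<^sub>R frechet_derivative f (at (h x)) i)" for x v
  have h: "Ck_on k S h" using Suc.prems(2) by (rule Ck_on_Suc_imp)
  show ?case
  proof (rule Ck_on_SucI[where f' = f'])
    show "open S" by fact
    fix x assume x: "x \<in> S"
    have df: "(f has_derivative frechet_derivative f (at (h x))) (at (h x))"
      using Ck_on_has_derivative[OF Suc.prems(1)] x Suc.prems(5) by auto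
    then have lin: "linear (frechet_derivative f (at (h x)))" by (rule has_derivative_linear)
    have "frechet_derivative f (at (h x)) w = (\<Sum>i\<in>Basis. (w \<bullet> i) *\<^sub>R frechet_derivative f (at (h x)) i)" for w
      by (subst (1) euclidean_representation[of w, symmetric])
         (simp only: linear_sum[OF lin] linear_scale[OF lin])
    from this[symmetric] have "f' x = (\<lambda>v. frechet_derivative f (at (h x)) (frechet_derivative h (at x) v))"
      unfolding f'_def by (rule ext)
    then show "((\<lambda>x. f (h x)) has_derivative f' x) (at x)"
      using has_derivative_compose[OF Ck_on_has_derivative[OF Suc.prems(2) x] df] by simp
  next
    fix v
    have "Ck_on k S (\<lambda>x. frechet_derivative f (at (h x)) i)" for i
      by (rule Suc.IH[OF _ h]) (use Suc.prems in auto)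
    moreover have "Ck_on k S (\<lambda>x. frechet_derivative h (at x) v \<bullet> i)" for i
      by (rule Ck_on_bilinear[OF bounded_bilinear_inner]) (use Suc.prems in \<open>auto intro: Ck_on_const\<close>)
    ultimately show "Ck_on k S (\<lambda>x. f' x v)" unfolding f'_def
      by (intro Ck_on_sum Ck_on_scaleR) (use Suc.prems in auto)
  qed
qed

section \<open>Smooth functions on open sets\<close>

lemma smooth_on_transfer:
  "smooth_on S f \<Longrightarrow> open S \<Longrightarrow> (\<And>x. x \<in> S \<Longrightarrow> f x = h x) \<Longrightarrow> smooth_on S h"
  unfolding smooth_on_def using Ck_on_transfer by blast

lemma smooth_on_subset: "smooth_on S f \<Longrightarrow> T \<subseteq> S \<Longrightarrow> smooth_on T f"
  unfolding smooth_on_def using Ck_on_subset by blast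

lemma smooth_on_continuous: "smooth_on S f \<Longrightarrow> continuous_on S f"
  unfolding smooth_on_def using Ck_on.simps(1) by blast

lemma smooth_on_const: "open S \<Longrightarrow> smooth_on S (\<lambda>x. c)"
  by (simp add: smooth_on_def Ck_on_const)

lemma smooth_on_linear: "bounded_linear f \<Longrightarrow> open S \<Longrightarrow> smooth_on S f"
  by (simp add: smooth_on_def Ck_on_linear)

lemma smooth_on_add: "smooth_on S f \<Longrightarrow> smooth_on S h \<Longrightarrow> open S \<Longrightarrow> smooth_on S (\<lambda>x. f x + h x)"
  by (simp add: smooth_on_def Ck_on_add)

lemma smooth_on_bilinear:
  "bounded_bilinear B \<Longrightarrow> smooth_on S f \<Longrightarrow> smooth_on S h \<Longrightarrow> open S \<Longrightarrow> smooth_on S (\<lambda>x. B (f x) (h x))"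
  by (simp add: smooth_on_def Ck_on_bilinear)

lemmas smooth_on_scaleR = smooth_on_bilinear[OF bounded_bilinear_scaleR]
lemmas smooth_on_mult = smooth_on_bilinear[OF bounded_bilinear_mult]

lemma smooth_on_inner: "smooth_on S f \<Longrightarrow> open S \<Longrightarrow> smooth_on S (\<lambda>x. f x \<bullet> i)"
  by (rule smooth_on_bilinear[OF bounded_bilinear_inner]) (auto intro: smooth_on_const)

lemma smooth_on_sum:
  "finite I \<Longrightarrow> open S \<Longrightarrow> (\<And>i. i \<in> I \<Longrightarrow> smooth_on S (f i)) \<Longrightarrow> smooth_on S (\<lambda>x. \<Sum>i\<in>I. f i x)"
  by (simp add: smooth_on_def Ck_on_sum)

lemma smooth_on_compose:
  fixes f :: "'b::euclidean_space \<Rightarrow> 'c::real_normed_vector" and h :: "'a::real_normed_vector \<Rightarrow> 'b"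
  shows "smooth_on T f \<Longrightarrow> smooth_on S h \<Longrightarrow> open S \<Longrightarrow> open T \<Longrightarrow> h ` S \<subseteq> T \<Longrightarrow> smooth_on S (\<lambda>x. f (h x))"
  by (auto simp: smooth_on_def intro: Ck_on_compose)

lemma smooth_on_components:
  fixes f :: "'a::real_normed_vector \<Rightarrow> 'b::euclidean_space"
  assumes "open S" "\<And>i. i \<in> Basis \<Longrightarrow> smooth_on S (\<lambda>x. f x \<bullet> i)"
  shows "smooth_on S f"
proof (rule smooth_on_transfer)
  show "smooth_on S (\<lambda>x. \<Sum>i\<in>Basis. (f x \<bullet> i) *\<^sub>R i)"
    using assms by (intro smooth_on_sum smooth_on_scaleR smooth_on_const) auto
qed (auto simp: assms euclidean_representation)

lemma smooth_on_has_derivative: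
  "smooth_on S f \<Longrightarrow> x \<in> S \<Longrightarrow> (f has_derivative frechet_derivative f (at x)) (at x)"
  unfolding smooth_on_def using Ck_on_has_derivative by blast

lemma smooth_on_derivative:
  "smooth_on S f \<Longrightarrow> smooth_on S (\<lambda>x. frechet_derivative f (at x) v)"
  unfolding smooth_on_def using Ck_on.simps(2) by blast

text \<open>Used with exponent -1/2 to normalise vectors. The proof carries a coefficient because
  the functions \<open>c * t powr p\<close>, unlike the bare powers, are closed under
  differentiation.\<close>

lemma smooth_on_powr: "smooth_on {0<..} (\<lambda>t::real. t powr p)"
proof -
  have "Ck_on k {0<..} (\<lambda>t::real. c * t powr p)" for k c p
  proof (induction k arbitrary: c p)
    case 0
    show ?case by (auto intro!: continuous_intros)
  next
    case (Suc k)
    have "((\<lambda>t. c * t powr p) has_derivative (\<lambda>v. (v * (c * p)) * x powr (p - 1))) (at x)" if "x > 0" for x :: real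
    proof -
      have "((\<lambda>t. c * t powr p) has_real_derivative c * (p * x powr (p - 1))) (at x)"
        by (intro DERIV_cmult has_real_derivative_powr that)
      moreover have "(*) (c * (p * x powr (p - 1))) = (\<lambda>v. (v * (c * p)) * x powr (p - 1))"
        by (simp add: fun_eq_iff)
      ultimately show ?thesis by (simp add: has_field_derivative_def)
    qed
    then show ?case
      by (intro Ck_on_SucI[where f' = "\<lambda>x v. (v * (c * p)) * x powr (p - 1)"] Suc.IH) auto
  qed
  from this[of _ 1] show ?thesis by (simp add: smooth_on_def)
qed

text \<open>Each differentiation in \<open>z\<close> under the integral sign produces a factor
  \<open>t\<close> and replaces \<open>F\<close> by a directional derivative. The weight
  \<open>t ^ m\<close> and the function \<open>F\<close> therefore vary in the induction.\<close>

lemma smooth_on_ray_integral: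
  fixes F :: "'e::euclidean_space \<Rightarrow> real"
  assumes "smooth_on (ball z0 r) F"
  shows "smooth_on (ball z0 r) (\<lambda>z. integral {0..1} (\<lambda>t::real. t ^ m * F (z0 + t *\<^sub>R (z - z0))))"
proof -
  let ?B = "ball z0 r"
  have ray: "z0 + t *\<^sub>R (z - z0) \<in> ?B" if "z \<in> ?B" "t \<in> {0..1}" for z and t :: real
  proof -
    have "norm (t *\<^sub>R (z - z0)) \<le> norm (z - z0)"
      using that by (simp add: mult_left_le_one_le)
    then show ?thesis using that by (auto simp: dist_norm norm_minus_commute)
  qed
  have cont: "continuous_on (?B \<times> {0..1}) (\<lambda>(z, t). t ^ m * F (z0 + t *\<^sub>R (z - z0)))"
    if "smooth_on ?B F" for F :: "'e \<Rightarrow> real" and m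
    unfolding case_prod_beta
    by (intro continuous_intros continuous_on_compose2[OF smooth_on_continuous[OF that]]) (use ray in force)
  have "Ck_on k ?B (\<lambda>z. integral {0..1} (\<lambda>t::real. t ^ m * F (z0 + t *\<^sub>R (z - z0))))"
    if "smooth_on ?B F" for F :: "'e \<Rightarrow> real" and k m
    using that
  proof (induction k arbitrary: F m)
    case 0
    show ?case
      using integral_continuous_on_param[of ?B 0 1 "\<lambda>z t. t ^ m * F (z0 + t *\<^sub>R (z - z0))"] cont[OF 0]
      by simp
  next
    case (Suc k)
    \<comment> \<open>\<open>leibniz_rule\<close> takes the derivative of the integrand as a bounded
      linear operator that is continuous in both variables. \<open>Blinfun\<close> is meaningful
      only where the map is bounded linear, so \<open>fx\<close> is evaluated for \<open>z\<close>
      in the ball and \<open>t\<close> in the unit interval only.\<close>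
    define fx where "fx z t = Blinfun (\<lambda>v. t ^ Suc m * frechet_derivative F (at (z0 + t *\<^sub>R (z - z0))) v)" for z and t :: real
    have bl: "bounded_linear (\<lambda>v. t ^ Suc m * frechet_derivative F (at (z0 + t *\<^sub>R (z - z0))) v)"
      if "z \<in> ?B" "t \<in> {0..1}" for z t
      by (intro bounded_linear_const_mult has_derivative_bounded_linear[OF smooth_on_has_derivative[OF Suc.prems ray[OF that]]])
    have fx: "fx z t v = t ^ Suc m * frechet_derivative F (at (z0 + t *\<^sub>R (z - z0))) v"
      if "z \<in> ?B" "t \<in> {0..1}" for z t v
      unfolding fx_def using bounded_linear_Blinfun_apply[OF bl[OF that]] by simp
    have cfx: "continuous_on (?B \<times> cbox 0 1) (\<lambda>(z, t). fx z t)"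
      unfolding case_prod_beta
    proof (rule continuous_on_blinfun_componentwise)
      fix i :: 'e assume "i \<in> Basis"
      have "continuous_on (?B \<times> cbox 0 1) (\<lambda>(z, t). t ^ Suc m * frechet_derivative F (at (z0 + t *\<^sub>R (z - z0))) i)"
        using cont[OF smooth_on_derivative[OF Suc.prems, of i], of "Suc m"] by (simp only: cbox_interval)
      then show "continuous_on (?B \<times> cbox 0 1) (\<lambda>x. blinfun_apply (fx (fst x) (snd x)) i)"
        by (rule continuous_on_eq) (simp add: case_prod_beta fx mem_Times_iff del: power_Suc)
    qed
    have der: "((\<lambda>z. integral {0..1} (\<lambda>t::real. t ^ m * F (z0 + t *\<^sub>R (z - z0)))) has_derivative
       (\<lambda>v. integral {0..1} (\<lambda>t. t ^ Suc m * frechet_derivative F (at (z0 + t *\<^sub>R (z - z0))) v))) (at z)"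
      if z: "z \<in> ?B" for z
    proof -
      have "((\<lambda>z. integral (cbox 0 1) (\<lambda>t::real. t ^ m * F (z0 + t *\<^sub>R (z - z0)))) has_derivative
         integral (cbox 0 1) (fx z)) (at z within ?B)"
      proof (rule leibniz_rule[OF _ _ cfx z convex_ball])
        fix x and t :: real assume x: "x \<in> ?B" and t: "t \<in> cbox 0 1"
        have a: "((\<lambda>x. z0 + t *\<^sub>R (x - z0)) has_derivative (\<lambda>v. t *\<^sub>R v)) (at x)"
          by (auto intro!: derivative_eq_intros simp: algebra_simps)
        have dF: "(F has_derivative frechet_derivative F (at (z0 + t *\<^sub>R (x - z0)))) (at (z0 + t *\<^sub>R (x - z0)))"
          using smooth_on_has_derivative[OF Suc.prems ray[OF x]] t by simp
        have "((\<lambda>x. t ^ m * F (z0 + t *\<^sub>R (x - z0))) has_derivative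
            (\<lambda>v. t ^ m * frechet_derivative F (at (z0 + t *\<^sub>R (x - z0))) (t *\<^sub>R v))) (at x)"
          by (intro has_derivative_mult_right has_derivative_compose[OF a dF])
        moreover have "(\<lambda>v. t ^ m * frechet_derivative F (at (z0 + t *\<^sub>R (x - z0))) (t *\<^sub>R v)) = blinfun_apply (fx x t)"
          using fx[OF x, of t] t linear_scale[OF has_derivative_linear[OF dF]] by (auto simp: algebra_simps)
        ultimately show "((\<lambda>x. t ^ m * F (z0 + t *\<^sub>R (x - z0))) has_derivative blinfun_apply (fx x t)) (at x within ?B)"
          using has_derivative_at_withinI by metis
      next
        fix x assume "x \<in> ?B"
        then show "(\<lambda>t. t ^ m * F (z0 + t *\<^sub>R (x - z0))) integrable_on cbox 0 1"
          by (intro integrable_continuous continuous_intros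
              continuous_on_compose2[OF smooth_on_continuous[OF Suc.prems]]) (use ray in force)
      qed
      moreover have "blinfun_apply (integral (cbox 0 1) (fx z)) v =
          integral (cbox 0 1) (\<lambda>t. t ^ Suc m * frechet_derivative F (at (z0 + t *\<^sub>R (z - z0))) v)" for v
      proof -
        have sub: "Pair z ` cbox 0 1 \<subseteq> ?B \<times> cbox 0 1" using z by auto
        have "continuous_on (cbox 0 1) (Pair z)" by (intro continuous_intros)
        from continuous_on_compose[OF this continuous_on_subset[OF cfx sub]]
        have "continuous_on (cbox 0 1) (fx z)" by (simp add: comp_def)
        then have "fx z integrable_on cbox 0 1" by (rule integrable_continuous)
        then have "blinfun_apply (integral (cbox 0 1) (fx z)) v = integral (cbox 0 1) (\<lambda>t. fx z t v)"
          by (simp add: blinfun_apply_integral)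
        also have "\<dots> = integral (cbox 0 1) (\<lambda>t. t ^ Suc m * frechet_derivative F (at (z0 + t *\<^sub>R (z - z0))) v)"
          using fx[OF z] by (intro integral_cong) auto
        finally show ?thesis .
      qed
      then have "blinfun_apply (integral (cbox 0 1) (fx z)) =
          (\<lambda>v. integral (cbox 0 1) (\<lambda>t. t ^ Suc m * frechet_derivative F (at (z0 + t *\<^sub>R (z - z0))) v))"
        by (rule ext)
      ultimately show ?thesis by (simp only: at_within_open[OF z open_ball] cbox_interval)
    qed
    show ?case
      by (rule Ck_on_SucI[OF _ der]) (auto intro: Suc.IH[OF smooth_on_derivative[OF Suc.prems], of "Suc m", simplified])
  qed
  then show ?thesis using assms by (simp add: smooth_on_def)
qed

text \<open>The fundamental theorem of calculus along the ray from \<open>z0\<close> to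
  \<open>z\<close> writes the increment of \<open>F\<close> as the integral of its derivative, and
  the coordinates of \<open>z - z0\<close> come out of the integral. This is what lets the Leibniz
  rule alone determine a derivation from its values on coordinates.\<close>

lemma hadamard:
  fixes F :: "'e::euclidean_space \<Rightarrow> real"
  assumes F: "smooth_on W F" and "open W" "z0 \<in> W"
  obtains r K where "r > 0" "ball z0 r \<subseteq> W" "\<And>i. smooth_on (ball z0 r) (K i)"
    "\<And>i. K i z0 = frechet_derivative F (at z0) i"
    "\<And>z. z \<in> ball z0 r \<Longrightarrow> F z = F z0 + (\<Sum>i\<in>Basis. ((z - z0) \<bullet> i) * K i z)"
proof -
  obtain r where r: "r > 0" "ball z0 r \<subseteq> W" using assms openE by blast
  have FB: "smooth_on (ball z0 r) F" using smooth_on_subset[OF F r(2)] .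
  define K where "K i z = integral {0..1} (\<lambda>t::real. frechet_derivative F (at (z0 + t *\<^sub>R (z - z0))) i)" for i z
  have K: "smooth_on (ball z0 r) (K i)" for i
    using smooth_on_ray_integral[OF smooth_on_derivative[OF FB], of 0 i] by (simp add: K_def[abs_def])
  have K0: "K i z0 = frechet_derivative F (at z0) i" for i by (simp add: K_def)
  have "F z = F z0 + (\<Sum>i\<in>Basis. ((z - z0) \<bullet> i) * K i z)" if z: "z \<in> ball z0 r" for z
  proof -
    have ray: "z0 + t *\<^sub>R (z - z0) \<in> ball z0 r" if "t \<in> {0..1}" for t :: real
    proof -
      have "norm (t *\<^sub>R (z - z0)) \<le> norm (z - z0)"
        using that by (simp add: mult_left_le_one_le)
      then show ?thesis using z by (auto simp: dist_norm norm_minus_commute)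
    qed
    define f' where "f' t = (\<Sum>i\<in>Basis. ((z - z0) \<bullet> i) * frechet_derivative F (at (z0 + t *\<^sub>R (z - z0))) i)" for t :: real
    have "((\<lambda>t. F (z0 + t *\<^sub>R (z - z0))) has_vector_derivative f' t) (at t within {0..1})" if t: "t \<in> {0..1}" for t
    proof -
      have dF: "(F has_derivative frechet_derivative F (at (z0 + t *\<^sub>R (z - z0)))) (at (z0 + t *\<^sub>R (z - z0)))"
        using smooth_on_has_derivative[OF FB ray[OF t]] by simp
      have a: "((\<lambda>t. z0 + t *\<^sub>R (z - z0)) has_derivative (\<lambda>s. s *\<^sub>R (z - z0))) (at t)"
        by (auto intro!: derivative_eq_intros)
      have lin: "linear (frechet_derivative F (at (z0 + t *\<^sub>R (z - z0))))"
        using dF by (rule has_derivative_linear)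
      have "frechet_derivative F (at (z0 + t *\<^sub>R (z - z0))) w =
          (\<Sum>i\<in>Basis. (w \<bullet> i) * frechet_derivative F (at (z0 + t *\<^sub>R (z - z0))) i)" for w
        by (subst (1) euclidean_representation[of w, symmetric])
           (simp only: linear_sum[OF lin] linear_scale[OF lin] real_scaleR_def)
      then have "frechet_derivative F (at (z0 + t *\<^sub>R (z - z0))) (z - z0) = f' t"
        unfolding f'_def .
      then have "(\<lambda>s. frechet_derivative F (at (z0 + t *\<^sub>R (z - z0))) (s *\<^sub>R (z - z0))) = (\<lambda>s. s *\<^sub>R f' t)"
        by (simp add: linear_scale[OF lin])
      then show ?thesis unfolding has_vector_derivative_def
        using has_derivative_at_withinI[OF has_derivative_compose[OF a dF]] by simp
    qed
    then have I: "(f' has_integral (F z - F z0)) {0..1}"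
      using fundamental_theorem_of_calculus[of 0 1 "\<lambda>t. F (z0 + t *\<^sub>R (z - z0))" f'] by simp
    have int: "(\<lambda>t. frechet_derivative F (at (z0 + t *\<^sub>R (z - z0))) i) integrable_on {0..1}" for i
      by (intro integrable_continuous_real continuous_on_compose2[OF smooth_on_continuous[OF smooth_on_derivative[OF FB, of i]]]
          continuous_intros) (use ray in auto)
    have "integral {0..1} f' = (\<Sum>i\<in>Basis. ((z - z0) \<bullet> i) * K i z)"
      unfolding f'_def K_def
      by (subst integral_sum) (auto intro!: integrable_on_mult_right int)
    then show ?thesis using integral_unique[OF I] by simp
  qed
  then show ?thesis using that r K K0 by blast
qed

section \<open>Germs, tangent vectors and vector fields\<close>

lemma sum_fun_apply: "(\<Sum>i\<in>I. f i) x = (\<Sum>i\<in>I. f i x)"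
  by (induction I rule: infinite_finite_induct) auto

lemma scaleR_fun_apply [simp]: "(r *\<^sub>R f) x = r *\<^sub>R f x"
  by (simp add: scaleR_fun_def)

text \<open>As a filter, nearness can be combined by \<open>eventually_elim\<close>. That
  \<open>near N p\<close> is a filter depends on the compatibility of charts and is shown in
  \<open>eventually_near\<close>.\<close>

definition nhdf :: "('p, 'e::euclidean_space) space \<Rightarrow> 'p \<Rightarrow> 'p filter" where
  "nhdf N p = Abs_filter (near N p)"

text \<open>A common ground for \<open>M\<close>, its tangent bundle and the unit tangent bundle. A
  coordinate change has to agree with a smooth map only at images of points of \<open>N\<close>,
  which permits charts of a larger manifold.\<close>

locale smooth_space =
  fixes N :: "('p, 'e::euclidean_space) space"
  assumes covered: "p \<in> points N \<Longrightarrow> \<exists>(U, \<phi>)\<in>charts N. p \<in> U"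
    and compatible: "(U, \<phi>) \<in> charts N \<Longrightarrow> (V, \<psi>) \<in> charts N \<Longrightarrow> p \<in> U \<Longrightarrow> p \<in> V \<Longrightarrow> p \<in> points N \<Longrightarrow>
       \<exists>W \<tau>. open W \<and> \<phi> p \<in> W \<and> smooth_on W \<tau> \<and> (\<forall>q\<in>U \<inter> points N. \<phi> q \<in> W \<longrightarrow> q \<in> V \<and> \<psi> q = \<tau> (\<phi> q))"
begin

lemma chart_at: "p \<in> points N \<Longrightarrow> (\<And>U \<phi>. (U, \<phi>) \<in> charts N \<Longrightarrow> p \<in> U \<Longrightarrow> P) \<Longrightarrow> P"
  using covered by blast

text \<open>The coordinate change pulls a neighbourhood back from the chart provided by the
  definition to the given one. Hence one chart at \<open>p\<close> can be fixed and used for all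
  neighbourhoods.\<close>

lemma near_chart:
  assumes p: "p \<in> points N" "(U, \<phi>) \<in> charts N" "p \<in> U"
  shows "near N p P \<longleftrightarrow> (\<exists>W. open W \<and> \<phi> p \<in> W \<and> (\<forall>q\<in>U \<inter> points N. \<phi> q \<in> W \<longrightarrow> P q))"
proof
  assume "near N p P"
  then obtain V \<psi> W' where V: "(V, \<psi>) \<in> charts N" "p \<in> V"
    and W': "open W'" "\<psi> p \<in> W'" "\<forall>q\<in>V \<inter> points N. \<psi> q \<in> W' \<longrightarrow> P q"
    unfolding near_def by blast
  obtain W \<tau> where W: "open W" "\<phi> p \<in> W" "smooth_on W \<tau>"
    "\<forall>q\<in>U \<inter> points N. \<phi> q \<in> W \<longrightarrow> q \<in> V \<and> \<psi> q = \<tau> (\<phi> q)"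
    using compatible[OF p(2) V(1) p(3) V(2) p(1)] by blast
  have "open (W \<inter> \<tau> -` W')"
    using continuous_open_preimage[OF smooth_on_continuous[OF W(3)] W(1) W'(1)] .
  moreover have "\<phi> p \<in> W \<inter> \<tau> -` W'" using W W' p by auto
  moreover have "\<forall>q\<in>U \<inter> points N. \<phi> q \<in> W \<inter> \<tau> -` W' \<longrightarrow> P q" using W W' by auto
  ultimately show "\<exists>W. open W \<and> \<phi> p \<in> W \<and> (\<forall>q\<in>U \<inter> points N. \<phi> q \<in> W \<longrightarrow> P q)" by blast
qed (use p in \<open>auto simp: near_def\<close>)

lemma eventually_near: "p \<in> points N \<Longrightarrow> eventually P (nhdf N p) \<longleftrightarrow> near N p P"
proof -
  assume p: "p \<in> points N"
  obtain U \<phi> where U: "(U, \<phi>) \<in> charts N" "p \<in> U" using chart_at[OF p] .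
  note nc = near_chart[OF p U]
  have "is_filter (near N p)"
  proof
    show "near N p (\<lambda>x. True)" unfolding nc using open_UNIV by blast
  next
    fix P Q assume "near N p P" "near N p Q"
    then obtain W W' where "open W" "\<phi> p \<in> W" "\<forall>q\<in>U \<inter> points N. \<phi> q \<in> W \<longrightarrow> P q"
      "open W'" "\<phi> p \<in> W'" "\<forall>q\<in>U \<inter> points N. \<phi> q \<in> W' \<longrightarrow> Q q" unfolding nc by blast
    then show "near N p (\<lambda>x. P x \<and> Q x)" unfolding nc by (intro exI[of _ "W \<inter> W'"]) auto
  next
    fix P Q assume "\<forall>x. P x \<longrightarrow> Q x" "near N p P"
    then show "near N p Q" unfolding nc by blast
  qed
  then show ?thesis unfolding nhdf_def by (rule eventually_Abs_filter)
qed

lemma eventually_chart: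
  assumes p: "p \<in> points N" "(U, \<phi>) \<in> charts N" "p \<in> U"
  shows "eventually P (nhdf N p) \<longleftrightarrow> (\<exists>W. open W \<and> \<phi> p \<in> W \<and> (\<forall>q\<in>U \<inter> points N. \<phi> q \<in> W \<longrightarrow> P q))"
  unfolding eventually_near[OF assms(1)] by (rule near_chart[OF assms])

lemma ev_at:
  assumes "eventually P (nhdf N p)" and p: "p \<in> points N" shows "P p"
proof -
  obtain U \<phi> where U: "(U, \<phi>) \<in> charts N" "p \<in> U" using chart_at[OF p] .
  show ?thesis using assms(1) p U unfolding eventually_chart[OF p U] by blast
qed

lemma ev_domain:
  assumes "p \<in> points N" "(U, \<phi>) \<in> charts N" "p \<in> U"
  shows "eventually (\<lambda>q. q \<in> U) (nhdf N p)"
  unfolding eventually_chart[OF assms] by (rule exI[of _ UNIV]) simp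

lemma ev_points:
  assumes p: "p \<in> points N" shows "eventually (\<lambda>q. q \<in> points N) (nhdf N p)"
proof -
  obtain U \<phi> where U: "(U, \<phi>) \<in> charts N" "p \<in> U" using chart_at[OF p] .
  show ?thesis unfolding eventually_chart[OF p U] by (rule exI[of _ UNIV]) simp
qed

lemma ev_open:
  assumes "p \<in> points N" "(U, \<phi>) \<in> charts N" "p \<in> U" and "open W" "\<phi> p \<in> W"
  shows "eventually (\<lambda>q. \<phi> q \<in> W) (nhdf N p)"
  unfolding eventually_chart[OF assms(1-3)] using assms(4,5) by blast

lemma ev_ev:
  assumes P: "eventually P (nhdf N p)" and p: "p \<in> points N"
  shows "eventually (\<lambda>q. eventually P (nhdf N q)) (nhdf N p)"
proof -
  obtain U \<phi> where U: "(U, \<phi>) \<in> charts N" "p \<in> U" using chart_at[OF p] .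
  obtain W where W: "open W" "\<phi> p \<in> W" "\<forall>q\<in>U \<inter> points N. \<phi> q \<in> W \<longrightarrow> P q"
    using P unfolding eventually_chart[OF p U] by blast
  have "eventually P (nhdf N q)" if "q \<in> U \<inter> points N" "\<phi> q \<in> W" for q
  proof -
    have q: "q \<in> points N" "q \<in> U" using that by auto
    show ?thesis unfolding eventually_chart[OF q(1) U(1) q(2)] using W that by blast
  qed
  then show ?thesis using W unfolding eventually_chart[OF p U] by blast
qed

section \<open>Functions that are smooth near a point\<close>

lemma smooth_near_chart:
  assumes p: "p \<in> points N" "(U, \<phi>) \<in> charts N" "p \<in> U"
  shows "smooth_near N p f \<longleftrightarrow> (\<exists>W F. open W \<and> \<phi> p \<in> W \<and> smooth_on W F \<and>
           (\<forall>q \<in> U \<inter> points N. \<phi> q \<in> W \<longrightarrow> f q = F (\<phi> q)))"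
proof
  assume "smooth_near N p f"
  then obtain V \<psi> W' F where V: "(V, \<psi>) \<in> charts N" "p \<in> V"
    and W': "open W'" "\<psi> p \<in> W'" "smooth_on W' F" "\<forall>q\<in>V \<inter> points N. \<psi> q \<in> W' \<longrightarrow> f q = F (\<psi> q)"
    unfolding smooth_near_def by blast
  obtain W \<tau> where W: "open W" "\<phi> p \<in> W" "smooth_on W \<tau>"
    "\<forall>q\<in>U \<inter> points N. \<phi> q \<in> W \<longrightarrow> q \<in> V \<and> \<psi> q = \<tau> (\<phi> q)"
    using compatible[OF p(2) V(1) p(3) V(2) p(1)] by blast
  have o: "open (W \<inter> \<tau> -` W')"
    using continuous_open_preimage[OF smooth_on_continuous[OF W(3)] W(1) W'(1)] .
  moreover have "\<phi> p \<in> W \<inter> \<tau> -` W'" using W W' p by auto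
  moreover have "smooth_on (W \<inter> \<tau> -` W') (\<lambda>z. F (\<tau> z))"
    using smooth_on_compose[OF W'(3) smooth_on_subset[OF W(3)] o W'(1)] by auto
  moreover have "\<forall>q\<in>U \<inter> points N. \<phi> q \<in> W \<inter> \<tau> -` W' \<longrightarrow> f q = F (\<tau> (\<phi> q))" using W W' by auto
  ultimately show "\<exists>W F. open W \<and> \<phi> p \<in> W \<and> smooth_on W F \<and>
           (\<forall>q \<in> U \<inter> points N. \<phi> q \<in> W \<longrightarrow> f q = F (\<phi> q))" by blast
qed (use p in \<open>auto simp: smooth_near_def\<close>)

lemma smooth_nearI:
  assumes "p \<in> points N" "(U, \<phi>) \<in> charts N" "p \<in> U" "open W" "\<phi> p \<in> W" "smooth_on W F"
    and "eventually (\<lambda>q. f q = F (\<phi> q)) (nhdf N p)"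
  shows "smooth_near N p f"
proof -
  obtain W' where "open W'" "\<phi> p \<in> W'" "\<forall>q\<in>U \<inter> points N. \<phi> q \<in> W' \<longrightarrow> f q = F (\<phi> q)"
    using assms(7) unfolding eventually_chart[OF assms(1-3)] by blast
  then show ?thesis unfolding smooth_near_chart[OF assms(1-3)]
    using assms(4-6) by (intro exI[of _ "W \<inter> W'"] exI[of _ F]) (auto intro: smooth_on_subset)
qed

lemma smooth_nearE:
  assumes "smooth_near N p f" "(U, \<phi>) \<in> charts N" "p \<in> U"
  obtains W F where "open W" "\<phi> p \<in> W" "smooth_on W F" "eventually (\<lambda>q. f q = F (\<phi> q)) (nhdf N p)"
proof -
  have p: "p \<in> points N" using assms(1) by (simp add: smooth_near_def)
  show ?thesis using assms(1) that unfolding smooth_near_chart[OF p assms(2,3)] eventually_chart[OF p assms(2,3)] by blast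
qed

lemma smooth_near_points: "smooth_near N p f \<Longrightarrow> p \<in> points N"
  by (simp add: smooth_near_def)

lemma smooth_near_cong:
  assumes "smooth_near N p f" and e: "eventually (\<lambda>q. f q = h q) (nhdf N p)"
  shows "smooth_near N p h"
proof -
  have p: "p \<in> points N" using assms(1) by (rule smooth_near_points)
  obtain U \<phi> where U: "(U, \<phi>) \<in> charts N" "p \<in> U" using chart_at[OF p] .
  obtain W F where "open W" "\<phi> p \<in> W" "smooth_on W F" and eF: "eventually (\<lambda>q. f q = F (\<phi> q)) (nhdf N p)"
    using smooth_nearE[OF assms(1) U] .
  moreover have "eventually (\<lambda>q. h q = F (\<phi> q)) (nhdf N p)" using e eF by eventually_elim simp
  ultimately show ?thesis using smooth_nearI[OF p U] by blast
qed

lemma smooth_near_ev: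
  assumes "smooth_near N p f" shows "eventually (\<lambda>q. smooth_near N q f) (nhdf N p)"
proof -
  have p: "p \<in> points N" using assms by (rule smooth_near_points)
  obtain U \<phi> where U: "(U, \<phi>) \<in> charts N" "p \<in> U" using chart_at[OF p] .
  obtain W F where W: "open W" "\<phi> p \<in> W" "smooth_on W F" "eventually (\<lambda>q. f q = F (\<phi> q)) (nhdf N p)"
    using smooth_nearE[OF assms U] .
  show ?thesis using ev_points[OF p] ev_domain[OF p U] ev_open[OF p U W(1,2)] ev_ev[OF W(4) p]
    by eventually_elim (rule smooth_nearI[OF _ U(1) _ W(1) _ W(3)])
qed

lemma smooth_coordinate:
  assumes "p \<in> points N" "(U, \<phi>) \<in> charts N" "p \<in> U"
  shows "smooth_near N p (\<lambda>q. \<phi> q \<bullet> i)"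
  by (rule smooth_nearI[OF assms open_UNIV, where F = "\<lambda>z. z \<bullet> i"])
    (auto intro: smooth_on_linear bounded_linear_inner_left)

text \<open>Each component of \<open>F\<close> has a chart representative on its own neighbourhood.
  There are finitely many, so on the intersection they combine into one smooth map, to which the
  Euclidean chain rule applies.\<close>

lemma smooth_compose:
  fixes K :: "'f::euclidean_space \<Rightarrow> real"
  assumes p: "p \<in> points N" and K: "smooth_on T K" "open T" "F p \<in> T"
    and F: "\<And>i. i \<in> Basis \<Longrightarrow> smooth_near N p (\<lambda>q. F q \<bullet> i)"
  shows "smooth_near N p (\<lambda>q. K (F q))"
proof -
  obtain U \<phi> where U: "(U, \<phi>) \<in> charts N" "p \<in> U" using chart_at[OF p] .
  have "\<exists>W H. open W \<and> \<phi> p \<in> W \<and> smooth_on W H \<and> eventually (\<lambda>q. F q \<bullet> i = H (\<phi> q)) (nhdf N p)"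
    if "i \<in> Basis" for i using smooth_nearE[OF F[OF that] U] by blast
  then obtain W H where W: "\<And>i. i \<in> Basis \<Longrightarrow> open (W i) \<and> \<phi> p \<in> W i \<and> smooth_on (W i) (H i) \<and>
      eventually (\<lambda>q. F q \<bullet> i = H i (\<phi> q)) (nhdf N p)" by metis
  define W0 where "W0 = (\<Inter>i\<in>Basis. W i)"
  define H0 where "H0 z = (\<Sum>i\<in>Basis. H i z *\<^sub>R i)" for z
  have W0: "open W0" "\<phi> p \<in> W0" unfolding W0_def using W by auto
  have "smooth_on W0 (H i)" if "i \<in> Basis" for i
    using smooth_on_subset[of "W i" "H i" W0] W that unfolding W0_def by auto
  then have H0: "smooth_on W0 H0" unfolding H0_def
    by (intro smooth_on_sum smooth_on_scaleR smooth_on_const W0) auto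
  have "eventually (\<lambda>q. \<forall>i\<in>Basis. F q \<bullet> i = H i (\<phi> q)) (nhdf N p)"
    by (rule eventually_ball_finite) (use W in auto)
  then have e: "eventually (\<lambda>q. F q = H0 (\<phi> q)) (nhdf N p)"
  proof eventually_elim
    case (elim q)
    show ?case unfolding H0_def
      by (subst euclidean_representation[of "F q", symmetric]) (intro sum.cong, use elim in auto)
  qed
  have o: "open (W0 \<inter> H0 -` T)"
    using continuous_open_preimage[OF smooth_on_continuous[OF H0] W0(1) K(2)] .
  show ?thesis
  proof (rule smooth_nearI[OF p U o])
    show "\<phi> p \<in> W0 \<inter> H0 -` T" using W0 K ev_at[OF e p] by auto
    show "smooth_on (W0 \<inter> H0 -` T) (\<lambda>z. K (H0 z))"
      using smooth_on_compose[OF K(1) smooth_on_subset[OF H0] o K(2)] by auto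
    show "eventually (\<lambda>q. K (F q) = K (H0 (\<phi> q))) (nhdf N p)" using e by eventually_elim simp
  qed
qed

lemma smooth_const:
  assumes p: "p \<in> points N" shows "smooth_near N p (\<lambda>q. c)"
proof -
  obtain U \<phi> where U: "(U, \<phi>) \<in> charts N" "p \<in> U" using chart_at[OF p] .
  show ?thesis by (rule smooth_nearI[OF p U open_UNIV, where F = "\<lambda>z. c"]) (auto intro: smooth_on_const)
qed

lemma smooth_add:
  assumes "smooth_near N p f" "smooth_near N p h" shows "smooth_near N p (\<lambda>q. f q + h q)"
proof -
  have "smooth_on UNIV (\<lambda>z::real \<times> real. fst z + snd z)"
    by (intro smooth_on_add smooth_on_linear bounded_linear_fst bounded_linear_snd open_UNIV)
  moreover have "smooth_near N p (\<lambda>q. (f q, h q) \<bullet> i)" if "i \<in> Basis" for i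
    using that assms by (auto simp: Basis_prod_def)
  ultimately show ?thesis
    using smooth_compose[OF smooth_near_points[OF assms(1)], where F = "\<lambda>q. (f q, h q)"] by fastforce
qed

lemma smooth_mult:
  assumes "smooth_near N p f" "smooth_near N p h" shows "smooth_near N p (\<lambda>q. f q * h q)"
proof -
  have "smooth_on UNIV (\<lambda>z::real \<times> real. fst z * snd z)"
    by (intro smooth_on_mult smooth_on_linear bounded_linear_fst bounded_linear_snd open_UNIV)
  moreover have "smooth_near N p (\<lambda>q. (f q, h q) \<bullet> i)" if "i \<in> Basis" for i
    using that assms by (auto simp: Basis_prod_def)
  ultimately show ?thesis
    using smooth_compose[OF smooth_near_points[OF assms(1)], where F = "\<lambda>q. (f q, h q)"] by fastforce
qed

lemma smooth_diff: "smooth_near N p f \<Longrightarrow> smooth_near N p h \<Longrightarrow> smooth_near N p (\<lambda>q. f q - h q)"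
  using smooth_add[of p f "\<lambda>q. - 1 * h q"] smooth_mult[OF smooth_const[of p "-1"], of h]
  by (auto simp: smooth_near_points)

lemma smooth_sum: "p \<in> points N \<Longrightarrow> (\<And>i. i \<in> I \<Longrightarrow> smooth_near N p (f i)) \<Longrightarrow> smooth_near N p (\<lambda>q. \<Sum>i\<in>I. f i q)"
  by (induction I rule: infinite_finite_induct) (auto intro: smooth_const smooth_add)

lemma smooth_cmult: "smooth_near N p f \<Longrightarrow> smooth_near N p (\<lambda>q. c * f q)"
  by (intro smooth_mult smooth_const) (simp add: smooth_near_points)

section \<open>Derivations at a point\<close>

lemma tan_nonsmooth: "v \<in> tangent_space N p \<Longrightarrow> \<not> smooth_near N p f \<Longrightarrow> v f = 0"
  by (simp add: tangent_space_def)

lemma tan_add: "v \<in> tangent_space N p \<Longrightarrow> smooth_near N p f \<Longrightarrow> smooth_near N p h \<Longrightarrow>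
    v (\<lambda>q. f q + h q) = v f + v h"
  unfolding tangent_space_def linear_on_def plus_fun_def by auto

lemma tan_cmult: "v \<in> tangent_space N p \<Longrightarrow> smooth_near N p f \<Longrightarrow> v (\<lambda>q. c * f q) = c * v f"
  unfolding tangent_space_def linear_on_def scaleR_fun_def by auto

lemma tan_mult: "v \<in> tangent_space N p \<Longrightarrow> smooth_near N p f \<Longrightarrow> smooth_near N p h \<Longrightarrow>
    v (\<lambda>q. f q * h q) = f p * v h + h p * v f"
  unfolding tangent_space_def by auto

lemma tan_diff: "v \<in> tangent_space N p \<Longrightarrow> smooth_near N p f \<Longrightarrow> smooth_near N p h \<Longrightarrow>
    v (\<lambda>q. f q - h q) = v f - v h"
  using tan_add[of v p f "\<lambda>q. - 1 * h q"] tan_cmult[of v p h "-1"] smooth_cmult[of p h "-1"] by simp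

lemma tan_const: "v \<in> tangent_space N p \<Longrightarrow> p \<in> points N \<Longrightarrow> v (\<lambda>q. c) = 0"
  using tan_mult[of v p "\<lambda>q. 1" "\<lambda>q. 1"] tan_cmult[of v p "\<lambda>q. 1" c] smooth_const[of p 1] by simp

text \<open>The indicator \<open>k\<close> of the set where \<open>f\<close> and \<open>h\<close>
  differ vanishes near \<open>p\<close>, hence is smooth there, and multiplying \<open>f - h\<close>
  by it changes nothing. Both factors vanish at \<open>p\<close>, so the Leibniz rule gives 0. If
  \<open>f\<close> is not smooth then neither is \<open>h\<close>, and both values are the default
  0.\<close>

lemma tan_local:
  assumes v: "v \<in> tangent_space N p" and p: "p \<in> points N"
    and e: "eventually (\<lambda>q. f q = h q) (nhdf N p)"
  shows "v f = v h"
proof (cases "smooth_near N p f")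
  case False
  then have "\<not> smooth_near N p h" using smooth_near_cong[of p h f] e by (auto simp: eq_commute)
  then show ?thesis using tan_nonsmooth[OF v False] tan_nonsmooth[OF v, of h] by simp
next
  case True
  then have h: "smooth_near N p h" using e smooth_near_cong by blast
  define k where "k q = (if f q = h q then 0 else 1 :: real)" for q
  have "eventually (\<lambda>q. 0 = k q) (nhdf N p)" using e by eventually_elim (simp add: k_def)
  then have k: "smooth_near N p k" using smooth_near_cong[OF smooth_const[OF p, of 0]] by simp
  have d: "smooth_near N p (\<lambda>q. f q - h q)" using smooth_diff True h by blast
  have "(\<lambda>q. f q - h q) = (\<lambda>q. (f q - h q) * k q)" by (auto simp: k_def)
  then have "v (\<lambda>q. f q - h q) = (f p - h p) * v k + k p * v (\<lambda>q. f q - h q)"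
    using tan_mult[OF v d k] by simp
  also have "\<dots> = 0" using ev_at[OF e p] by (simp add: k_def)
  finally show ?thesis using tan_diff[OF v True h] by simp
qed

lemma tan_sum:
  assumes v: "v \<in> tangent_space N p" and p: "p \<in> points N"
    and f: "\<And>i. i \<in> I \<Longrightarrow> smooth_near N p (f i)"
  shows "v (\<lambda>q. \<Sum>i\<in>I. f i q) = (\<Sum>i\<in>I. v (f i))"
  using f
proof (induction I rule: infinite_finite_induct)
  case (insert i I)
  then show ?case using tan_add[OF v insert.prems[of i] smooth_sum[OF p, of I f]] by simp
qed (simp_all add: tan_const[OF v p])

text \<open>By \<open>hadamard\<close>, \<open>f\<close> is near \<open>p\<close> a constant plus
  products whose first factor vanishes at \<open>p\<close>; the Leibniz rule leaves only the second
  factors at \<open>p\<close>, which are the partial derivatives. On a submanifold \<open>F\<close>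
  is not determined by \<open>f\<close>, and the formula holds for every choice of it.\<close>

lemma tan_chart:
  assumes v: "v \<in> tangent_space N p" and p: "p \<in> points N" and U: "(U, \<phi>) \<in> charts N" "p \<in> U"
    and W: "open W" "\<phi> p \<in> W" "smooth_on W F" and e: "eventually (\<lambda>q. f q = F (\<phi> q)) (nhdf N p)"
  shows "v f = (\<Sum>i\<in>Basis. v (\<lambda>q. \<phi> q \<bullet> i) * frechet_derivative F (at (\<phi> p)) i)"
proof -
  obtain r K where r: "r > 0" "ball (\<phi> p) r \<subseteq> W" "\<And>i. smooth_on (ball (\<phi> p) r) (K i)"
    "\<And>i. K i (\<phi> p) = frechet_derivative F (at (\<phi> p)) i"
    and FK: "\<And>z. z \<in> ball (\<phi> p) r \<Longrightarrow> F z = F (\<phi> p) + (\<Sum>i\<in>Basis. ((z - \<phi> p) \<bullet> i) * K i z)"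
    using hadamard[OF W(3,1,2)] by blast
  have "eventually (\<lambda>q. \<phi> q \<in> ball (\<phi> p) r) (nhdf N p)"
    using r(1) by (intro ev_open[OF p U]) auto
  with e have e2: "eventually (\<lambda>q. f q = F (\<phi> p) + (\<Sum>i\<in>Basis. (\<phi> q \<bullet> i - \<phi> p \<bullet> i) * K i (\<phi> q))) (nhdf N p)"
    by eventually_elim (use FK in \<open>simp add: inner_diff_left\<close>)
  have K: "smooth_near N p (\<lambda>q. K i (\<phi> q))" for i
    by (rule smooth_nearI[OF p U _ _ r(3)[of i]]) (use r(1) in auto)
  have c: "smooth_near N p (\<lambda>q. \<phi> q \<bullet> i - \<phi> p \<bullet> i)" for i
    by (intro smooth_diff smooth_const p smooth_coordinate[OF p U])
  have vc: "v (\<lambda>q. \<phi> q \<bullet> i - \<phi> p \<bullet> i) = v (\<lambda>q. \<phi> q \<bullet> i)" for i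
    using tan_diff[OF v smooth_coordinate[OF p U] smooth_const[OF p]] tan_const[OF v p] by simp
  have "v f = v (\<lambda>q. F (\<phi> p) + (\<Sum>i\<in>Basis. (\<phi> q \<bullet> i - \<phi> p \<bullet> i) * K i (\<phi> q)))"
    using tan_local[OF v p e2] .
  also have "\<dots> = v (\<lambda>q. \<Sum>i\<in>Basis. (\<phi> q \<bullet> i - \<phi> p \<bullet> i) * K i (\<phi> q))"
    by (subst tan_add[OF v]) (auto intro!: smooth_const smooth_sum smooth_mult c K p simp: tan_const[OF v p])
  also have "\<dots> = (\<Sum>i\<in>Basis. v (\<lambda>q. (\<phi> q \<bullet> i - \<phi> p \<bullet> i) * K i (\<phi> q)))"
    by (rule tan_sum[OF v p smooth_mult[OF c K]])
  also have "\<dots> = (\<Sum>i\<in>Basis. v (\<lambda>q. \<phi> q \<bullet> i) * frechet_derivative F (at (\<phi> p)) i)"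
    by (intro sum.cong refl) (subst tan_mult[OF v c K], simp add: vc r(4))
  finally show ?thesis .
qed

lemma tan_eqI:
  assumes v: "v \<in> tangent_space N p" and w: "w \<in> tangent_space N p" and p: "p \<in> points N"
    and U: "(U, \<phi>) \<in> charts N" "p \<in> U"
    and eq: "\<And>i. i \<in> Basis \<Longrightarrow> v (\<lambda>q. \<phi> q \<bullet> i) = w (\<lambda>q. \<phi> q \<bullet> i)"
  shows "v = w"
proof
  fix f
  show "v f = w f"
  proof (cases "smooth_near N p f")
    case True
    then obtain W F where W: "open W" "\<phi> p \<in> W" "smooth_on W F" "eventually (\<lambda>q. f q = F (\<phi> q)) (nhdf N p)"
      using smooth_nearE U by metis
    show ?thesis unfolding tan_chart[OF v p U W] tan_chart[OF w p U W] using eq by simp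
  qed (simp add: tan_nonsmooth[OF v] tan_nonsmooth[OF w])
qed

section \<open>Vector fields near a point\<close>

lemma vf_points: "vector_field_near N p V \<Longrightarrow> p \<in> points N"
  unfolding vector_field_near_def near_def by blast

lemma vf_ev:
  assumes "vector_field_near N p V"
  shows "eventually (\<lambda>q. V q \<in> tangent_space N q) (nhdf N p)"
  using assms unfolding eventually_near[OF vf_points[OF assms]] vector_field_near_def by blast

lemma vf_tan: "vector_field_near N p V \<Longrightarrow> V p \<in> tangent_space N p"
  using ev_at[OF vf_ev vf_points] .

lemma vf_smooth: "vector_field_near N p V \<Longrightarrow> smooth_near N p f \<Longrightarrow> smooth_near N p (\<lambda>q. V q f)"
  unfolding vector_field_near_def by auto

lemma vfI:
  assumes "p \<in> points N" "eventually (\<lambda>q. V q \<in> tangent_space N q) (nhdf N p)"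
    "\<And>f. smooth_near N p f \<Longrightarrow> smooth_near N p (\<lambda>q. V q f)"
  shows "vector_field_near N p V"
  using assms unfolding vector_field_near_def eventually_near[OF assms(1)] by simp

text \<open>Applying \<open>tan_chart\<close> at all nearby points expresses \<open>V q f\<close>
  through the coordinate components of \<open>V\<close> and the partial derivatives of a
  representative of \<open>f\<close>.\<close>

lemma vfI_chart:
  assumes p: "p \<in> points N" and U: "(U, \<phi>) \<in> charts N" "p \<in> U"
    and e: "eventually (\<lambda>q. V q \<in> tangent_space N q) (nhdf N p)"
    and s: "\<And>i. i \<in> Basis \<Longrightarrow> smooth_near N p (\<lambda>q. V q (\<lambda>r. \<phi> r \<bullet> i))"
  shows "vector_field_near N p V"
proof (rule vfI[OF p e])
  fix f assume "smooth_near N p f"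
  then obtain W F where W: "open W" "\<phi> p \<in> W" "smooth_on W F" "eventually (\<lambda>q. f q = F (\<phi> q)) (nhdf N p)"
    using smooth_nearE U by metis
  have "smooth_near N p (\<lambda>q. \<Sum>i\<in>Basis. V q (\<lambda>r. \<phi> r \<bullet> i) * frechet_derivative F (at (\<phi> q)) i)"
  proof (intro smooth_sum smooth_mult s p)
    fix i show "smooth_near N p (\<lambda>q. frechet_derivative F (at (\<phi> q)) i)"
      by (rule smooth_nearI[OF p U W(1,2) smooth_on_derivative[OF W(3), of i]]) simp
  qed
  moreover have "eventually (\<lambda>q. (\<Sum>i\<in>Basis. V q (\<lambda>r. \<phi> r \<bullet> i) * frechet_derivative F (at (\<phi> q)) i) = V q f) (nhdf N p)"
    using e ev_points[OF p] ev_domain[OF p U] ev_open[OF p U W(1,2)] ev_ev[OF W(4) p]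
  proof eventually_elim
    case (elim q)
    show ?case by (rule tan_chart[OF elim(1,2) U(1) elim(3) W(1) elim(4) W(3) elim(5), symmetric])
  qed
  ultimately show "smooth_near N p (\<lambda>q. V q f)" by (rule smooth_near_cong)
qed

text \<open>The definition quantifies over all functions smooth near \<open>p\<close>, which says
  nothing directly about functions smooth near another point. The criterion \<open>vfI_chart\<close>
  involves finitely many coordinate functions, and for these smoothness is an open
  condition.\<close>

lemma vf_near:
  assumes V: "vector_field_near N p V"
  shows "eventually (\<lambda>q. vector_field_near N q V) (nhdf N p)"
proof -
  have p: "p \<in> points N" using vf_points[OF V] .
  obtain U \<phi> where U: "(U, \<phi>) \<in> charts N" "p \<in> U" using chart_at[OF p] .
  have "eventually (\<lambda>q. \<forall>i\<in>Basis. smooth_near N q (\<lambda>q. V q (\<lambda>r. \<phi> r \<bullet> i))) (nhdf N p)"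
    by (intro eventually_ball_finite ballI smooth_near_ev vf_smooth[OF V] smooth_coordinate[OF p U] finite_Basis)
  then show ?thesis using ev_points[OF p] ev_domain[OF p U] ev_ev[OF vf_ev[OF V] p]
  proof eventually_elim
    case (elim q)
    show ?case by (rule vfI_chart[OF elim(2) U(1) elim(3,4)]) (use elim(1) in auto)
  qed
qed

lemma vf_cong:
  assumes V: "vector_field_near N p V" and e: "eventually (\<lambda>q. V q = V' q) (nhdf N p)"
  shows "vector_field_near N p V'"
proof (rule vfI[OF vf_points[OF V]])
  show "eventually (\<lambda>q. V' q \<in> tangent_space N q) (nhdf N p)"
    using vf_ev[OF V] e by eventually_elim simp
  fix f assume f: "smooth_near N p f"
  have "eventually (\<lambda>q. V q f = V' q f) (nhdf N p)" using e by eventually_elim simp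
  then show "smooth_near N p (\<lambda>q. V' q f)" by (rule smooth_near_cong[OF vf_smooth[OF V f]])
qed

lemma vf_add:
  assumes V: "vector_field_near N p V" and W: "vector_field_near N p W"
  shows "vector_field_near N p (\<lambda>q. V q + W q)"
proof (rule vfI[OF vf_points[OF V]])
  show "eventually (\<lambda>q. V q + W q \<in> tangent_space N q) (nhdf N p)"
    using vf_ev[OF V] vf_ev[OF W] by eventually_elim (rule subspace_add[OF subspace_tangent_space])
  fix f assume "smooth_near N p f"
  then show "smooth_near N p (\<lambda>q. (V q + W q) f)"
    using smooth_add[OF vf_smooth[OF V] vf_smooth[OF W]] by simp
qed

lemma vf_scale:
  assumes V: "vector_field_near N p V" and h: "smooth_near N p h"
  shows "vector_field_near N p (\<lambda>q. h q *\<^sub>R V q)"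
proof (rule vfI[OF vf_points[OF V]])
  show "eventually (\<lambda>q. h q *\<^sub>R V q \<in> tangent_space N q) (nhdf N p)"
    using vf_ev[OF V] by eventually_elim (rule subspace_scale[OF subspace_tangent_space])
  fix f assume "smooth_near N p f"
  then show "smooth_near N p (\<lambda>q. (h q *\<^sub>R V q) f)"
    using smooth_mult[OF h vf_smooth[OF V]] by simp
qed

lemma vf_zero: "p \<in> points N \<Longrightarrow> vector_field_near N p (\<lambda>q. 0)"
  by (rule vfI) (auto intro!: smooth_const subspace_0[OF subspace_tangent_space] always_eventually)

lemma vf_sum: "p \<in> points N \<Longrightarrow> (\<And>i. i \<in> I \<Longrightarrow> vector_field_near N p (V i)) \<Longrightarrow> vector_field_near N p (\<lambda>q. \<Sum>i\<in>I. V i q)"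
  by (induction I rule: infinite_finite_induct) (auto intro: vf_zero vf_add)

lemma vf_diff: "vector_field_near N p V \<Longrightarrow> vector_field_near N p W \<Longrightarrow> vector_field_near N p (\<lambda>q. V q - W q)"
  using vf_add[of p V "\<lambda>q. - 1 *\<^sub>R W q"] vf_scale[OF _ smooth_const, of p W "-1"] vf_points by auto

section \<open>Lie brackets\<close>

lemma lie_apply: "smooth_near N p f \<Longrightarrow> lie_bracket N V W p f = V p (\<lambda>q. W q f) - W p (\<lambda>q. V q f)"
  by (simp add: lie_bracket_def)

lemma lie_nonsmooth: "\<not> smooth_near N p f \<Longrightarrow> lie_bracket N V W p f = 0"
  by (simp add: lie_bracket_def)

lemma lie_swap: "lie_bracket N V W p = - lie_bracket N W V p"
  by (auto simp: lie_bracket_def)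

text \<open>A composite of two fields fails the Leibniz rule by the mixed terms in \<open>C\<close>,
  V f * W h + V h * W f. They are symmetric in the two fields and cancel in the commutator.\<close>

lemma lie_tan:
  assumes V: "vector_field_near N p V" and W: "vector_field_near N p W"
  shows "lie_bracket N V W p \<in> tangent_space N p"
proof -
  note p = vf_points[OF V]
  have A: "V p (\<lambda>q. W q (\<lambda>r. f r + h r)) = V p (\<lambda>q. W q f) + V p (\<lambda>q. W q h)"
    if V: "vector_field_near N p V" and W: "vector_field_near N p W"
      and f: "smooth_near N p f" and h: "smooth_near N p h" for V W f h
  proof -
    have "eventually (\<lambda>q. W q (\<lambda>r. f r + h r) = W q f + W q h) (nhdf N p)"
      using vf_ev[OF W] smooth_near_ev[OF f] smooth_near_ev[OF h] by eventually_elim (rule tan_add)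
    from tan_local[OF vf_tan[OF V] p this] show ?thesis
      using tan_add[OF vf_tan[OF V] vf_smooth[OF W f] vf_smooth[OF W h]] by simp
  qed
  have B: "V p (\<lambda>q. W q (\<lambda>r. c * f r)) = c * V p (\<lambda>q. W q f)"
    if V: "vector_field_near N p V" and W: "vector_field_near N p W" and f: "smooth_near N p f" for V W f c
  proof -
    have "eventually (\<lambda>q. W q (\<lambda>r. c * f r) = c * W q f) (nhdf N p)"
      using vf_ev[OF W] smooth_near_ev[OF f] by eventually_elim (rule tan_cmult)
    from tan_local[OF vf_tan[OF V] p this] show ?thesis
      using tan_cmult[OF vf_tan[OF V] vf_smooth[OF W f]] by simp
  qed
  have C: "V p (\<lambda>q. W q (\<lambda>r. f r * h r)) = f p * V p (\<lambda>q. W q h) + V p f * W p h + h p * V p (\<lambda>q. W q f) + V p h * W p f"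
    if V: "vector_field_near N p V" and W: "vector_field_near N p W"
      and f: "smooth_near N p f" and h: "smooth_near N p h" for V W f h
  proof -
    have "eventually (\<lambda>q. W q (\<lambda>r. f r * h r) = f q * W q h + h q * W q f) (nhdf N p)"
      using vf_ev[OF W] smooth_near_ev[OF f] smooth_near_ev[OF h] by eventually_elim (rule tan_mult)
    then have "V p (\<lambda>q. W q (\<lambda>r. f r * h r)) = V p (\<lambda>q. f q * W q h + h q * W q f)"
      by (rule tan_local[OF vf_tan[OF V] p])
    also have "\<dots> = f p * V p (\<lambda>q. W q h) + V p f * W p h + h p * V p (\<lambda>q. W q f) + V p h * W p f"
      using tan_add[OF vf_tan[OF V] smooth_mult[OF f vf_smooth[OF W h]] smooth_mult[OF h vf_smooth[OF W f]]]
        tan_mult[OF vf_tan[OF V] f vf_smooth[OF W h]] tan_mult[OF vf_tan[OF V] h vf_smooth[OF W f]]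
      by (simp add: algebra_simps)
    finally show ?thesis .
  qed
  let ?B = "lie_bracket N V W p"
  have "?B (\<lambda>q. f q + h q) = ?B f + ?B h" if "smooth_near N p f" "smooth_near N p h" for f h
    using A[OF V W that] A[OF W V that] that by (simp add: lie_apply smooth_add)
  moreover have "?B (\<lambda>q. r * f q) = r * ?B f" if "smooth_near N p f" for f r
    using B[OF V W that, of r] B[OF W V that, of r] that by (simp add: lie_apply smooth_cmult right_diff_distrib)
  ultimately have "linear_on {f. smooth_near N p f} ?B"
    unfolding linear_on_def plus_fun_def scaleR_fun_def by simp
  moreover have "?B (\<lambda>q. f q * h q) = f p * ?B h + h p * ?B f"
    if "smooth_near N p f" "smooth_near N p h" for f h
    using C[OF V W that] C[OF W V that] that by (simp add: lie_apply smooth_mult algebra_simps)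
  ultimately show ?thesis unfolding tangent_space_def by (simp add: lie_nonsmooth)
qed

lemma vf_lie:
  assumes V: "vector_field_near N p V" and W: "vector_field_near N p W"
  shows "vector_field_near N p (lie_bracket N V W)"
proof (rule vfI[OF vf_points[OF V]])
  show "eventually (\<lambda>q. lie_bracket N V W q \<in> tangent_space N q) (nhdf N p)"
    using vf_near[OF V] vf_near[OF W] by eventually_elim (rule lie_tan)
  fix f assume f: "smooth_near N p f"
  have "smooth_near N p (\<lambda>q. V q (\<lambda>r. W r f) - W q (\<lambda>r. V r f))"
    by (rule smooth_diff[OF vf_smooth[OF V vf_smooth[OF W f]] vf_smooth[OF W vf_smooth[OF V f]]])
  moreover have "eventually (\<lambda>q. V q (\<lambda>r. W r f) - W q (\<lambda>r. V r f) = lie_bracket N V W q f) (nhdf N p)"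
    using smooth_near_ev[OF f] by eventually_elim (simp add: lie_apply)
  ultimately show "smooth_near N p (\<lambda>q. lie_bracket N V W q f)" by (rule smooth_near_cong)
qed

lemma lie_cong:
  assumes V: "vector_field_near N p V" and W: "vector_field_near N p W"
    and e: "eventually (\<lambda>q. V q = V' q) (nhdf N p)" "eventually (\<lambda>q. W q = W' q) (nhdf N p)"
  shows "lie_bracket N V W p = lie_bracket N V' W' p"
proof
  fix f
  note p = vf_points[OF V]
  have "eventually (\<lambda>q. V q f = V' q f) (nhdf N p)" using e(1) by eventually_elim simp
  then have "W p (\<lambda>q. V q f) = W p (\<lambda>q. V' q f)" by (rule tan_local[OF vf_tan[OF W] p])
  moreover have "eventually (\<lambda>q. W q f = W' q f) (nhdf N p)" using e(2) by eventually_elim simp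
  then have "V p (\<lambda>q. W q f) = V p (\<lambda>q. W' q f)" by (rule tan_local[OF vf_tan[OF V] p])
  ultimately show "lie_bracket N V W p f = lie_bracket N V' W' p f"
    using ev_at[OF e(1) p] ev_at[OF e(2) p] by (simp add: lie_bracket_def)
qed

lemma lie_add_left:
  assumes V: "vector_field_near N p V" and V': "vector_field_near N p V'" and W: "vector_field_near N p W"
  shows "lie_bracket N (\<lambda>q. V q + V' q) W p = lie_bracket N V W p + lie_bracket N V' W p"
  using tan_add[OF vf_tan[OF W] vf_smooth[OF V] vf_smooth[OF V']]
  by (auto simp: fun_eq_iff lie_bracket_def)

lemma lie_scale_left:
  assumes V: "vector_field_near N p V" and W: "vector_field_near N p W" and h: "smooth_near N p h"
  shows "lie_bracket N (\<lambda>q. h q *\<^sub>R V q) W p = h p *\<^sub>R lie_bracket N V W p - W p h *\<^sub>R V p"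
  using tan_mult[OF vf_tan[OF W] h vf_smooth[OF V]] tan_nonsmooth[OF vf_tan[OF V]]
  by (auto simp: fun_eq_iff lie_bracket_def algebra_simps)

lemma lie_scale_right:
  assumes V: "vector_field_near N p V" and W: "vector_field_near N p W" and h: "smooth_near N p h"
  shows "lie_bracket N V (\<lambda>q. h q *\<^sub>R W q) p = h p *\<^sub>R lie_bracket N V W p + V p h *\<^sub>R W p"
  using lie_scale_left[OF W V h] lie_swap[of V "\<lambda>q. h q *\<^sub>R W q" p] lie_swap[of V W p] by simp

lemma lie_add_right:
  assumes V: "vector_field_near N p V" and W: "vector_field_near N p W" and W': "vector_field_near N p W'"
  shows "lie_bracket N V (\<lambda>q. W q + W' q) p = lie_bracket N V W p + lie_bracket N V W' p"
  using lie_add_left[OF W W' V] lie_swap[of V "\<lambda>q. W q + W' q" p] lie_swap[of V W p] lie_swap[of V W' p] by simp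

lemma lie_zero_left:
  assumes W: "vector_field_near N p W"
  shows "lie_bracket N (\<lambda>q. 0) W p = 0"
  using tan_const[OF vf_tan[OF W] vf_points[OF W], of 0] by (auto simp: fun_eq_iff lie_bracket_def)

lemma lie_sum_left:
  assumes V: "\<And>i. i \<in> I \<Longrightarrow> vector_field_near N p (V i)" and W: "vector_field_near N p W"
  shows "lie_bracket N (\<lambda>q. \<Sum>i\<in>I. V i q) W p = (\<Sum>i\<in>I. lie_bracket N (V i) W p)"
  using V
  by (induction I rule: infinite_finite_induct)
    (auto simp: lie_zero_left[OF W] lie_add_left[OF _ vf_sum[OF vf_points[OF W]] W])

lemma jacobi:
  assumes X: "vector_field_near N p X" and Y: "vector_field_near N p Y" and Z: "vector_field_near N p Z"
  shows "lie_bracket N X (lie_bracket N Y Z) p + lie_bracket N Y (lie_bracket N Z X) p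
    + lie_bracket N Z (lie_bracket N X Y) p = 0"
proof
  fix f
  have *: "lie_bracket N X (lie_bracket N Y Z) p f =
      X p (\<lambda>q. Y q (\<lambda>r. Z r f)) - X p (\<lambda>q. Z q (\<lambda>r. Y r f)) - (Y p (\<lambda>q. Z q (\<lambda>r. X r f)) - Z p (\<lambda>q. Y q (\<lambda>r. X r f)))"
    if X: "vector_field_near N p X" and Y: "vector_field_near N p Y" and Z: "vector_field_near N p Z"
      and f: "smooth_near N p f" for X Y Z
  proof -
    have "eventually (\<lambda>q. lie_bracket N Y Z q f = Y q (\<lambda>r. Z r f) - Z q (\<lambda>r. Y r f)) (nhdf N p)"
      using smooth_near_ev[OF f] by eventually_elim (simp add: lie_apply)
    then have "X p (\<lambda>q. lie_bracket N Y Z q f) = X p (\<lambda>q. Y q (\<lambda>r. Z r f) - Z q (\<lambda>r. Y r f))"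
      by (rule tan_local[OF vf_tan[OF X] vf_points[OF X]])
    also have "\<dots> = X p (\<lambda>q. Y q (\<lambda>r. Z r f)) - X p (\<lambda>q. Z q (\<lambda>r. Y r f))"
      by (rule tan_diff[OF vf_tan[OF X] vf_smooth[OF Y vf_smooth[OF Z f]] vf_smooth[OF Z vf_smooth[OF Y f]]])
    finally show ?thesis using f vf_smooth[OF X f] by (simp add: lie_apply)
  qed
  show "(lie_bracket N X (lie_bracket N Y Z) p + lie_bracket N Y (lie_bracket N Z X) p
    + lie_bracket N Z (lie_bracket N X Y) p) f = 0 f"
    by (cases "smooth_near N p f") (simp_all add: *[OF X Y Z] *[OF Y Z X] *[OF Z X Y] lie_nonsmooth)
qed

end

section \<open>Manifolds and the curvature tensor\<close>

locale manifold =
  fixes M :: "('a, 'e::euclidean_space) space"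
  assumes mfd: "smooth_manifold M"
begin

lemma chart_inj: "(U, \<phi>) \<in> charts M \<Longrightarrow> inj_on \<phi> U"
  and chart_image_open: "(U, \<phi>) \<in> charts M \<Longrightarrow> open (\<phi> ` U)"
  and chart_domain: "(U, \<phi>) \<in> charts M \<Longrightarrow> U \<subseteq> points M"
  and chart_overlap_open: "(U, \<phi>) \<in> charts M \<Longrightarrow> (V, \<psi>) \<in> charts M \<Longrightarrow> open (\<phi> ` (U \<inter> V))"
proof -
  obtain X where X: "topspace X = points M"
    and ch: "\<forall>(U, \<phi>)\<in>charts M. openin X U \<and> open (\<phi> ` U) \<and>
            homeomorphic_map (subtopology X U) (top_of_set (\<phi> ` U)) \<phi>"
    using mfd unfolding smooth_manifold_def by auto
  {
    fix U \<phi> assume U: "(U, \<phi>) \<in> charts M"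
    have o: "openin X U" "open (\<phi> ` U)" and h: "homeomorphic_map (subtopology X U) (top_of_set (\<phi> ` U)) \<phi>"
      using ch U by auto
    show "U \<subseteq> points M" using openin_subset[OF o(1)] X by simp
    then have ts: "topspace (subtopology X U) = U" using X by auto
    show "open (\<phi> ` U)" by fact
    show "inj_on \<phi> U" using homeomorphic_imp_injective_map[OF h] ts by simp
    fix V \<psi> assume V: "(V, \<psi>) \<in> charts M"
    have "openin (subtopology X U) (U \<inter> V)"
      using ch V o by (auto intro: openin_subtopology_Int2)
    then have "openin (top_of_set (\<phi> ` U)) (\<phi> ` (U \<inter> V))"
      using homeomorphic_imp_open_map[OF h] unfolding open_map_def by blast
    then show "open (\<phi> ` (U \<inter> V))" using o(2) openin_open_eq by blast
  }
qed

sublocale smooth_space M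
proof
  fix p assume "p \<in> points M"
  then have "p \<in> \<Union>(fst ` charts M)" using mfd by (simp add: smooth_manifold_def)
  then show "\<exists>(U, \<phi>)\<in>charts M. p \<in> U" by force
next
  fix U \<phi> V \<psi> p assume U: "(U, \<phi>) \<in> charts M" and V: "(V, \<psi>) \<in> charts M" and p: "p \<in> U" "p \<in> V"
  have s: "smooth_on (\<phi> ` (U \<inter> V)) (\<psi> \<circ> inv_into U \<phi>)"
    using mfd U V unfolding smooth_manifold_def by fast
  show "\<exists>W \<tau>. open W \<and> \<phi> p \<in> W \<and> smooth_on W \<tau> \<and> (\<forall>q\<in>U \<inter> points M. \<phi> q \<in> W \<longrightarrow> q \<in> V \<and> \<psi> q = \<tau> (\<phi> q))"
    using chart_overlap_open[OF U V] s p chart_inj[OF U]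
    by (intro exI[of _ "\<phi> ` (U \<inter> V)"] exI[of _ "\<psi> \<circ> inv_into U \<phi>"]) (auto simp: inj_on_def inv_into_f_f[OF chart_inj[OF U]])
qed

text \<open>For a basis vector \<open>i\<close> this is the coordinate vector field of the chart.
  Functions that are not smooth receive 0, as \<open>tangent_space\<close> demands.\<close>

definition cfield :: "'a set \<Rightarrow> ('a \<Rightarrow> 'e) \<Rightarrow> 'e \<Rightarrow> 'a \<Rightarrow> 'a tvec" where
  "cfield U \<phi> i q = (\<lambda>f. if smooth_near M q f
     then frechet_derivative (\<lambda>z. f (inv_into U \<phi> z)) (at (\<phi> q)) i else 0)"

lemma smooth_near_inv:
  assumes U: "(U, \<phi>) \<in> charts M" "q \<in> U" and f: "smooth_near M q f"
  shows "((\<lambda>z. f (inv_into U \<phi> z)) has_derivative frechet_derivative (\<lambda>z. f (inv_into U \<phi> z)) (at (\<phi> q))) (at (\<phi> q))"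
proof -
  have q: "q \<in> points M" using chart_domain U by blast
  obtain W F where W: "open W" "\<phi> q \<in> W" "smooth_on W F"
    "\<forall>r \<in> U \<inter> points M. \<phi> r \<in> W \<longrightarrow> f r = F (\<phi> r)"
    using f unfolding smooth_near_chart[OF q U] by blast
  have o: "open (W \<inter> \<phi> ` U)" using W chart_image_open[OF U(1)] by auto
  have "smooth_on (W \<inter> \<phi> ` U) (\<lambda>z. f (inv_into U \<phi> z))"
  proof (rule smooth_on_transfer[OF smooth_on_subset[OF W(3)] o])
    fix z assume "z \<in> W \<inter> \<phi> ` U"
    then show "F z = f (inv_into U \<phi> z)"
      using W(4) chart_domain[OF U(1)] inv_into_f_f[OF chart_inj[OF U(1)]] by auto
  qed auto
  then show ?thesis using smooth_on_has_derivative W U by blast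
qed

lemma cfield_tan:
  assumes U: "(U, \<phi>) \<in> charts M" "q \<in> U"
  shows "cfield U \<phi> i q \<in> tangent_space M q"
proof -
  note d = smooth_near_inv[OF U]
  have iv: "inv_into U \<phi> (\<phi> q) = q" using inv_into_f_f[OF chart_inj[OF U(1)] U(2)] .
  have "cfield U \<phi> i q (\<lambda>r. f r + h r) = cfield U \<phi> i q f + cfield U \<phi> i q h"
    if f: "smooth_near M q f" and h: "smooth_near M q h" for f h
    using frechet_derivative_at[OF has_derivative_add[OF d[OF f] d[OF h]]] f h smooth_add[OF f h]
    by (simp add: cfield_def fun_eq_iff)
  moreover have "cfield U \<phi> i q (\<lambda>r. c * f r) = c * cfield U \<phi> i q f"
    if f: "smooth_near M q f" for f c
    using frechet_derivative_at[OF has_derivative_mult_right[OF d[OF f], of c]] f smooth_cmult[OF f]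
    by (simp add: cfield_def fun_eq_iff)
  moreover have "cfield U \<phi> i q (\<lambda>r. f r * h r) = f q * cfield U \<phi> i q h + h q * cfield U \<phi> i q f"
    if f: "smooth_near M q f" and h: "smooth_near M q h" for f h
    using frechet_derivative_at[OF has_derivative_mult[OF d[OF f] d[OF h]]] f h smooth_mult[OF f h]
    by (simp add: cfield_def fun_eq_iff iv mult.commute)
  ultimately show ?thesis
    unfolding tangent_space_def linear_on_def plus_fun_def scaleR_fun_def by (simp add: cfield_def)
qed

lemma cfield_coordinate:
  assumes U: "(U, \<phi>) \<in> charts M" "q \<in> U"
  shows "cfield U \<phi> i q (\<lambda>r. \<phi> r \<bullet> j) = i \<bullet> j"
proof -
  have q: "q \<in> points M" using chart_domain U by blast
  have "((\<lambda>z. \<phi> (inv_into U \<phi> z) \<bullet> j) has_derivative (\<lambda>v. v \<bullet> j)) (at (\<phi> q))"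
  proof (rule has_derivative_transform_within_open[OF _ chart_image_open[OF U(1)]])
    show "((\<lambda>z. z \<bullet> j) has_derivative (\<lambda>v. v \<bullet> j)) (at (\<phi> q))" by (auto intro!: derivative_eq_intros)
  qed (use U in \<open>auto simp: f_inv_into_f\<close>)
  then have "frechet_derivative (\<lambda>z. \<phi> (inv_into U \<phi> z) \<bullet> j) (at (\<phi> q)) i = i \<bullet> j"
    by (rule frechet_derivative_at[symmetric, THEN fun_cong])
  then show ?thesis using smooth_coordinate[OF q U, of j] by (simp add: cfield_def)
qed

lemma cfield_vf:
  assumes U: "(U, \<phi>) \<in> charts M" "q \<in> U"
  shows "vector_field_near M q (cfield U \<phi> i)"
proof -
  have q: "q \<in> points M" using chart_domain U by blast
  have e: "eventually (\<lambda>r. r \<in> U) (nhdf M q)" by (rule ev_domain[OF q U])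
  show ?thesis
  proof (rule vfI_chart[OF q U])
    show "eventually (\<lambda>q. cfield U \<phi> i q \<in> tangent_space M q) (nhdf M q)"
      using e by eventually_elim (rule cfield_tan[OF U(1)])
    fix j
    have "eventually (\<lambda>r. i \<bullet> j = cfield U \<phi> i r (\<lambda>r. \<phi> r \<bullet> j)) (nhdf M q)"
      using e by eventually_elim (simp add: cfield_coordinate[OF U(1)])
    then show "smooth_near M q (\<lambda>r. cfield U \<phi> i r (\<lambda>r. \<phi> r \<bullet> j))"
      by (rule smooth_near_cong[OF smooth_const[OF q]])
  qed
qed

lemma tan_expand:
  assumes U: "(U, \<phi>) \<in> charts M" "q \<in> U" and v: "v \<in> tangent_space M q"
  shows "v = (\<Sum>i\<in>Basis. v (\<lambda>r. \<phi> r \<bullet> i) *\<^sub>R cfield U \<phi> i q)"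
proof -
  have q: "q \<in> points M" using chart_domain U by blast
  show ?thesis
  proof (rule tan_eqI[OF v _ q U])
    show "(\<Sum>i\<in>Basis. v (\<lambda>r. \<phi> r \<bullet> i) *\<^sub>R cfield U \<phi> i q) \<in> tangent_space M q"
      by (intro subspace_sum[OF subspace_tangent_space] subspace_scale[OF subspace_tangent_space] cfield_tan[OF U])
    fix j :: 'e assume j: "j \<in> Basis"
    have "(\<Sum>i\<in>Basis. v (\<lambda>r. \<phi> r \<bullet> i) *\<^sub>R cfield U \<phi> i q) (\<lambda>r. \<phi> r \<bullet> j) =
       (\<Sum>i\<in>Basis. if i = j then v (\<lambda>r. \<phi> r \<bullet> j) else 0)"
      unfolding sum_fun_apply by (intro sum.cong refl) (auto simp: cfield_coordinate[OF U] inner_Basis j)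
    also have "\<dots> = v (\<lambda>r. \<phi> r \<bullet> j)" by (simp add: j)
    finally show "v (\<lambda>r. \<phi> r \<bullet> j) = (\<Sum>i\<in>Basis. v (\<lambda>r. \<phi> r \<bullet> i) *\<^sub>R cfield U \<phi> i q) (\<lambda>r. \<phi> r \<bullet> j)" ..
  qed
qed

text \<open>Since fields live only near \<open>x\<close>, freezing the coefficients of
  \<open>v\<close> in a chart is enough.\<close>

lemma extension:
  assumes x: "x \<in> points M" and v: "v \<in> tangent_space M x"
  obtains V where "vector_field_near M x V" "V x = v"
proof -
  obtain U \<phi> where U: "(U, \<phi>) \<in> charts M" "x \<in> U" using chart_at[OF x] .
  show ?thesis
    by (rule that[of "\<lambda>q. \<Sum>i\<in>Basis. v (\<lambda>r. \<phi> r \<bullet> i) *\<^sub>R cfield U \<phi> i q"])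
      (use tan_expand[OF U v] in \<open>auto intro!: vf_sum x vf_scale smooth_const cfield_vf[OF U]\<close>)
qed

end

locale riemannian = manifold M for M :: "('a, 'e::euclidean_space) space" +
  fixes g :: "'a \<Rightarrow> 'a tvec \<Rightarrow> 'a tvec \<Rightarrow> real" and D :: "'a connection"
  assumes metric: "riemannian_metric M g" and lc: "levi_civita M g D"
begin

section \<open>Linear algebra of the metric in one tangent space\<close>

lemma g_sym: "x \<in> points M \<Longrightarrow> u \<in> tangent_space M x \<Longrightarrow> v \<in> tangent_space M x \<Longrightarrow> g x u v = g x v u"
  and g_pos: "x \<in> points M \<Longrightarrow> u \<in> tangent_space M x \<Longrightarrow> u \<noteq> 0 \<Longrightarrow> g x u u > 0"
  and g_linear: "x \<in> points M \<Longrightarrow> u \<in> tangent_space M x \<Longrightarrow> linear_on (tangent_space M x) (g x u)"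
  and g_smooth: "vector_field_near M x V \<Longrightarrow> vector_field_near M x W \<Longrightarrow> smooth_near M x (\<lambda>q. g q (V q) (W q))"
  using metric vf_points[of x V] unfolding riemannian_metric_def pseudo_riemannian_metric_def by auto

lemma g_add_right: "x \<in> points M \<Longrightarrow> u \<in> tangent_space M x \<Longrightarrow> v \<in> tangent_space M x \<Longrightarrow> w \<in> tangent_space M x \<Longrightarrow>
    g x u (v + w) = g x u v + g x u w"
  and g_scale_right: "x \<in> points M \<Longrightarrow> u \<in> tangent_space M x \<Longrightarrow> v \<in> tangent_space M x \<Longrightarrow> g x u (r *\<^sub>R v) = r * g x u v"
  using g_linear[of x u] unfolding linear_on_def by auto

lemma T_add: "u \<in> tangent_space M x \<Longrightarrow> v \<in> tangent_space M x \<Longrightarrow> u + v \<in> tangent_space M x"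
  by (rule subspace_add[OF subspace_tangent_space])

lemma T_diff: "u \<in> tangent_space M x \<Longrightarrow> v \<in> tangent_space M x \<Longrightarrow> u - v \<in> tangent_space M x"
  by (rule subspace_diff[OF subspace_tangent_space])

lemma T_scale: "u \<in> tangent_space M x \<Longrightarrow> r *\<^sub>R u \<in> tangent_space M x"
  by (rule subspace_scale[OF subspace_tangent_space])

lemma T_zero: "0 \<in> tangent_space M x"
  by (rule subspace_0[OF subspace_tangent_space])

lemma T_sum: "(\<And>i. i \<in> I \<Longrightarrow> f i \<in> tangent_space M x) \<Longrightarrow> (\<Sum>i\<in>I. f i) \<in> tangent_space M x"
  by (rule subspace_sum[OF subspace_tangent_space])

lemmas T_intros = T_add T_diff T_scale T_zero T_sum

lemma g_add_left: "x \<in> points M \<Longrightarrow> u \<in> tangent_space M x \<Longrightarrow> v \<in> tangent_space M x \<Longrightarrow> w \<in> tangent_space M x \<Longrightarrow>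
    g x (v + w) u = g x v u + g x w u"
  using g_add_right[of x u v w] g_sym[of x "v + w" u] g_sym[of x v u] g_sym[of x w u] T_add[of v x w] by simp

lemma g_scale_left: "x \<in> points M \<Longrightarrow> u \<in> tangent_space M x \<Longrightarrow> v \<in> tangent_space M x \<Longrightarrow> g x (r *\<^sub>R v) u = r * g x v u"
  using g_scale_right[of x u v r] g_sym[of x "r *\<^sub>R v" u] g_sym[of x v u] T_scale[of v x r] by simp

lemma g_diff_right: "x \<in> points M \<Longrightarrow> u \<in> tangent_space M x \<Longrightarrow> v \<in> tangent_space M x \<Longrightarrow> w \<in> tangent_space M x \<Longrightarrow>
    g x u (v - w) = g x u v - g x u w"
  using g_add_right[of x u v "-1 *\<^sub>R w"] g_scale_right[of x u w "-1"] T_scale[of w x "-1"] by simp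

lemma g_diff_left: "x \<in> points M \<Longrightarrow> u \<in> tangent_space M x \<Longrightarrow> v \<in> tangent_space M x \<Longrightarrow> w \<in> tangent_space M x \<Longrightarrow>
    g x (v - w) u = g x v u - g x w u"
  using g_diff_right[of x u v w] g_sym[of x "v - w" u] g_sym[of x v u] g_sym[of x w u] T_diff[of v x w] by simp

lemma g_zero_left: "x \<in> points M \<Longrightarrow> u \<in> tangent_space M x \<Longrightarrow> g x 0 u = 0"
  using g_scale_left[of x u 0 0] T_zero by simp

lemma g_zero_right: "x \<in> points M \<Longrightarrow> u \<in> tangent_space M x \<Longrightarrow> g x u 0 = 0"
  using g_scale_right[of x u 0 0] T_zero by simp

lemma g_sum_right:
  assumes "x \<in> points M" "u \<in> tangent_space M x" "\<And>i. i \<in> I \<Longrightarrow> f i \<in> tangent_space M x"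
  shows "g x u (\<Sum>i\<in>I. f i) = (\<Sum>i\<in>I. g x u (f i))"
  using assms(3)
  by (induction I rule: infinite_finite_induct) (auto simp: g_zero_right g_add_right T_sum assms(1,2))

lemma g_sum_left:
  assumes "x \<in> points M" "u \<in> tangent_space M x" "\<And>i. i \<in> I \<Longrightarrow> f i \<in> tangent_space M x"
  shows "g x (\<Sum>i\<in>I. f i) u = (\<Sum>i\<in>I. g x (f i) u)"
  using assms(3)
  by (induction I rule: infinite_finite_induct) (auto simp: g_zero_left g_add_left T_sum assms(1,2))

lemma g_eqI:
  assumes x: "x \<in> points M" and u: "u \<in> tangent_space M x" and v: "v \<in> tangent_space M x"
    and eq: "\<And>w. w \<in> tangent_space M x \<Longrightarrow> g x u w = g x v w"
  shows "u = v"
proof (rule ccontr)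
  assume "u \<noteq> v"
  then have "g x (u - v) (u - v) > 0" using g_pos[OF x T_diff[OF u v]] by simp
  moreover have "g x (u - v) (u - v) = 0"
    using eq[OF T_diff[OF u v]] g_diff_left[OF x T_diff[OF u v] u v] by simp
  ultimately show False by simp
qed

section \<open>Calculus with the Levi-Civita connection\<close>

lemma D_props:
  assumes "vector_field_near M x Y"
  shows D_tan: "v \<in> tangent_space M x \<Longrightarrow> D x v Y \<in> tangent_space M x"
    and D_linear: "linear_on (tangent_space M x) (\<lambda>v. D x v Y)"
    and D_add: "v \<in> tangent_space M x \<Longrightarrow> vector_field_near M x Z \<Longrightarrow> D x v (\<lambda>y. Y y + Z y) = D x v Y + D x v Z"
    and D_leibniz: "v \<in> tangent_space M x \<Longrightarrow> smooth_near M x f \<Longrightarrow>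
        D x v (\<lambda>y. f y *\<^sub>R Y y) = f x *\<^sub>R D x v Y + v f *\<^sub>R Y x"
    and D_vf: "vector_field_near M x V \<Longrightarrow> vector_field_near M x (\<lambda>y. D y (V y) Y)"
  using lc assms vf_points[OF assms] unfolding levi_civita_def affine_connection_def plus_fun_def by auto

lemma D_torsion: "vector_field_near M x Y \<Longrightarrow> vector_field_near M x Z \<Longrightarrow>
    D x (Y x) Z - D x (Z x) Y = lie_bracket M Y Z x"
  using lc vf_points[of x Y] unfolding levi_civita_def by auto

lemma D_metric: "vector_field_near M x Y \<Longrightarrow> vector_field_near M x Z \<Longrightarrow> v \<in> tangent_space M x \<Longrightarrow>
    v (\<lambda>y. g y (Y y) (Z y)) = g x (D x v Y) (Z x) + g x (Y x) (D x v Z)"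
  using lc vf_points[of x Y] unfolding levi_civita_def by auto

lemma D_dir_add: "vector_field_near M x Y \<Longrightarrow> v \<in> tangent_space M x \<Longrightarrow> w \<in> tangent_space M x \<Longrightarrow>
    D x (v + w) Y = D x v Y + D x w Y"
  and D_dir_scale: "vector_field_near M x Y \<Longrightarrow> v \<in> tangent_space M x \<Longrightarrow> D x (r *\<^sub>R v) Y = r *\<^sub>R D x v Y"
  using D_linear[of x Y] unfolding linear_on_def by auto

lemma D_dir_sum:
  assumes Y: "vector_field_near M x Y" and f: "\<And>i. i \<in> I \<Longrightarrow> f i \<in> tangent_space M x"
  shows "D x (\<Sum>i\<in>I. f i) Y = (\<Sum>i\<in>I. D x (f i) Y)"
  using f D_dir_scale[OF Y T_zero, of 0]
  by (induction I rule: infinite_finite_induct) (auto simp: D_dir_add[OF Y] T_sum)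

lemma D_zero:
  assumes x: "x \<in> points M" and v: "v \<in> tangent_space M x" shows "D x v (\<lambda>y. 0) = 0"
  using D_leibniz[OF vf_zero[OF x] v smooth_const[OF x], of 0] tan_const[OF v x] by simp

lemma D_sum:
  assumes x: "x \<in> points M" and v: "v \<in> tangent_space M x" and Y: "\<And>i. i \<in> I \<Longrightarrow> vector_field_near M x (Y i)"
  shows "D x v (\<lambda>y. \<Sum>i\<in>I. Y i y) = (\<Sum>i\<in>I. D x v (Y i))"
  using Y
proof (induction I rule: infinite_finite_induct)
  case (insert i I)
  have "(\<lambda>y. \<Sum>i\<in>insert i I. Y i y) = (\<lambda>y. Y i y + (\<Sum>i\<in>I. Y i y))"
    by (rule ext) (rule sum.insert[OF insert.hyps])
  moreover have "D x v (\<lambda>y. Y i y + (\<Sum>i\<in>I. Y i y)) = D x v (Y i) + D x v (\<lambda>y. \<Sum>i\<in>I. Y i y)"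
    by (rule D_add) (use insert.prems v vf_sum[OF x, of I Y] in auto)
  ultimately show ?case using insert.IH insert.prems sum.insert[OF insert.hyps, of "\<lambda>i. D x v (Y i)"] by simp
qed (simp_all add: D_zero[OF x v])

lemma D_diff:
  assumes Y: "vector_field_near M x Y" and Z: "vector_field_near M x Z" and v: "v \<in> tangent_space M x"
  shows "D x v (\<lambda>y. Y y - Z y) = D x v Y - D x v Z"
proof -
  note x = vf_points[OF Y]
  have "D x v (\<lambda>y. Y y + (-1) *\<^sub>R Z y) = D x v Y + D x v (\<lambda>y. (-1) *\<^sub>R Z y)"
    by (rule D_add[OF Y v vf_scale[OF Z smooth_const[OF x]]])
  then show ?thesis using D_leibniz[OF Z v smooth_const[OF x], of "-1"] tan_const[OF v x, of "-1"] by simp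
qed

text \<open>The indicator \<open>k\<close> of the set where the fields agree equals 1 near
  \<open>x\<close>, so its derivative is 0 and multiplication by it does not change the covariant
  derivative at \<open>x\<close>; and \<open>k\<close> times \<open>Y\<close> is \<open>k\<close>
  times \<open>Z\<close> everywhere.\<close>

lemma D_local:
  assumes Y: "vector_field_near M x Y" and v: "v \<in> tangent_space M x"
    and e: "eventually (\<lambda>y. Y y = Z y) (nhdf M x)"
  shows "D x v Y = D x v Z"
proof -
  note x = vf_points[OF Y]
  have Z: "vector_field_near M x Z" by (rule vf_cong[OF Y e])
  define k where "k y = (if Y y = Z y then 1 else 0 :: real)" for y
  have ek: "eventually (\<lambda>y. 1 = k y) (nhdf M x)" using e by eventually_elim (simp add: k_def)
  have k: "smooth_near M x k" by (rule smooth_near_cong[OF smooth_const[OF x] ek])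
  have kx: "k x = 1" using ev_at[OF ek x] by simp
  have vk: "v k = 0" using tan_local[OF v x ek] tan_const[OF v x] by simp
  have "(\<lambda>y. k y *\<^sub>R Y y) = (\<lambda>y. k y *\<^sub>R Z y)" by (auto simp: k_def)
  then show ?thesis using D_leibniz[OF Y v k] D_leibniz[OF Z v k] kx vk by simp
qed

text \<open>From an arbitrary extension \<open>Y\<close> subtract the sum of (x^i - x^i(x)) times
  the covariant derivative of \<open>Y\<close> along the i-th coordinate field. This correction
  vanishes at \<open>x\<close>, and its covariant derivative there is that of \<open>Y\<close>. The
  lemma guarantees that the choice made in \<open>horizontal_lift\<close> picks a parallel
  section.\<close>

lemma parallel_extension:
  assumes x: "x \<in> points M" and u: "u \<in> tangent_space M x"
  shows "\<exists>Z. vector_field_near M x Z \<and> Z x = u \<and> (\<forall>v\<in>tangent_space M x. D x v Z = 0)"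
proof -
  obtain U \<phi> where U: "(U, \<phi>) \<in> charts M" "x \<in> U" using chart_at[OF x] .
  obtain Y where Y: "vector_field_near M x Y" "Y x = u" using extension[OF x u] .
  define F where "F i y = (\<phi> y \<bullet> i - \<phi> x \<bullet> i) *\<^sub>R D y (cfield U \<phi> i y) Y" for i y
  have c: "smooth_near M x (\<lambda>y. \<phi> y \<bullet> i - \<phi> x \<bullet> i)" for i
    by (rule smooth_diff[OF smooth_coordinate[OF x U] smooth_const[OF x]])
  have DY: "vector_field_near M x (\<lambda>y. D y (cfield U \<phi> i y) Y)" for i
    by (rule D_vf[OF Y(1) cfield_vf[OF U]])
  have F: "vector_field_near M x (F i)" for i unfolding F_def by (rule vf_scale[OF DY c])
  have DF: "D x v (F i) = v (\<lambda>y. \<phi> y \<bullet> i) *\<^sub>R D x (cfield U \<phi> i x) Y" if v: "v \<in> tangent_space M x" for v i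
    unfolding F_def D_leibniz[OF DY v c]
    using tan_diff[OF v smooth_coordinate[OF x U] smooth_const[OF x]] tan_const[OF v x] by simp
  have sF: "vector_field_near M x (\<lambda>y. \<Sum>i\<in>Basis. F i y)" by (rule vf_sum[OF x F])
  show ?thesis
  proof (intro exI conjI ballI)
    show "vector_field_near M x (\<lambda>y. Y y - (\<Sum>i\<in>Basis. F i y))" by (rule vf_diff[OF Y(1) sF])
    show "Y x - (\<Sum>i\<in>Basis. F i x) = u" by (simp add: F_def Y(2))
    fix v assume v: "v \<in> tangent_space M x"
    have "D x v Y = D x (\<Sum>i\<in>Basis. v (\<lambda>y. \<phi> y \<bullet> i) *\<^sub>R cfield U \<phi> i x) Y"
      using tan_expand[OF U v] by simp
    also have "\<dots> = (\<Sum>i\<in>Basis. D x v (F i))"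
      by (subst D_dir_sum[OF Y(1)]) (auto intro!: T_scale cfield_tan[OF U] sum.cong simp: DF[OF v] D_dir_scale[OF Y(1) cfield_tan[OF U]])
    finally show "D x v (\<lambda>y. Y y - (\<Sum>i\<in>Basis. F i y)) = 0"
      using D_diff[OF Y(1) sF v] D_sum[OF x v, of Basis F] F by simp
  qed
qed

section \<open>Symmetries of the curvature\<close>

lemma curvature_vf_tan:
  assumes X: "vector_field_near M x X" and Y: "vector_field_near M x Y" and Z: "vector_field_near M x Z"
  shows "curvature M D X Y Z x \<in> tangent_space M x"
  unfolding curvature_def
  by (intro T_diff D_tan[OF D_vf[OF Z Y] vf_tan[OF X]] D_tan[OF D_vf[OF Z X] vf_tan[OF Y]] D_tan[OF Z lie_tan[OF X Y]])

lemma curvature_skew: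
  assumes X: "vector_field_near M x X" and Y: "vector_field_near M x Y" and Z: "vector_field_near M x Z"
  shows "curvature M D X Y Z x = - curvature M D Y X Z x"
  unfolding curvature_def lie_swap[of X Y x]
  using D_dir_scale[OF Z lie_tan[OF Y X], of "-1"] by simp

text \<open>Compute [X, Y] <Z, W> once as a commutator, with metric compatibility used twice, and
  once directly. The terms with one derivative on each of \<open>Z\<close> and \<open>W\<close> are
  symmetric in \<open>X\<close> and \<open>Y\<close> and cancel.\<close>

lemma curvature_metric:
  assumes X: "vector_field_near M x X" and Y: "vector_field_near M x Y"
    and Z: "vector_field_near M x Z" and W: "vector_field_near M x W"
  shows "g x (curvature M D X Y Z x) (W x) = - g x (curvature M D X Y W x) (Z x)"
proof -
  note x = vf_points[OF X]
  have second: "X x (\<lambda>q. Y q (\<lambda>y. g y (Z y) (W y))) =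
      g x (D x (X x) (\<lambda>y. D y (Y y) Z)) (W x) + g x (D x (Y x) Z) (D x (X x) W)
      + (g x (D x (X x) Z) (D x (Y x) W) + g x (Z x) (D x (X x) (\<lambda>y. D y (Y y) W)))"
    if X: "vector_field_near M x X" and Y: "vector_field_near M x Y" for X Y
  proof -
    have "eventually (\<lambda>q. Y q (\<lambda>y. g y (Z y) (W y)) = g q (D q (Y q) Z) (W q) + g q (Z q) (D q (Y q) W)) (nhdf M x)"
      using vf_near[OF Z] vf_near[OF W] vf_ev[OF Y] by eventually_elim (rule D_metric)
    then have "X x (\<lambda>q. Y q (\<lambda>y. g y (Z y) (W y))) =
        X x (\<lambda>q. g q (D q (Y q) Z) (W q) + g q (Z q) (D q (Y q) W))"
      by (rule tan_local[OF vf_tan[OF X] x])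
    also have "\<dots> = X x (\<lambda>q. g q (D q (Y q) Z) (W q)) + X x (\<lambda>q. g q (Z q) (D q (Y q) W))"
      by (rule tan_add[OF vf_tan[OF X] g_smooth[OF D_vf[OF Z Y] W] g_smooth[OF Z D_vf[OF W Y]]])
    finally show ?thesis
      using D_metric[OF D_vf[OF Z Y] W vf_tan[OF X]] D_metric[OF Z D_vf[OF W Y] vf_tan[OF X]] by simp
  qed
  note t = D_tan[OF D_vf[OF Z Y] vf_tan[OF X]] D_tan[OF D_vf[OF Z X] vf_tan[OF Y]] D_tan[OF Z lie_tan[OF X Y]]
    D_tan[OF D_vf[OF W Y] vf_tan[OF X]] D_tan[OF D_vf[OF W X] vf_tan[OF Y]] D_tan[OF W lie_tan[OF X Y]]
    D_tan[OF Z vf_tan[OF X]] D_tan[OF Z vf_tan[OF Y]] D_tan[OF W vf_tan[OF X]] D_tan[OF W vf_tan[OF Y]]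
    vf_tan[OF Z] vf_tan[OF W]
  have "lie_bracket M X Y x (\<lambda>y. g y (Z y) (W y)) =
      g x (D x (lie_bracket M X Y x) Z) (W x) + g x (Z x) (D x (lie_bracket M X Y x) W)"
    by (rule D_metric[OF Z W lie_tan[OF X Y]])
  moreover have "lie_bracket M X Y x (\<lambda>y. g y (Z y) (W y)) =
      X x (\<lambda>q. Y q (\<lambda>y. g y (Z y) (W y))) - Y x (\<lambda>q. X q (\<lambda>y. g y (Z y) (W y)))"
    by (rule lie_apply[OF g_smooth[OF Z W]])
  moreover have "g x (curvature M D X Y Z x) (W x) = g x (D x (X x) (\<lambda>y. D y (Y y) Z)) (W x)
      - g x (D x (Y x) (\<lambda>y. D y (X y) Z)) (W x) - g x (D x (lie_bracket M X Y x) Z) (W x)"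
    unfolding curvature_def by (simp add: g_diff_left x t T_diff)
  moreover have "g x (curvature M D X Y W x) (Z x) = g x (D x (X x) (\<lambda>y. D y (Y y) W)) (Z x)
      - g x (D x (Y x) (\<lambda>y. D y (X y) W)) (Z x) - g x (D x (lie_bracket M X Y x) W) (Z x)"
    unfolding curvature_def by (simp add: g_diff_left x t T_diff)
  ultimately show ?thesis
    using second[OF X Y] second[OF Y X] g_sym[OF x t(11) t(4)] g_sym[OF x t(11) t(5)] g_sym[OF x t(11) t(6)]
      g_sym[OF x t(7) t(10)] g_sym[OF x t(8) t(9)]
    by simp
qed

text \<open>Vanishing torsion turns the suitably grouped terms of the cyclic sum into iterated Lie
  brackets, whose sum is zero by \<open>jacobi\<close>.\<close>

lemma curvature_bianchi:
  assumes X: "vector_field_near M x X" and Y: "vector_field_near M x Y" and Z: "vector_field_near M x Z"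
  shows "curvature M D X Y Z x + curvature M D Y Z X x + curvature M D Z X Y x = 0"
proof -
  have *: "D x (X x) (\<lambda>y. D y (Y y) Z) - D x (X x) (\<lambda>y. D y (Z y) Y) - D x (lie_bracket M Y Z x) X
      = lie_bracket M X (lie_bracket M Y Z) x"
    if X: "vector_field_near M x X" and Y: "vector_field_near M x Y" and Z: "vector_field_near M x Z" for X Y Z
  proof -
    have "eventually (\<lambda>y. D y (Y y) Z - D y (Z y) Y = lie_bracket M Y Z y) (nhdf M x)"
      using vf_near[OF Y] vf_near[OF Z] by eventually_elim (rule D_torsion)
    then have "D x (X x) (\<lambda>y. D y (Y y) Z - D y (Z y) Y) = D x (X x) (lie_bracket M Y Z)"
      by (rule D_local[OF vf_diff[OF D_vf[OF Z Y] D_vf[OF Y Z]] vf_tan[OF X]])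
    then show ?thesis
      using D_diff[OF D_vf[OF Z Y] D_vf[OF Y Z] vf_tan[OF X]] D_torsion[OF X vf_lie[OF Y Z]] by simp
  qed
  show ?thesis
    using *[OF X Y Z] *[OF Y Z X] *[OF Z X Y] jacobi[OF X Y Z] unfolding curvature_def
    by (simp add: algebra_simps)
qed

end

text \<open>The four Bianchi identities for the cyclic rotations of (a, b, c, d), combined with the
  two skew symmetries, give the claim linearly. Only a set \<open>S\<close> is involved, so that the
  lemma applies to vector fields, before tensoriality is known, as well as to vectors.\<close>

lemma curvature_pair_symmetry:
  fixes R :: "'s \<Rightarrow> 's \<Rightarrow> 's \<Rightarrow> 's \<Rightarrow> real"
  assumes s1: "\<And>a b c d. a \<in> S \<Longrightarrow> b \<in> S \<Longrightarrow> c \<in> S \<Longrightarrow> d \<in> S \<Longrightarrow> R a b c d = - R b a c d"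
    and s2: "\<And>a b c d. a \<in> S \<Longrightarrow> b \<in> S \<Longrightarrow> c \<in> S \<Longrightarrow> d \<in> S \<Longrightarrow> R a b c d = - R a b d c"
    and b: "\<And>a b c d. a \<in> S \<Longrightarrow> b \<in> S \<Longrightarrow> c \<in> S \<Longrightarrow> d \<in> S \<Longrightarrow> R a b c d + R b c a d + R c a b d = 0"
    and S: "a \<in> S" "b \<in> S" "c \<in> S" "d \<in> S"
  shows "R a b c d = R c d a b"
proof -
  have "R b c d a = - R b c a d" "R c d b a = - R c d a b" "R d b c a = - R b d c a"
    "R d a c b = R a d b c" "R a c d b = R c a b d"
    "R d a b c = - R a d b c" "R a b d c = - R a b c d" "R b d a c = - R b d c a"
    using s1[OF S(4) S(2) S(3) S(1)] s1[OF S(4) S(1) S(3) S(2)] s2[OF S(1) S(4) S(3) S(2)]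
      s1[OF S(1) S(3) S(4) S(2)] s2[OF S(3) S(1) S(4) S(2)] s1[OF S(4) S(1) S(2) S(3)]
      s2[OF S(2) S(3) S(4) S(1)] s2[OF S(3) S(4) S(2) S(1)] s2[OF S(1) S(2) S(4) S(3)] s2[OF S(2) S(4) S(1) S(3)]
    by auto
  then show ?thesis
    using b[OF S(1) S(2) S(3) S(4)] b[OF S(2) S(3) S(4) S(1)] b[OF S(3) S(4) S(1) S(2)] b[OF S(4) S(1) S(2) S(3)]
    by linarith
qed

text \<open>Linearity is assumed in the last slot, and the symmetries carry it to the other three.
  The locale is used for \<open>Rm x\<close> and for its difference from the model of constant
  curvature.\<close>

locale curvature_like =
  fixes T :: "'s::real_vector set" and R :: "'s \<Rightarrow> 's \<Rightarrow> 's \<Rightarrow> 's \<Rightarrow> real"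
  assumes subspace: "subspace T"
    and skew1: "a \<in> T \<Longrightarrow> b \<in> T \<Longrightarrow> c \<in> T \<Longrightarrow> d \<in> T \<Longrightarrow> R a b c d = - R b a c d"
    and skew2: "a \<in> T \<Longrightarrow> b \<in> T \<Longrightarrow> c \<in> T \<Longrightarrow> d \<in> T \<Longrightarrow> R a b c d = - R a b d c"
    and bianchi: "a \<in> T \<Longrightarrow> b \<in> T \<Longrightarrow> c \<in> T \<Longrightarrow> d \<in> T \<Longrightarrow> R a b c d + R b c a d + R c a b d = 0"
    and add4: "a \<in> T \<Longrightarrow> b \<in> T \<Longrightarrow> c \<in> T \<Longrightarrow> d \<in> T \<Longrightarrow> e \<in> T \<Longrightarrow> R a b c (d + e) = R a b c d + R a b c e"
    and scale4: "a \<in> T \<Longrightarrow> b \<in> T \<Longrightarrow> c \<in> T \<Longrightarrow> d \<in> T \<Longrightarrow> R a b c (r *\<^sub>R d) = r * R a b c d"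
begin

lemma pair_symmetry: "a \<in> T \<Longrightarrow> b \<in> T \<Longrightarrow> c \<in> T \<Longrightarrow> d \<in> T \<Longrightarrow> R a b c d = R c d a b"
  using curvature_pair_symmetry[of T R a b c d] skew1 skew2 bianchi by blast

lemma T_closed: "a \<in> T \<Longrightarrow> b \<in> T \<Longrightarrow> a + b \<in> T" "a \<in> T \<Longrightarrow> r *\<^sub>R a \<in> T"
  using subspace subspace_add subspace_scale by blast+

lemma add3: "a \<in> T \<Longrightarrow> b \<in> T \<Longrightarrow> c \<in> T \<Longrightarrow> d \<in> T \<Longrightarrow> e \<in> T \<Longrightarrow> R a b (c + e) d = R a b c d + R a b e d"
  using skew2[of a b "c + e" d] skew2[of a b c d] skew2[of a b e d] add4[of a b d c e] T_closed by simp

lemma add2: "a \<in> T \<Longrightarrow> b \<in> T \<Longrightarrow> c \<in> T \<Longrightarrow> d \<in> T \<Longrightarrow> e \<in> T \<Longrightarrow> R a (b + e) c d = R a b c d + R a e c d"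
  using pair_symmetry[of a "b + e" c d] pair_symmetry[of a b c d] pair_symmetry[of a e c d] add4[of c d a b e] T_closed by simp

lemma add1: "a \<in> T \<Longrightarrow> b \<in> T \<Longrightarrow> c \<in> T \<Longrightarrow> d \<in> T \<Longrightarrow> e \<in> T \<Longrightarrow> R (a + e) b c d = R a b c d + R e b c d"
  using pair_symmetry[of "a + e" b c d] pair_symmetry[of a b c d] pair_symmetry[of e b c d] add3[of c d a b e] T_closed by simp

lemma scale3: "a \<in> T \<Longrightarrow> b \<in> T \<Longrightarrow> c \<in> T \<Longrightarrow> d \<in> T \<Longrightarrow> R a b (r *\<^sub>R c) d = r * R a b c d"
  using skew2[of a b "r *\<^sub>R c" d] skew2[of a b c d] scale4[of a b d c r] T_closed by simp

lemma scale2: "a \<in> T \<Longrightarrow> b \<in> T \<Longrightarrow> c \<in> T \<Longrightarrow> d \<in> T \<Longrightarrow> R a (r *\<^sub>R b) c d = r * R a b c d"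
  using pair_symmetry[of a "r *\<^sub>R b" c d] pair_symmetry[of a b c d] scale4[of c d a b r] T_closed by simp

lemma scale1: "a \<in> T \<Longrightarrow> b \<in> T \<Longrightarrow> c \<in> T \<Longrightarrow> d \<in> T \<Longrightarrow> R (r *\<^sub>R a) b c d = r * R a b c d"
  using pair_symmetry[of "r *\<^sub>R a" b c d] pair_symmetry[of a b c d] scale3[of c d a b r] T_closed by simp

lemma diag1: "a \<in> T \<Longrightarrow> c \<in> T \<Longrightarrow> d \<in> T \<Longrightarrow> R a a c d = 0"
  using skew1[of a a c d] by simp

lemma diag2: "a \<in> T \<Longrightarrow> b \<in> T \<Longrightarrow> c \<in> T \<Longrightarrow> R a b c c = 0"
  using skew2[of a b c c] by simp

text \<open>Polarising \<open>R a b b a = 0\<close> in \<open>a\<close> and then in \<open>b\<close>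
  shows that \<open>R\<close> is also skew in its two middle slots. The three terms of the Bianchi
  identity are then equal, so each is zero.\<close>

lemma zero_of_sectional:
  assumes sec: "\<And>a b. a \<in> T \<Longrightarrow> b \<in> T \<Longrightarrow> R a b b a = 0"
    and T: "a \<in> T" "b \<in> T" "c \<in> T" "d \<in> T"
  shows "R a b c d = 0"
proof -
  have 1: "R a b b c = 0" if "a \<in> T" "b \<in> T" "c \<in> T" for a b c
  proof -
    have "R a b b c + R c b b a = 0"
      using sec[of "a + c" b] sec[of a b] sec[of c b] that add1[of a b b "a + c" c] add4[of a b b a c] add4[of c b b a c] T_closed
      by simp
    moreover have "R c b b a = R a b b c"
      using that pair_symmetry[of c b b a] skew1[of b a c b] skew2[of a b c b] by simp
    ultimately show ?thesis by simp
  qed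
  have 2: "R a b c d = - R a c b d" if "a \<in> T" "b \<in> T" "c \<in> T" "d \<in> T" for a b c d
    using 1[of a "b + c" d] 1[of a b d] 1[of a c d] that add2[of a b "b + c" d c] add3[of a b b d c] add3[of a c b d c] T_closed
    by simp
  show ?thesis
    using bianchi[OF T] 2[OF T] 2[of c a b d] skew1[of b c a d] skew1[of a c b d] T by simp
qed

end

context riemannian
begin

text \<open>Tensoriality without differentiating coefficient functions: g(R(X,Y)Z, W) depends on
  \<open>W\<close> only through \<open>W x\<close> by its very form, and the symmetries move each of
  the other fields into that last place in turn.\<close>

lemma g_curvature_cong:
  assumes X: "vector_field_near M x X" "vector_field_near M x X'" "X x = X' x"
    and Y: "vector_field_near M x Y" "vector_field_near M x Y'" "Y x = Y' x"
    and Z: "vector_field_near M x Z" "vector_field_near M x Z'" "Z x = Z' x"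
    and w: "w \<in> tangent_space M x"
  shows "g x (curvature M D X Y Z x) w = g x (curvature M D X' Y' Z' x) w"
proof -
  note x = vf_points[OF X(1)]
  let ?R = "\<lambda>X Y Z W. g x (curvature M D X Y Z x) (W x)"
  let ?S = "{V. vector_field_near M x V}"
  have skew1: "?R X Y Z W = - ?R Y X Z W" if "X \<in> ?S" "Y \<in> ?S" "Z \<in> ?S" "W \<in> ?S" for X Y Z W
  proof -
    have v: "vector_field_near M x X" "vector_field_near M x Y" "vector_field_near M x Z" "vector_field_near M x W"
      using that by auto
    show ?thesis unfolding curvature_skew[OF v(1-3)]
      using g_scale_left[OF x vf_tan[OF v(4)] curvature_vf_tan[OF v(2,1,3)], of "-1"] by simp
  qed
  have skew2: "?R X Y Z W = - ?R X Y W Z" if "X \<in> ?S" "Y \<in> ?S" "Z \<in> ?S" "W \<in> ?S" for X Y Z W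
    by (rule curvature_metric) (use that in auto)
  have "?R X Y Z W + ?R Y Z X W + ?R Z X Y W = 0" if "X \<in> ?S" "Y \<in> ?S" "Z \<in> ?S" "W \<in> ?S" for X Y Z W
  proof -
    have v: "vector_field_near M x X" "vector_field_near M x Y" "vector_field_near M x Z" "vector_field_near M x W"
      using that by auto
    note t = curvature_vf_tan[OF v(1,2,3)] curvature_vf_tan[OF v(2,3,1)] curvature_vf_tan[OF v(3,1,2)]
    have "g x (curvature M D X Y Z x + curvature M D Y Z X x + curvature M D Z X Y x) (W x) = 0"
      unfolding curvature_bianchi[OF v(1-3)] by (rule g_zero_left[OF x vf_tan[OF v(4)]])
    then show ?thesis
      unfolding g_add_left[OF x vf_tan[OF v(4)] T_add[OF t(1,2)] t(3)] g_add_left[OF x vf_tan[OF v(4)] t(1,2)] .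
  qed
  then have pair: "?R X Y Z W = ?R Z W X Y" if "X \<in> ?S" "Y \<in> ?S" "Z \<in> ?S" "W \<in> ?S" for X Y Z W
    using that by (intro curvature_pair_symmetry[of ?S ?R X Y Z W] skew1 skew2) auto
  obtain W where W: "vector_field_near M x W" "W x = w" using extension[OF x w] .
  have m: "X \<in> ?S" "X' \<in> ?S" "Y \<in> ?S" "Y' \<in> ?S" "Z \<in> ?S" "Z' \<in> ?S" "W \<in> ?S"
    using X Y Z W by auto
  have c3: "?R X Y Z W = ?R X Y Z' W"
    unfolding skew2[OF m(1,3,5,7)] skew2[OF m(1,3,6,7)] Z(3) ..
  have c2: "?R X Y Z' W = ?R X Y' Z' W"
    unfolding pair[OF m(1,3,6,7)] pair[OF m(1,4,6,7)] Y(3) ..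
  have c1: "?R X Y' Z' W = ?R X' Y' Z' W"
    unfolding pair[OF m(1,4,6,7)] pair[OF m(2,4,6,7)] skew2[OF m(6,7,1,4)] skew2[OF m(6,7,2,4)] X(3) ..
  show ?thesis using c1 c2 c3 unfolding W(2) by (simp only:)
qed

definition extend :: "'a \<Rightarrow> 'a tvec \<Rightarrow> 'a \<Rightarrow> 'a tvec" where
  "extend x v = (SOME V. vector_field_near M x V \<and> V x = v)"

lemma extend: "x \<in> points M \<Longrightarrow> v \<in> tangent_space M x \<Longrightarrow> vector_field_near M x (extend x v) \<and> extend x v x = v"
  unfolding extend_def by (rule someI_ex[of "\<lambda>V. vector_field_near M x V \<and> V x = v"]) (meson extension)

text \<open>The curvature as a tensor on a single tangent space. By \<open>g_curvature_cong\<close>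
  the choice made in \<open>extend\<close> does not affect it.\<close>

definition Rm :: "'a \<Rightarrow> 'a tvec \<Rightarrow> 'a tvec \<Rightarrow> 'a tvec \<Rightarrow> 'a tvec \<Rightarrow> real" where
  "Rm x a b c d = g x (curvature M D (extend x a) (extend x b) (extend x c) x) d"

lemma Rm_eq:
  assumes X: "vector_field_near M x X" and Y: "vector_field_near M x Y" and Z: "vector_field_near M x Z"
    and w: "w \<in> tangent_space M x"
  shows "g x (curvature M D X Y Z x) w = Rm x (X x) (Y x) (Z x) w"
  unfolding Rm_def using extend[OF vf_points[OF X]] vf_tan[OF X] vf_tan[OF Y] vf_tan[OF Z] X Y Z w
  by (intro g_curvature_cong) auto

lemma Rm_curvature_like:
  assumes x: "x \<in> points M"
  shows "curvature_like (tangent_space M x) (Rm x)"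
proof
  show "subspace (tangent_space M x)" by (rule subspace_tangent_space)
  fix a b c d e :: "'a tvec" and r :: real
  assume T: "a \<in> tangent_space M x" "b \<in> tangent_space M x" "c \<in> tangent_space M x" "d \<in> tangent_space M x"
  obtain A where A: "vector_field_near M x A" "A x = a" using extension[OF x T(1)] .
  obtain B where B: "vector_field_near M x B" "B x = b" using extension[OF x T(2)] .
  obtain C where C: "vector_field_near M x C" "C x = c" using extension[OF x T(3)] .
  obtain E where E: "vector_field_near M x E" "E x = d" using extension[OF x T(4)] .
  note Rs = Rm_eq[OF A(1) B(1) C(1), unfolded A B C]
  note t = curvature_vf_tan[OF A(1) B(1) C(1)] curvature_vf_tan[OF B(1) C(1) A(1)] curvature_vf_tan[OF C(1) A(1) B(1)]
    curvature_vf_tan[OF B(1) A(1) C(1)]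
  show "Rm x a b c d = - Rm x b a c d"
    using curvature_skew[OF A(1) B(1) C(1)] g_scale_left[OF x T(4) t(4), of "-1"]
      Rs[OF T(4)] Rm_eq[OF B(1) A(1) C(1) T(4), unfolded A B C] by simp
  show "Rm x a b c d = - Rm x a b d c"
    using curvature_metric[OF A(1) B(1) C(1) E(1)] Rs[OF T(4)] Rm_eq[OF A(1) B(1) E(1) T(3), unfolded A B C E] C E by simp
  show "Rm x a b c d + Rm x b c a d + Rm x c a b d = 0"
    using curvature_bianchi[OF A(1) B(1) C(1)] Rs[OF T(4)] Rm_eq[OF B(1) C(1) A(1) T(4), unfolded A B C]
      Rm_eq[OF C(1) A(1) B(1) T(4), unfolded A B C] g_zero_left[OF x T(4)]
      g_add_left[OF x T(4) t(1) t(2)] g_add_left[OF x T(4) T_add[OF t(1) t(2)] t(3)] by simp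
  show "Rm x a b c (r *\<^sub>R d) = r * Rm x a b c d"
    using Rs[OF T(4)] Rs[OF T_scale[OF T(4), of r]] g_scale_right[OF x t(1) T(4)] by simp
  assume e: "e \<in> tangent_space M x"
  show "Rm x a b c (d + e) = Rm x a b c d + Rm x a b c e"
    using Rs[OF T(4)] Rs[OF e] Rs[OF T_add[OF T(4) e]] g_add_right[OF x t(1) T(4) e] by simp
qed

text \<open>The component of \<open>a\<close> orthogonal to \<open>b\<close> is nonzero by
  independence, and its squared norm times that of \<open>b\<close> is the Gram determinant.\<close>

lemma gram_pos:
  assumes x: "x \<in> points M" and T: "a \<in> tangent_space M x" "b \<in> tangent_space M x"
    and ind: "a \<noteq> b" "independent {a, b}"
  shows "g x a a * g x b b - (g x a b)\<^sup>2 > 0"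
proof -
  have "b \<noteq> 0" using ind dependent_zero by blast
  then have b: "g x b b > 0" by (rule g_pos[OF x T(2)])
  define t where "t = g x a b / g x b b"
  have "a \<noteq> t *\<^sub>R b"
  proof
    assume "a = t *\<^sub>R b"
    then have "a \<in> span {b}" by (auto simp: span_singleton)
    then show False using ind by (simp add: independent_insert)
  qed
  then have "g x (a - t *\<^sub>R b) (a - t *\<^sub>R b) > 0"
    using g_pos[OF x T_diff[OF T(1) T_scale[OF T(2)]]] by simp
  also have "g x (a - t *\<^sub>R b) (a - t *\<^sub>R b) = g x a a - t * g x a b"
    using T x b g_sym[OF x T]
    by (simp add: g_diff_left g_diff_right g_scale_left g_scale_right T_intros t_def)
  finally have "0 < (g x a a - t * g x a b) * g x b b" using b by simp
  then show ?thesis using b by (simp add: t_def field_simps power2_eq_square)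
qed

text \<open>The difference \<open>Q\<close> from the model tensor has all symmetries of a curvature
  tensor. It vanishes on \<open>a b b a\<close>: by assumption for independent vectors, and by
  skewness for dependent ones. Hence it vanishes by \<open>zero_of_sectional\<close>.\<close>

lemma Rm_constant_curvature:
  assumes K: "constant_sectional_curvature M g D \<kappa>" and x: "x \<in> points M"
    and T: "a \<in> tangent_space M x" "b \<in> tangent_space M x" "c \<in> tangent_space M x" "d \<in> tangent_space M x"
  shows "Rm x a b c d = \<kappa> * (g x b c * g x a d - g x a c * g x b d)"
proof -
  interpret R: curvature_like "tangent_space M x" "Rm x" by (rule Rm_curvature_like[OF x])
  define Q where "Q a b c d = Rm x a b c d - \<kappa> * (g x b c * g x a d - g x a c * g x b d)" for a b c d
  interpret Q: curvature_like "tangent_space M x" Q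
  proof
    show "subspace (tangent_space M x)" by (rule subspace_tangent_space)
    fix a b c d e :: "'a tvec" and r :: real
    assume T: "a \<in> tangent_space M x" "b \<in> tangent_space M x" "c \<in> tangent_space M x" "d \<in> tangent_space M x"
    show "Q a b c d = - Q b a c d" using R.skew1[OF T] by (simp add: Q_def algebra_simps)
    show "Q a b c d = - Q a b d c" using R.skew2[OF T] by (simp add: Q_def algebra_simps)
    show "Q a b c d + Q b c a d + Q c a b d = 0"
      using R.bianchi[OF T] g_sym[OF x T(1,2)] g_sym[OF x T(1,3)] g_sym[OF x T(2,3)] by (simp add: Q_def algebra_simps)
    show "Q a b c (r *\<^sub>R d) = r * Q a b c d"
      using R.scale4[OF T] T by (simp add: Q_def g_scale_right x algebra_simps)
    assume e: "e \<in> tangent_space M x"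
    show "Q a b c (d + e) = Q a b c d + Q a b c e"
      using R.add4[OF T e] T e by (simp add: Q_def g_add_right x algebra_simps)
  qed
  have "Q a b b a = 0" if T: "a \<in> tangent_space M x" "b \<in> tangent_space M x" for a b
  proof (cases "a \<noteq> b \<and> independent {a, b}")
    case True
    obtain A where A: "vector_field_near M x A" "A x = a" using extension[OF x T(1)] .
    obtain B where B: "vector_field_near M x B" "B x = b" using extension[OF x T(2)] .
    have "sectional_curvature M g D A B x = \<kappa>"
      using K x A B True unfolding constant_sectional_curvature_def by auto
    then have "Rm x a b b a / (g x a a * g x b b - (g x a b)\<^sup>2) = \<kappa>"
      using Rm_eq[OF A(1) B(1) B(1) T(1)] A B unfolding sectional_curvature_def by simp
    then show ?thesis
      using gram_pos[OF x T] True g_sym[OF x T] by (simp add: Q_def power2_eq_square field_simps)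
  next
    case False
    have "a = b \<or> b = 0 \<or> (\<exists>t. a = t *\<^sub>R b)"
      using False by (auto simp: independent_insert span_singleton)
    then show ?thesis
      using T Q.diag1[OF T(1) T(1) T(1)] Q.scale1[OF T(2) T(2) T(2) T(1)] Q.diag1[OF T(2) T(2) T(1)] Q.scale2[OF T(1) T(1) T(2) T(1), of 0]
        Q.scale3[OF T(1) T(2) T(2) T(1), of 0] Q.scale1[OF T(2) T(2) T(2)] by auto
  qed
  from Q.zero_of_sectional[OF this T] show ?thesis by (simp add: Q_def)
qed

text \<open>Every plane has a basis of a unit vector \<open>u\<close> and a vector orthogonal to it,
  and replacing a basis by it scales numerator and denominator of the sectional curvature alike. The
  hypothesis has the form in which the Killing equation at the point \<open>(x, u)\<close> of the
  unit tangent bundle supplies it.\<close>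

lemma constant_sectional_curvatureI:
  assumes K: "\<And>x u a. x \<in> points M \<Longrightarrow> u \<in> tangent_space M x \<Longrightarrow> g x u u = 1 \<Longrightarrow>
    a \<in> tangent_space M x \<Longrightarrow> g x a u = 0 \<Longrightarrow> Rm x a u u a = \<kappa> * g x a a"
  shows "constant_sectional_curvature M g D \<kappa>"
  unfolding constant_sectional_curvature_def
proof (intro ballI allI impI, elim conjE)
  fix x X Y assume x: "x \<in> points M" and X: "vector_field_near M x X" and Y: "vector_field_near M x Y"
    and ind: "X x \<noteq> Y x" "independent {X x, Y x}"
  interpret R: curvature_like "tangent_space M x" "Rm x" by (rule Rm_curvature_like[OF x])
  note T = vf_tan[OF X] vf_tan[OF Y]
  have "Y x \<noteq> 0" using ind(2) dependent_zero[of "{X x, Y x}"] by auto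
  then have b: "g x (Y x) (Y x) > 0" by (rule g_pos[OF x T(2)])
  define s where "s = sqrt (g x (Y x) (Y x))"
  have s: "s > 0" "s * s = g x (Y x) (Y x)" using b by (auto simp: s_def)
  define u where "u = (1 / s) *\<^sub>R Y x"
  have Tu: "u \<in> tangent_space M x" unfolding u_def by (rule T_scale[OF T(2)])
  have Yu: "Y x = s *\<^sub>R u" using s by (simp add: u_def)
  have u1: "g x u u = 1"
    using s b by (simp add: u_def g_scale_left g_scale_right x T T_scale)
  define t where "t = g x (X x) u"
  define a where "a = X x - t *\<^sub>R u"
  have Ta: "a \<in> tangent_space M x" unfolding a_def by (intro T_intros T Tu)
  have au: "g x a u = 0" using u1 by (simp add: a_def t_def g_diff_left g_scale_left x T Tu T_scale)
  have Xa: "X x = a + t *\<^sub>R u" by (simp add: a_def)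
  have aa: "g x (X x) (X x) = g x a a + t\<^sup>2"
    using au u1 g_sym[OF x Ta Tu] unfolding Xa
    by (simp add: g_add_left g_add_right g_scale_left g_scale_right x Ta Tu T_scale T_add power2_eq_square)
  have "Rm x (X x) u u (X x) = Rm x a u u a"
    unfolding Xa using R.diag1[OF Tu Tu Ta] R.diag1[OF Tu Tu Tu] R.diag2[OF Ta Tu Tu] Ta Tu
    by (simp add: R.add1 R.add4 R.scale1 R.scale4 T_scale T_add)
  then have "Rm x (X x) (Y x) (Y x) (X x) = s\<^sup>2 * (\<kappa> * g x a a)"
    using K[OF x Tu u1 Ta au] T Tu unfolding Yu by (simp add: R.scale2 R.scale3 T_scale power2_eq_square)
  moreover have "g x (X x) (X x) * g x (Y x) (Y x) - (g x (X x) (Y x))\<^sup>2 = s\<^sup>2 * g x a a"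
    using aa s u1 unfolding Yu t_def by (simp add: g_scale_right g_scale_left x T Tu T_scale algebra_simps power2_eq_square)
  moreover from this have "g x a a \<noteq> 0" using gram_pos[OF x T ind] by auto
  ultimately show "sectional_curvature M g D X Y x = \<kappa>"
    using s(1) Rm_eq[OF X Y Y T(1)] unfolding sectional_curvature_def by simp
qed

end

section \<open>Lifts to the tangent bundle and the unit tangent bundle\<close>

lemma smooth_on_Pair:
  fixes f :: "'x::real_normed_vector \<Rightarrow> 'b::euclidean_space" and h :: "'x \<Rightarrow> 'c::euclidean_space"
  assumes "open S" "smooth_on S f" "smooth_on S h"
  shows "smooth_on S (\<lambda>z. (f z, h z))"
  by (rule smooth_on_components) (use assms in \<open>auto simp: Basis_prod_def intro: smooth_on_inner\<close>)

lemma smooth_on_fst_compose: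
  fixes F :: "'b::euclidean_space \<Rightarrow> 'd::real_normed_vector"
  assumes "open W" "smooth_on W F"
  shows "smooth_on (W \<times> (UNIV::'c::euclidean_space set)) (\<lambda>z. F (fst z))"
  by (rule smooth_on_compose[OF assms(2) smooth_on_linear[OF bounded_linear_fst]])
    (use assms in \<open>auto intro: open_Times\<close>)

context smooth_space
begin

text \<open>Smoothness is defined for real functions only, so continuity of the vector-valued
  \<open>F\<close> is drawn from the smooth function \<open>h\<close>, its squared distance from
  \<open>F p\<close>.\<close>

lemma smooth_ev_open:
  fixes F :: "'p \<Rightarrow> 'f::euclidean_space"
  assumes p: "p \<in> points N" and T: "open T" "F p \<in> T"
    and F: "\<And>i. i \<in> Basis \<Longrightarrow> smooth_near N p (\<lambda>q. F q \<bullet> i)"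
  shows "eventually (\<lambda>q. F q \<in> T) (nhdf N p)"
proof -
  obtain r where r: "r > 0" "ball (F p) r \<subseteq> T" using T openE by blast
  define h where "h q = (\<Sum>i\<in>Basis. (F q \<bullet> i - F p \<bullet> i) * (F q \<bullet> i - F p \<bullet> i))" for q
  have h: "smooth_near N p h" unfolding h_def
    by (intro smooth_sum[OF p] smooth_mult smooth_diff F smooth_const[OF p])
  have hd: "h q = (dist (F p) (F q))\<^sup>2" for q
  proof -
    have "dist (F p) (F q) = norm (F q - F p)" by (simp add: dist_norm norm_minus_commute)
    then have "(dist (F p) (F q))\<^sup>2 = (F q - F p) \<bullet> (F q - F p)" by (simp only: power2_norm_eq_inner)
    moreover have "h q = (F q - F p) \<bullet> (F q - F p)"
      unfolding h_def by (subst euclidean_inner) (simp only: inner_diff_left)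
    ultimately show ?thesis by simp
  qed
  obtain U \<phi> where U: "(U, \<phi>) \<in> charts N" "p \<in> U" using chart_at[OF p] .
  obtain W K where W: "open W" "\<phi> p \<in> W" "smooth_on W K" and e: "eventually (\<lambda>q. h q = K (\<phi> q)) (nhdf N p)"
    using smooth_nearE[OF h U] .
  have o: "open (W \<inter> K -` {..<r\<^sup>2})"
    by (rule continuous_open_preimage[OF smooth_on_continuous[OF W(3)] W(1)]) simp
  have "K (\<phi> p) = 0" using ev_at[OF e p] hd by simp
  then have "eventually (\<lambda>q. \<phi> q \<in> W \<inter> K -` {..<r\<^sup>2}) (nhdf N p)"
    using W r(1) by (intro ev_open[OF p U o]) auto
  with e show ?thesis
  proof eventually_elim
    case (elim q)
    then have "(dist (F p) (F q))\<^sup>2 < r\<^sup>2" using hd by auto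
    then have "dist (F p) (F q) < r" using r(1) by (simp add: power_less_imp_less_base)
    then show ?case using r(2) by auto
  qed
qed

text \<open>A chain rule for maps between different spaces. The maps of interest are sections of the
  tangent bundle and the normalisation of vectors.\<close>

lemma smooth_pullback:
  assumes N': "smooth_space N'" and p: "p \<in> points N'" "s p \<in> points N"
    and V: "(V, \<psi>) \<in> charts N" "s p \<in> V"
    and e: "eventually (\<lambda>q. s q \<in> V \<and> s q \<in> points N) (nhdf N' p)"
    and c: "\<And>i. i \<in> Basis \<Longrightarrow> smooth_near N' p (\<lambda>q. \<psi> (s q) \<bullet> i)"
    and f: "smooth_near N (s p) f"
  shows "smooth_near N' p (\<lambda>q. f (s q))"
proof -
  interpret N': smooth_space N' by (rule N')
  obtain W F where W: "open W" "\<psi> (s p) \<in> W" "smooth_on W F" and F: "\<forall>q\<in>V \<inter> points N. \<psi> q \<in> W \<longrightarrow> f q = F (\<psi> q)"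
    using f unfolding smooth_near_chart[OF p(2) V] by blast
  have "eventually (\<lambda>q. \<psi> (s q) \<in> W) (nhdf N' p)"
    by (rule N'.smooth_ev_open[OF p(1) W(1), where F = "\<lambda>q. \<psi> (s q)"]) (use W c in auto)
  with e have "eventually (\<lambda>q. F (\<psi> (s q)) = f (s q)) (nhdf N' p)"
    by eventually_elim (use F in auto)
  moreover have "smooth_near N' p (\<lambda>q. F (\<psi> (s q)))"
    by (rule N'.smooth_compose[OF p(1) W(3,1), where F = "\<lambda>q. \<psi> (s q)"]) (use W c in auto)
  ultimately show ?thesis by (rule N'.smooth_near_cong[rotated])
qed

lemma smooth_inverse_sqrt:
  assumes n: "smooth_near N p n" "n p > 0"
  shows "smooth_near N p (\<lambda>q. inverse (sqrt (n q)))"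
proof -
  note p = smooth_near_points[OF n(1)]
  have "eventually (\<lambda>q. n q \<in> {0<..}) (nhdf N p)"
    by (rule smooth_ev_open[OF p]) (use n in auto)
  then have "eventually (\<lambda>q. n q powr (-1/2) = inverse (sqrt (n q))) (nhdf N p)"
    by eventually_elim (simp add: powr_minus powr_half_sqrt)
  moreover have "smooth_near N p (\<lambda>q. n q powr (-1/2))"
    by (rule smooth_compose[OF p smooth_on_powr, where F = n]) (use n in auto)
  ultimately show ?thesis by (rule smooth_near_cong[rotated])
qed

text \<open>Differentiate the identity r * r * n = 1, where r is the inverse square root of
  \<open>n\<close>, with the Leibniz rule.\<close>

lemma tan_inverse_sqrt:
  assumes n: "smooth_near N p n" "n p = 1" and v: "v \<in> tangent_space N p"
  shows "v (\<lambda>q. inverse (sqrt (n q))) = - v n / 2"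
proof -
  note p = smooth_near_points[OF n(1)]
  let ?r = "\<lambda>q. inverse (sqrt (n q))"
  have r: "smooth_near N p ?r" by (rule smooth_inverse_sqrt) (use n in auto)
  have "eventually (\<lambda>q. n q \<in> {0<..}) (nhdf N p)"
    by (rule smooth_ev_open[OF p]) (use n in auto)
  then have "eventually (\<lambda>q. ?r q * ?r q * n q = 1) (nhdf N p)"
    by eventually_elim (simp add: field_simps)
  from tan_local[OF v p this] have "v (\<lambda>q. ?r q * ?r q * n q) = 0"
    using tan_const[OF v p, of 1] by simp
  then show ?thesis
    using tan_mult[OF v smooth_mult[OF r r] n(1)] tan_mult[OF v r r] n(2) by simp
qed

end

definition bchart :: "('a \<Rightarrow> 'e::euclidean_space) \<Rightarrow> 'a \<times> 'a tvec \<Rightarrow> 'e \<times> 'e" where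
  "bchart \<phi> q = (\<phi> (fst q), \<Sum>i\<in>Basis. snd q (\<lambda>y. \<phi> y \<bullet> i) *\<^sub>R i)"

lemma bchart_fst: "bchart \<phi> q \<bullet> (i, 0) = \<phi> (fst q) \<bullet> i"
  by (simp add: bchart_def)

lemma bchart_snd: "i \<in> Basis \<Longrightarrow> bchart \<phi> q \<bullet> (0, i) = snd q (\<lambda>y. \<phi> y \<bullet> i)"
  by (simp add: bchart_def inner_sum_left inner_Basis if_distrib cong: if_cong)

lemma charts_tangent_bundle:
  "charts (tangent_bundle M) = {(Sigma U (tangent_space M), bchart \<phi>) | U \<phi>. (U, \<phi>) \<in> charts M}"
  unfolding tangent_bundle_def bchart_def by (force simp: case_prod_beta')

lemma points_tangent_bundle: "points (tangent_bundle M) = Sigma (points M) (tangent_space M)"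
  by (simp add: tangent_bundle_def)

text \<open>Treats the tangent bundle and the unit tangent bundle simultaneously: they have the same
  charts and differ in their points.\<close>

locale subbundle = riemannian M g D for M :: "('a, 'e::euclidean_space) space" and g D +
  fixes B :: "('a \<times> 'a tvec, 'e \<times> 'e) space"
  assumes charts_B: "charts B = charts (tangent_bundle M)"
    and points_B: "points B \<subseteq> points (tangent_bundle M)"
begin

lemma B_points: "(x, u) \<in> points B \<Longrightarrow> x \<in> points M" "(x, u) \<in> points B \<Longrightarrow> u \<in> tangent_space M x"
  using points_B by (auto simp: points_tangent_bundle)

lemma B_chart: "(U, \<phi>) \<in> charts M \<Longrightarrow> (Sigma U (tangent_space M), bchart \<phi>) \<in> charts B"
  by (auto simp: charts_B charts_tangent_bundle)

lemma B_chartE: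
  assumes "(U', \<Phi>) \<in> charts B"
  obtains U \<phi> where "(U, \<phi>) \<in> charts M" "U' = Sigma U (tangent_space M)" "\<Phi> = bchart \<phi>"
  using assms by (auto simp: charts_B charts_tangent_bundle)

sublocale B: smooth_space B
proof
  fix p assume p: "p \<in> points B"
  obtain x u where pxu: "p = (x, u)" by (cases p)
  have x: "x \<in> points M" "u \<in> tangent_space M x" using B_points p pxu by auto
  obtain U \<phi> where "(U, \<phi>) \<in> charts M" "x \<in> U" using chart_at[OF x(1)] .
  then show "\<exists>(U, \<phi>)\<in>charts B. p \<in> U"
    using x pxu by (intro bexI[OF _ B_chart]) auto
next
  fix U' \<Phi> V' \<Psi> p
  assume U': "(U', \<Phi>) \<in> charts B" and V': "(V', \<Psi>) \<in> charts B" and p: "p \<in> U'" "p \<in> V'" "p \<in> points B"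
  obtain U \<phi> where U: "(U, \<phi>) \<in> charts M" "U' = Sigma U (tangent_space M)" "\<Phi> = bchart \<phi>" using B_chartE[OF U'] .
  obtain V \<psi> where V: "(V, \<psi>) \<in> charts M" "V' = Sigma V (tangent_space M)" "\<Psi> = bchart \<psi>" using B_chartE[OF V'] .
  obtain x u where pxu: "p = (x, u)" by (cases p)
  have x: "x \<in> U" "x \<in> V" "x \<in> points M" "u \<in> tangent_space M x" using p pxu U V B_points by auto
  obtain W \<tau> where W: "open W" "\<phi> x \<in> W" "smooth_on W \<tau>"
    and \<tau>: "\<forall>q\<in>U \<inter> points M. \<phi> q \<in> W \<longrightarrow> q \<in> V \<and> \<psi> q = \<tau> (\<phi> q)"
    using compatible[OF U(1) V(1) x(1-3)] by blast
  \<comment> \<open>The induced coordinate change is the tangent map of \<open>\<tau>\<close>. That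
    it transforms the fibre coordinates correctly is \<open>tan_chart\<close> applied to the
    components of \<open>\<psi>\<close>.\<close>
  define T where "T z = (\<tau> (fst z), \<Sum>j\<in>Basis. (snd z \<bullet> j) *\<^sub>R frechet_derivative \<tau> (at (fst z)) j)" for z :: "'e \<times> 'e"
  have oW: "open (W \<times> (UNIV::'e set))" using W(1) by (intro open_Times) auto
  have "smooth_on (W \<times> UNIV) T" unfolding T_def
    by (intro smooth_on_Pair oW smooth_on_sum smooth_on_scaleR smooth_on_inner smooth_on_linear bounded_linear_snd
        smooth_on_fst_compose W smooth_on_derivative finite_Basis)
  moreover have "q \<in> V' \<and> \<Psi> q = T (\<Phi> q)" if q: "q \<in> U' \<inter> points B" and qW: "\<Phi> q \<in> W \<times> UNIV" for q
  proof -
    obtain y v where qyv: "q = (y, v)" by (cases q)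
    have y: "y \<in> U" "y \<in> points M" "v \<in> tangent_space M y" "\<phi> y \<in> W"
      using q qyv U qW B_points by (auto simp: bchart_def)
    have yV: "y \<in> V" "\<psi> y = \<tau> (\<phi> y)" using \<tau> y by auto
    have vi: "v (\<lambda>r. \<psi> r \<bullet> i) = (\<Sum>j\<in>Basis. v (\<lambda>r. \<phi> r \<bullet> j) * (frechet_derivative \<tau> (at (\<phi> y)) j \<bullet> i))" for i
    proof -
      have e: "eventually (\<lambda>r. \<psi> r \<bullet> i = \<tau> (\<phi> r) \<bullet> i) (nhdf M y)"
        using ev_domain[OF y(2) U(1) y(1)] ev_points[OF y(2)] ev_open[OF y(2) U(1) y(1) W(1) y(4)]
        by eventually_elim (use \<tau> in auto)
      have "((\<lambda>z. \<tau> z \<bullet> i) has_derivative (\<lambda>w. frechet_derivative \<tau> (at (\<phi> y)) w \<bullet> i)) (at (\<phi> y))"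
        by (intro has_derivative_inner_left smooth_on_has_derivative[OF W(3) y(4)])
      from frechet_derivative_at[OF this]
      show ?thesis
        using tan_chart[OF y(3,2) U(1) y(1) W(1) y(4) smooth_on_inner[OF W(3,1)] e] by metis
    qed
    have "(\<Sum>i\<in>Basis. v (\<lambda>r. \<psi> r \<bullet> i) *\<^sub>R i) =
        (\<Sum>j\<in>Basis. v (\<lambda>r. \<phi> r \<bullet> j) *\<^sub>R frechet_derivative \<tau> (at (\<phi> y)) j)"
      by (rule euclidean_eqI) (simp add: vi inner_sum_left inner_Basis if_distrib cong: if_cong)
    moreover have "(\<Sum>i\<in>Basis. v (\<lambda>r. \<phi> r \<bullet> i) *\<^sub>R i) \<bullet> j = v (\<lambda>r. \<phi> r \<bullet> j)" if "j \<in> Basis" for j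
      using that by (simp add: inner_sum_left inner_Basis if_distrib cong: if_cong)
    ultimately show ?thesis using yV y qyv V U by (simp add: bchart_def T_def)
  qed
  moreover have "\<Phi> p \<in> W \<times> UNIV" using W pxu U by (simp add: bchart_def)
  ultimately show "\<exists>W \<tau>. open W \<and> \<Phi> p \<in> W \<and> smooth_on W \<tau> \<and>
      (\<forall>q\<in>U' \<inter> points B. \<Phi> q \<in> W \<longrightarrow> q \<in> V' \<and> \<Psi> q = \<tau> (\<Phi> q))"
    using oW by (intro exI[of _ "W \<times> (UNIV::'e set)"] exI[of _ T] conjI ballI impI) simp_all
qed

lemma ev_base:
  assumes p: "(x, u) \<in> points B" and e: "eventually P (nhdf M x)"
  shows "eventually (\<lambda>q. P (fst q)) (nhdf B (x, u))"
proof -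
  note x = B_points[OF p]
  obtain U \<phi> where U: "(U, \<phi>) \<in> charts M" "x \<in> U" using chart_at[OF x(1)] .
  obtain W where W: "open W" "\<phi> x \<in> W" "\<forall>q\<in>U \<inter> points M. \<phi> q \<in> W \<longrightarrow> P q"
    using e unfolding eventually_chart[OF x(1) U] by blast
  have pU: "(x, u) \<in> Sigma U (tangent_space M)" using U x by auto
  show ?thesis unfolding B.eventually_chart[OF p B_chart[OF U(1)] pU]
  proof (intro exI conjI ballI impI)
    show "open (W \<times> (UNIV::'e set))" using W by (intro open_Times) auto
    show "bchart \<phi> (x, u) \<in> W \<times> UNIV" using W by (simp add: bchart_def)
    fix q assume "q \<in> Sigma U (tangent_space M) \<inter> points B" "bchart \<phi> q \<in> W \<times> UNIV"
    then show "P (fst q)" using W B_points by (cases q) (auto simp: bchart_def)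
  qed
qed

lemma ev_bundle:
  assumes "p \<in> points B"
  shows "eventually (\<lambda>q. q \<in> points B \<and> fst q \<in> points M \<and> snd q \<in> tangent_space M (fst q)) (nhdf B p)"
  using B.ev_points[OF assms] by eventually_elim (auto dest: B_points)

lemma smooth_base:
  assumes p: "(x, u) \<in> points B" and f: "smooth_near M x f"
  shows "smooth_near B (x, u) (\<lambda>q. f (fst q))"
proof -
  note x = B_points[OF p]
  obtain U \<phi> where U: "(U, \<phi>) \<in> charts M" "x \<in> U" using chart_at[OF x(1)] .
  obtain W F where W: "open W" "\<phi> x \<in> W" "smooth_on W F" and e: "eventually (\<lambda>q. f q = F (\<phi> q)) (nhdf M x)"
    using smooth_nearE[OF f U] .
  have pU: "(x, u) \<in> Sigma U (tangent_space M)" using U x by auto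
  show ?thesis
  proof (rule B.smooth_nearI[OF p B_chart[OF U(1)] pU])
    show "smooth_on (W \<times> (UNIV::'e set)) (\<lambda>z. F (fst z))" by (rule smooth_on_fst_compose[OF W(1,3)])
    show "eventually (\<lambda>q. f (fst q) = F (fst (bchart \<phi> q))) (nhdf B (x, u))"
      using ev_base[OF p e] by (simp add: bchart_def)
  qed (use W in \<open>auto simp: bchart_def intro: open_Times\<close>)
qed

lemma smooth_fibre_coordinate:
  assumes p: "(x, u) \<in> points B" and U: "(U, \<phi>) \<in> charts M" "x \<in> U" and i: "i \<in> Basis"
  shows "smooth_near B (x, u) (\<lambda>q. snd q (\<lambda>y. \<phi> y \<bullet> i))"
proof -
  have pU: "(x, u) \<in> Sigma U (tangent_space M)" using U B_points[OF p] by auto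
  show ?thesis using B.smooth_coordinate[OF p B_chart[OF U(1)] pU, of "(0, i)"] by (simp add: bchart_snd[OF i])
qed

lemma smooth_fibre:
  assumes p: "(x, u) \<in> points B" and h: "smooth_near M x h"
  shows "smooth_near B (x, u) (\<lambda>q. snd q h)"
proof -
  note x = B_points[OF p]
  obtain U \<phi> where U: "(U, \<phi>) \<in> charts M" "x \<in> U" using chart_at[OF x(1)] .
  obtain W F where W: "open W" "\<phi> x \<in> W" "smooth_on W F" and e: "eventually (\<lambda>q. h q = F (\<phi> q)) (nhdf M x)"
    using smooth_nearE[OF h U] .
  have "smooth_near B (x, u) (\<lambda>q. \<Sum>i\<in>Basis. snd q (\<lambda>y. \<phi> y \<bullet> i) * frechet_derivative F (at (\<phi> (fst q))) i)"
  proof (intro B.smooth_sum[OF p] B.smooth_mult smooth_fibre_coordinate[OF p U])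
    fix i
    have "smooth_near M x (\<lambda>y. frechet_derivative F (at (\<phi> y)) i)"
      by (rule smooth_nearI[OF x(1) U W(1,2) smooth_on_derivative[OF W(3), of i]]) simp
    then show "smooth_near B (x, u) (\<lambda>q. frechet_derivative F (at (\<phi> (fst q))) i)" by (rule smooth_base[OF p])
  qed
  moreover have "eventually (\<lambda>q. (\<Sum>i\<in>Basis. snd q (\<lambda>y. \<phi> y \<bullet> i) * frechet_derivative F (at (\<phi> (fst q))) i) = snd q h) (nhdf B (x, u))"
    using ev_bundle[OF p] ev_base[OF p ev_domain[OF x(1) U]] ev_base[OF p ev_open[OF x(1) U W(1,2)]]
      ev_base[OF p ev_ev[OF e x(1)]]
  proof eventually_elim
    case (elim q)
    show ?case by (rule tan_chart[OF _ _ U(1) elim(2) W(1) elim(3) W(3) elim(4), symmetric]) (use elim(1) in auto)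
  qed
  ultimately show ?thesis by (rule B.smooth_near_cong)
qed

definition lf :: "('a \<Rightarrow> 'a tvec) \<Rightarrow> 'a \<times> 'a tvec \<Rightarrow> real" where
  "lf Z q = g (fst q) (Z (fst q)) (snd q)"

definition nf :: "'a \<times> 'a tvec \<Rightarrow> real" where
  "nf q = g (fst q) (snd q) (snd q)"

lemma smooth_lf:
  assumes p: "(x, u) \<in> points B" and Z: "vector_field_near M x Z"
  shows "smooth_near B (x, u) (lf Z)"
proof -
  note x = B_points[OF p]
  obtain U \<phi> where U: "(U, \<phi>) \<in> charts M" "x \<in> U" using chart_at[OF x(1)] .
  have "smooth_near B (x, u) (\<lambda>q. \<Sum>i\<in>Basis. snd q (\<lambda>y. \<phi> y \<bullet> i) * g (fst q) (Z (fst q)) (cfield U \<phi> i (fst q)))"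
    by (intro B.smooth_sum[OF p] B.smooth_mult smooth_fibre_coordinate[OF p U] smooth_base[OF p g_smooth[OF Z cfield_vf[OF U]]])
  moreover have "eventually (\<lambda>q. (\<Sum>i\<in>Basis. snd q (\<lambda>y. \<phi> y \<bullet> i) * g (fst q) (Z (fst q)) (cfield U \<phi> i (fst q))) = lf Z q) (nhdf B (x, u))"
    using ev_bundle[OF p] ev_base[OF p ev_domain[OF x(1) U]] ev_base[OF p vf_ev[OF Z]]
  proof eventually_elim
    case (elim q)
    have q: "fst q \<in> points M" "snd q \<in> tangent_space M (fst q)" using elim(1) by auto
    have "lf Z q = g (fst q) (Z (fst q)) (\<Sum>i\<in>Basis. snd q (\<lambda>y. \<phi> y \<bullet> i) *\<^sub>R cfield U \<phi> i (fst q))"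
      unfolding lf_def using tan_expand[OF U(1) elim(2) q(2)] by simp
    also have "\<dots> = (\<Sum>i\<in>Basis. g (fst q) (Z (fst q)) (snd q (\<lambda>y. \<phi> y \<bullet> i) *\<^sub>R cfield U \<phi> i (fst q)))"
      by (rule g_sum_right[OF q(1) elim(3) T_scale[OF cfield_tan[OF U(1) elim(2)]]])
    finally show ?case
      by (simp add: g_scale_right[OF q(1) elim(3) cfield_tan[OF U(1) elim(2)]])
  qed
  ultimately show ?thesis by (rule B.smooth_near_cong)
qed

lemma nf_expand:
  assumes p: "(x, u) \<in> points B" and U: "(U, \<phi>) \<in> charts M" "x \<in> U"
  shows "eventually (\<lambda>q. (\<Sum>i\<in>Basis. snd q (\<lambda>y. \<phi> y \<bullet> i) * lf (cfield U \<phi> i) q) = nf q) (nhdf B (x, u))"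
  using ev_bundle[OF p] ev_base[OF p ev_domain[OF B_points(1)[OF p] U]]
proof eventually_elim
  case (elim q)
  have q: "fst q \<in> points M" "snd q \<in> tangent_space M (fst q)" using elim(1) by auto
  have "nf q = g (fst q) (\<Sum>i\<in>Basis. snd q (\<lambda>y. \<phi> y \<bullet> i) *\<^sub>R cfield U \<phi> i (fst q)) (snd q)"
    unfolding nf_def using tan_expand[OF U(1) elim(2) q(2)] by simp
  also have "\<dots> = (\<Sum>i\<in>Basis. g (fst q) (snd q (\<lambda>y. \<phi> y \<bullet> i) *\<^sub>R cfield U \<phi> i (fst q)) (snd q))"
    by (rule g_sum_left[OF q T_scale[OF cfield_tan[OF U(1) elim(2)]]])
  finally show ?case
    by (simp add: g_scale_left[OF q cfield_tan[OF U(1) elim(2)]] lf_def)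
qed

lemma smooth_nf:
  assumes p: "(x, u) \<in> points B" shows "smooth_near B (x, u) nf"
proof -
  obtain U \<phi> where U: "(U, \<phi>) \<in> charts M" "x \<in> U" using chart_at[OF B_points(1)[OF p]] .
  have "smooth_near B (x, u) (\<lambda>q. \<Sum>i\<in>Basis. snd q (\<lambda>y. \<phi> y \<bullet> i) * lf (cfield U \<phi> i) q)"
    by (intro B.smooth_sum[OF p] B.smooth_mult smooth_fibre_coordinate[OF p U] smooth_lf[OF p cfield_vf[OF U]])
  then show ?thesis using nf_expand[OF p U] by (rule B.smooth_near_cong)
qed

lemma bundle_pullback:
  assumes N': "smooth_space N'" and p: "p \<in> points N'" "s p = (x, u)" "(x, u) \<in> points B"
    and U: "(U, \<phi>) \<in> charts M" "x \<in> U"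
    and e: "eventually (\<lambda>q. s q \<in> points B \<and> fst (s q) \<in> U) (nhdf N' p)"
    and c: "\<And>i. i \<in> Basis \<Longrightarrow> smooth_near N' p (\<lambda>q. \<phi> (fst (s q)) \<bullet> i)"
      "\<And>i. i \<in> Basis \<Longrightarrow> smooth_near N' p (\<lambda>q. snd (s q) (\<lambda>y. \<phi> y \<bullet> i))"
    and f: "smooth_near B (x, u) f"
  shows "smooth_near N' p (\<lambda>q. f (s q))"
proof (rule B.smooth_pullback[where s = s, OF N' p(1) _ B_chart[OF U(1)]])
  show "s p \<in> points B" using p by simp
  show "s p \<in> Sigma U (tangent_space M)" using p U B_points[OF p(3)] by simp
  show "smooth_near B (s p) f" using f p by simp
  show "eventually (\<lambda>q. s q \<in> Sigma U (tangent_space M) \<and> s q \<in> points B) (nhdf N' p)"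
    using e by eventually_elim (metis B_points(2) mem_Sigma_iff prod.collapse)
  fix i :: "'e \<times> 'e" assume "i \<in> Basis"
  then consider j where "j \<in> Basis" "i = (j, 0)" | j where "j \<in> Basis" "i = (0, j)" by (auto simp: Basis_prod_def)
  then show "smooth_near N' p (\<lambda>q. bchart \<phi> (s q) \<bullet> i)"
    by cases (simp_all add: c bchart_fst bchart_snd)
qed

lemma bundle_tan_eqI:
  assumes v: "v \<in> tangent_space B (x, u)" and w: "w \<in> tangent_space B (x, u)" and p: "(x, u) \<in> points B"
    and U: "(U, \<phi>) \<in> charts M" "x \<in> U"
    and b: "\<And>i. i \<in> Basis \<Longrightarrow> v (\<lambda>q. \<phi> (fst q) \<bullet> i) = w (\<lambda>q. \<phi> (fst q) \<bullet> i)"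
    and f: "\<And>i. i \<in> Basis \<Longrightarrow> v (\<lambda>q. snd q (\<lambda>y. \<phi> y \<bullet> i)) = w (\<lambda>q. snd q (\<lambda>y. \<phi> y \<bullet> i))"
  shows "v = w"
proof (rule B.tan_eqI[OF v w p B_chart[OF U(1)]])
  show "(x, u) \<in> Sigma U (tangent_space M)" using U B_points[OF p] by auto
  fix i :: "'e \<times> 'e" assume "i \<in> Basis"
  then consider j where "j \<in> Basis" "i = (j, 0)" | j where "j \<in> Basis" "i = (0, j)" by (auto simp: Basis_prod_def)
  then show "v (\<lambda>q. bchart \<phi> q \<bullet> i) = w (\<lambda>q. bchart \<phi> q \<bullet> i)"
    by cases (simp_all add: b f bchart_fst bchart_snd)
qed

text \<open>A vector that kills all functions from the base is vertical. In the expansion of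
  \<open>lf\<close> in fibre coordinates it differentiates only these, so its fibre components, read
  as a vector of \<open>M\<close>, represent its values on \<open>lf\<close> through the
  metric.\<close>

lemma vertical_lf:
  assumes z: "z \<in> tangent_space B (x, u)" and p: "(x, u) \<in> points B"
    and U: "(U, \<phi>) \<in> charts M" "x \<in> U"
    and zb: "\<And>f. smooth_near M x f \<Longrightarrow> z (\<lambda>q. f (fst q)) = 0"
  shows "z (lf (cfield U \<phi> i)) =
    g x (cfield U \<phi> i x) (\<Sum>j\<in>Basis. z (\<lambda>q. snd q (\<lambda>y. \<phi> y \<bullet> j)) *\<^sub>R cfield U \<phi> j x)"
proof -
  note x = B_points[OF p]
  note cx = cfield_tan[OF U]
  let ?f = "\<lambda>j q. snd q (\<lambda>y. \<phi> y \<bullet> j)" and ?g = "\<lambda>j q. g (fst q) (cfield U \<phi> i (fst q)) (cfield U \<phi> j (fst q))"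
  have s: "smooth_near B (x, u) (?g j)" for j by (rule smooth_base[OF p g_smooth[OF cfield_vf[OF U] cfield_vf[OF U]]])
  have zg: "z (?g j) = 0" for j by (rule zb[OF g_smooth[OF cfield_vf[OF U] cfield_vf[OF U]]])
  have "eventually (\<lambda>q. lf (cfield U \<phi> i) q = (\<Sum>j\<in>Basis. ?f j q * ?g j q)) (nhdf B (x, u))"
    using ev_bundle[OF p] ev_base[OF p ev_domain[OF x(1) U]]
  proof eventually_elim
    case (elim q)
    have q: "fst q \<in> points M" "snd q \<in> tangent_space M (fst q)" using elim(1) by auto
    note cq = cfield_tan[OF U(1) elim(2)]
    have "lf (cfield U \<phi> i) q = g (fst q) (cfield U \<phi> i (fst q)) (\<Sum>j\<in>Basis. ?f j q *\<^sub>R cfield U \<phi> j (fst q))"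
      unfolding lf_def using tan_expand[OF U(1) elim(2) q(2)] by simp
    also have "\<dots> = (\<Sum>j\<in>Basis. g (fst q) (cfield U \<phi> i (fst q)) (?f j q *\<^sub>R cfield U \<phi> j (fst q)))"
      by (rule g_sum_right[OF q(1) cq T_scale[OF cq]])
    finally show ?case by (simp add: g_scale_right[OF q(1) cq cq])
  qed
  then have "z (lf (cfield U \<phi> i)) = z (\<lambda>q. \<Sum>j\<in>Basis. ?f j q * ?g j q)" by (rule B.tan_local[OF z p])
  also have "\<dots> = (\<Sum>j\<in>Basis. z (\<lambda>q. ?f j q * ?g j q))"
    by (rule B.tan_sum[OF z p B.smooth_mult[OF smooth_fibre_coordinate[OF p U] s]])
  also have "\<dots> = (\<Sum>j\<in>Basis. g x (cfield U \<phi> i x) (z (?f j) *\<^sub>R cfield U \<phi> j x))"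
  proof (rule sum.cong[OF refl])
    fix j :: 'e assume j: "j \<in> Basis"
    show "z (\<lambda>q. ?f j q * ?g j q) = g x (cfield U \<phi> i x) (z (?f j) *\<^sub>R cfield U \<phi> j x)"
      using B.tan_mult[OF z smooth_fibre_coordinate[OF p U j] s[of j]] zg[of j] g_scale_right[OF x(1) cx cx] by simp
  qed
  also have "\<dots> = g x (cfield U \<phi> i x) (\<Sum>j\<in>Basis. z (?f j) *\<^sub>R cfield U \<phi> j x)"
    by (rule g_sum_right[OF x(1) cx T_scale[OF cx], symmetric])
  finally show ?thesis .
qed

lemma cfield_sum_coordinate:
  assumes U: "(U, \<phi>) \<in> charts M" "x \<in> U" and j: "j \<in> Basis"
  shows "(\<Sum>i\<in>Basis. c i *\<^sub>R cfield U \<phi> i x) (\<lambda>r. \<phi> r \<bullet> j) = c j"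
proof -
  have "(\<Sum>i\<in>Basis. c i *\<^sub>R cfield U \<phi> i x) (\<lambda>r. \<phi> r \<bullet> j) = (\<Sum>i\<in>Basis. if i = j then c j else 0)"
    unfolding sum_fun_apply by (intro sum.cong refl) (auto simp: cfield_coordinate[OF U] inner_Basis j)
  then show ?thesis by (simp add: j)
qed

text \<open>The functions \<open>lf Z\<close> take over the role of the fibre coordinates because the Gram matrix of the
  coordinate fields is nondegenerate.\<close>

lemma bundle_tan_eqI_lf:
  assumes v: "v \<in> tangent_space B (x, u)" and w: "w \<in> tangent_space B (x, u)" and p: "(x, u) \<in> points B"
    and b: "\<And>f. smooth_near M x f \<Longrightarrow> v (\<lambda>q. f (fst q)) = w (\<lambda>q. f (fst q))"
    and f: "\<And>Z. vector_field_near M x Z \<Longrightarrow> v (lf Z) = w (lf Z)"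
  shows "v = w"
proof -
  note x = B_points[OF p]
  obtain U \<phi> where U: "(U, \<phi>) \<in> charts M" "x \<in> U" using chart_at[OF x(1)] .
  note cx = cfield_tan[OF U]
  define z where "z = v - w"
  have z: "z \<in> tangent_space B (x, u)" unfolding z_def by (rule subspace_diff[OF subspace_tangent_space v w])
  have zb: "z (\<lambda>q. f (fst q)) = 0" if "smooth_near M x f" for f using b[OF that] by (simp add: z_def)
  have zf: "z (lf Z) = 0" if "vector_field_near M x Z" for Z using f[OF that] by (simp add: z_def)
  define Y where "Y = (\<Sum>j\<in>Basis. z (\<lambda>q. snd q (\<lambda>y. \<phi> y \<bullet> j)) *\<^sub>R cfield U \<phi> j x)"
  have Y: "Y \<in> tangent_space M x" unfolding Y_def by (intro T_sum T_scale cx)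
  have gY: "g x (cfield U \<phi> i x) Y = 0" for i
    using vertical_lf[OF z p U zb, of i] zf[OF cfield_vf[OF U]] by (simp add: Y_def)
  have "g x Y w = 0" if w: "w \<in> tangent_space M x" for w
  proof -
    have "g x w Y = g x (\<Sum>i\<in>Basis. w (\<lambda>r. \<phi> r \<bullet> i) *\<^sub>R cfield U \<phi> i x) Y" using tan_expand[OF U w] by simp
    also have "\<dots> = (\<Sum>i\<in>Basis. g x (w (\<lambda>r. \<phi> r \<bullet> i) *\<^sub>R cfield U \<phi> i x) Y)" by (rule g_sum_left[OF x(1) Y T_scale[OF cx]])
    also have "\<dots> = 0" by (simp add: g_scale_left[OF x(1) Y cx] gY)
    finally show ?thesis using g_sym[OF x(1) w Y] by simp
  qed
  then have Y0: "Y = 0" using g_eqI[OF x(1) Y T_zero] g_zero_left[OF x(1)] by simp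
  have zc: "z (\<lambda>q. snd q (\<lambda>y. \<phi> y \<bullet> j)) = 0" if j: "j \<in> Basis" for j
    using cfield_sum_coordinate[OF U j, of "\<lambda>j. z (\<lambda>q. snd q (\<lambda>y. \<phi> y \<bullet> j))"] Y0 by (simp add: Y_def)
  show ?thesis
    by (rule bundle_tan_eqI[OF v w p U])
      (use zc zb[OF smooth_coordinate[OF x(1) U]] in \<open>auto simp: z_def\<close>)
qed

end

section \<open>Horizontal and vertical lifts to the tangent bundle\<close>

context riemannian
begin

sublocale TM: subbundle M g D "tangent_bundle M"
  by unfold_locales auto

sublocale UT: subbundle M g D "unit_tangent_bundle M g"
  by unfold_locales (auto simp: unit_tangent_bundle_def)

lemma UT_points: "(x, u) \<in> points (unit_tangent_bundle M g) \<longleftrightarrow>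
    x \<in> points M \<and> u \<in> tangent_space M x \<and> g x u u = 1"
  by (auto simp: unit_tangent_bundle_def points_tangent_bundle)

lemma UT_TM: "p \<in> points (unit_tangent_bundle M g) \<Longrightarrow> p \<in> points (tangent_bundle M)"
  by (auto simp: unit_tangent_bundle_def)

text \<open>Literally the term chosen inside \<open>horizontal_lift\<close>, so that the lift
  unfolds to differentiation along \<open>par x u\<close>.\<close>

definition par :: "'a \<Rightarrow> 'a tvec \<Rightarrow> 'a \<Rightarrow> 'a tvec" where
  "par x u = (SOME Z. vector_field_near M x Z \<and> Z x = u \<and> (\<forall>v\<in>tangent_space M x. D x v Z = 0))"

lemma par:
  assumes "x \<in> points M" "u \<in> tangent_space M x"
  shows "vector_field_near M x (par x u)" "par x u x = u" "v \<in> tangent_space M x \<Longrightarrow> D x v (par x u) = 0"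
  using someI_ex[OF parallel_extension[OF assms]] unfolding par_def by auto

lemma horizontal_lift_apply:
  "horizontal_lift M D (x, u) X F =
     (if smooth_near (tangent_bundle M) (x, u) F then X (\<lambda>y. F (y, par x u y)) else 0)"
  by (simp add: horizontal_lift_def Let_def par_def)

lemma smooth_section:
  assumes Z: "vector_field_near M x Z" and F: "smooth_near (tangent_bundle M) (x, Z x) F"
  shows "smooth_near M x (\<lambda>y. F (y, Z y))"
proof -
  note x = vf_points[OF Z]
  obtain U \<phi> where U: "(U, \<phi>) \<in> charts M" "x \<in> U" using chart_at[OF x] .
  note c = smooth_coordinate[OF x U]
  show ?thesis
  proof (rule TM.bundle_pullback[where s = "\<lambda>y. (y, Z y)" and N' = M, OF _ x refl _ U _ _ _ F])
    show "smooth_space M" by (rule smooth_space_axioms)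
    show "(x, Z x) \<in> points (tangent_bundle M)" using x vf_tan[OF Z] by (simp add: points_tangent_bundle)
    show "eventually (\<lambda>q. (q, Z q) \<in> points (tangent_bundle M) \<and> fst (q, Z q) \<in> U) (nhdf M x)"
      using vf_ev[OF Z] ev_points[OF x] ev_domain[OF x U] by eventually_elim (simp add: points_tangent_bundle)
  next
    fix i
    show "smooth_near M x (\<lambda>q. \<phi> (fst (q, Z q)) \<bullet> i)" using c by simp
    show "smooth_near M x (\<lambda>q. snd (q, Z q) (\<lambda>y. \<phi> y \<bullet> i))" using vf_smooth[OF Z c] by simp
  qed
qed

lemma hl_tan:
  assumes p: "(x, u) \<in> points (tangent_bundle M)" and X: "X \<in> tangent_space M x"
  shows "horizontal_lift M D (x, u) X \<in> tangent_space (tangent_bundle M) (x, u)"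
proof -
  note x = TM.B_points[OF p]
  note Z = par[OF x]
  have s: "smooth_near M x (\<lambda>y. F (y, par x u y))" if "smooth_near (tangent_bundle M) (x, u) F" for F
    using smooth_section[OF Z(1)] that Z(2) by simp
  let ?H = "horizontal_lift M D (x, u) X"
  have "?H (\<lambda>q. f q + h q) = ?H f + ?H h"
    if f: "smooth_near (tangent_bundle M) (x, u) f" and h: "smooth_near (tangent_bundle M) (x, u) h" for f h
    using tan_add[OF X s[OF f] s[OF h]] TM.B.smooth_add[OF f h] f h by (simp add: horizontal_lift_apply)
  moreover have "?H (\<lambda>q. r * f q) = r * ?H f"
    if f: "smooth_near (tangent_bundle M) (x, u) f" for f r
    using tan_cmult[OF X s[OF f]] TM.B.smooth_cmult[OF f] f by (simp add: horizontal_lift_apply)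
  moreover have "?H (\<lambda>q. f q * h q) = f (x, u) * ?H h + h (x, u) * ?H f"
    if f: "smooth_near (tangent_bundle M) (x, u) f" and h: "smooth_near (tangent_bundle M) (x, u) h" for f h
    using tan_mult[OF X s[OF f] s[OF h]] TM.B.smooth_mult[OF f h] f h Z(2) by (simp add: horizontal_lift_apply)
  ultimately show ?thesis
    unfolding tangent_space_def linear_on_def plus_fun_def scaleR_fun_def by (simp add: horizontal_lift_apply)
qed

text \<open>The section \<open>par x u\<close> is parallel at \<open>x\<close>, so in
  \<open>D_metric\<close> the terms that differentiate it drop out. In particular the squared norm
  has derivative 0: horizontal lifts are tangent to the unit tangent bundle.\<close>

lemma hl_values:
  assumes p: "(x, u) \<in> points (tangent_bundle M)" and X: "X \<in> tangent_space M x"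
  shows hl_base: "smooth_near M x f \<Longrightarrow> horizontal_lift M D (x, u) X (\<lambda>q. f (fst q)) = X f"
    and hl_lf: "vector_field_near M x Z \<Longrightarrow> horizontal_lift M D (x, u) X (TM.lf Z) = g x (D x X Z) u"
    and hl_nf: "horizontal_lift M D (x, u) X TM.nf = 0"
proof -
  note x = TM.B_points[OF p]
  note P = par[OF x]
  show "horizontal_lift M D (x, u) X (\<lambda>q. f (fst q)) = X f" if "smooth_near M x f"
    using TM.smooth_base[OF p that] by (simp add: horizontal_lift_apply)
  show "horizontal_lift M D (x, u) X (TM.lf Z) = g x (D x X Z) u" if Z: "vector_field_near M x Z"
    using TM.smooth_lf[OF p Z] D_metric[OF Z P(1) X] P(2,3) X g_zero_right[OF x(1) vf_tan[OF Z]]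
    by (simp add: horizontal_lift_apply TM.lf_def)
  show "horizontal_lift M D (x, u) X TM.nf = 0"
    using TM.smooth_nf[OF p] D_metric[OF P(1) P(1) X] P(2,3) X g_zero_right[OF x] g_zero_left[OF x]
    by (simp add: horizontal_lift_apply TM.nf_def)
qed

text \<open>The classical expression by Christoffel symbols, obtained by writing the condition that
  \<open>par x u\<close> is parallel at \<open>x\<close> in the coordinate frame.\<close>

lemma hl_fibre:
  assumes p: "(x, u) \<in> points (tangent_bundle M)" and X: "X \<in> tangent_space M x"
    and U: "(U, \<phi>) \<in> charts M" "x \<in> U" and i: "i \<in> Basis"
  shows "horizontal_lift M D (x, u) X (\<lambda>q. snd q (\<lambda>y. \<phi> y \<bullet> i)) =
     - (\<Sum>j\<in>Basis. u (\<lambda>y. \<phi> y \<bullet> j) * D x X (cfield U \<phi> j) (\<lambda>y. \<phi> y \<bullet> i))"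
proof -
  note x = TM.B_points[OF p]
  note P = par[OF x]
  define c where "c j y = par x u y (\<lambda>y. \<phi> y \<bullet> j)" for j y
  have c: "smooth_near M x (c j)" for j
    unfolding c_def by (rule vf_smooth[OF P(1) smooth_coordinate[OF x(1) U]])
  note cv = cfield_vf[OF U]
  have "eventually (\<lambda>y. par x u y = (\<Sum>j\<in>Basis. c j y *\<^sub>R cfield U \<phi> j y)) (nhdf M x)"
    using vf_ev[OF P(1)] ev_domain[OF x(1) U]
    by eventually_elim (unfold c_def, rule tan_expand[OF U(1)])
  from D_local[OF P(1) X this] have "0 = D x X (\<lambda>y. \<Sum>j\<in>Basis. c j y *\<^sub>R cfield U \<phi> j y)" using P(3)[OF X] by simp
  also have "\<dots> = (\<Sum>j\<in>Basis. D x X (\<lambda>y. c j y *\<^sub>R cfield U \<phi> j y))"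
    by (rule D_sum[OF x(1) X vf_scale[OF cv c]])
  also have "\<dots> = (\<Sum>j\<in>Basis. c j x *\<^sub>R D x X (cfield U \<phi> j)) + (\<Sum>j\<in>Basis. X (c j) *\<^sub>R cfield U \<phi> j x)"
    unfolding D_leibniz[OF cv X c] sum.distrib ..
  finally have "0 = ((\<Sum>j\<in>Basis. c j x *\<^sub>R D x X (cfield U \<phi> j)) + (\<Sum>j\<in>Basis. X (c j) *\<^sub>R cfield U \<phi> j x)) (\<lambda>y. \<phi> y \<bullet> i)"
    by (metis zero_fun_apply)
  also have "\<dots> = (\<Sum>j\<in>Basis. c j x * D x X (cfield U \<phi> j) (\<lambda>y. \<phi> y \<bullet> i)) + X (c i)"
    unfolding plus_fun_apply TM.cfield_sum_coordinate[OF U i] by (simp add: sum_fun_apply)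
  finally have "X (c i) = - (\<Sum>j\<in>Basis. c j x * D x X (cfield U \<phi> j) (\<lambda>y. \<phi> y \<bullet> i))" by simp
  then show ?thesis
    using TM.smooth_fibre_coordinate[OF p U i] P(2) by (simp add: horizontal_lift_apply c_def[abs_def])
qed

text \<open>In a bundle chart the curve u + t Y is a straight line, so \<open>F\<close> is
  differentiable along it. Without this, the \<open>deriv\<close> in the definition of
  \<open>vertical_lift\<close> would carry no information.\<close>

lemma vertical_curve:
  assumes p: "(x, u) \<in> points (tangent_bundle M)" and Y: "Y \<in> tangent_space M x"
    and F: "smooth_near (tangent_bundle M) (x, u) F"
  shows "((\<lambda>t. F (x, u + t *\<^sub>R Y)) has_real_derivative vertical_lift M (x, u) Y F) (at 0)"
proof -
  note x = TM.B_points[OF p]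
  obtain U \<phi> where U: "(U, \<phi>) \<in> charts M" "x \<in> U" using chart_at[OF x(1)] .
  have pU: "(x, u) \<in> Sigma U (tangent_space M)" using U x by auto
  obtain W K where W: "open W" "bchart \<phi> (x, u) \<in> W" "smooth_on W K"
    and K: "\<forall>q\<in>Sigma U (tangent_space M) \<inter> points (tangent_bundle M). bchart \<phi> q \<in> W \<longrightarrow> F q = K (bchart \<phi> q)"
    using F unfolding TM.B.smooth_near_chart[OF p TM.B_chart[OF U(1)] pU] by blast
  define Y' where "Y' = (\<Sum>i\<in>Basis. Y (\<lambda>y. \<phi> y \<bullet> i) *\<^sub>R i)"
  have bc: "bchart \<phi> (x, u + t *\<^sub>R Y) = bchart \<phi> (x, u) + t *\<^sub>R (0, Y')" for t
    by (simp add: bchart_def Y'_def scaleR_add_left sum.distrib scaleR_sum_right)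
  have q: "(x, u + t *\<^sub>R Y) \<in> Sigma U (tangent_space M) \<inter> points (tangent_bundle M)" for t
    using x U Y by (auto simp: points_tangent_bundle intro!: T_add T_scale)
  have l: "((\<lambda>t. bchart \<phi> (x, u + t *\<^sub>R Y)) has_derivative (\<lambda>s. s *\<^sub>R (0, Y'))) (at 0)"
    unfolding bc by (rule derivative_eq_intros refl | simp)+
  have "(K has_derivative frechet_derivative K (at (bchart \<phi> (x, u)))) (at (bchart \<phi> (x, u + 0 *\<^sub>R Y)))"
    using smooth_on_has_derivative[OF W(3,2)] by simp
  from has_derivative_compose[OF l this]
  have dK: "((\<lambda>t. K (bchart \<phi> (x, u + t *\<^sub>R Y))) has_derivative (\<lambda>s. frechet_derivative K (at (bchart \<phi> (x, u))) (s *\<^sub>R (0, Y')))) (at 0)" .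
  have "open ((\<lambda>t::real. bchart \<phi> (x, u + t *\<^sub>R Y)) -` W)"
    unfolding bc by (intro open_vimage W continuous_intros)
  then have "((\<lambda>t. F (x, u + t *\<^sub>R Y)) has_derivative (\<lambda>s. frechet_derivative K (at (bchart \<phi> (x, u))) (s *\<^sub>R (0, Y')))) (at 0)"
    by (rule has_derivative_transform_within_open[OF dK]) (use W K q in auto)
  then have "(\<lambda>t. F (x, u + t *\<^sub>R Y)) field_differentiable at 0"
    unfolding field_differentiable_def using has_derivative_imp_has_field_derivative
    by (metis DERIV_deriv_iff_real_differentiable differentiableI)
  then show ?thesis using F by (simp add: vertical_lift_def DERIV_deriv_iff_field_differentiable)
qed

lemma vl_tan:
  assumes p: "(x, u) \<in> points (tangent_bundle M)" and Y: "Y \<in> tangent_space M x"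
  shows "vertical_lift M (x, u) Y \<in> tangent_space (tangent_bundle M) (x, u)"
proof -
  note c = vertical_curve[OF p Y]
  let ?V = "vertical_lift M (x, u) Y"
  have "?V (\<lambda>q. f q + h q) = ?V f + ?V h"
    if f: "smooth_near (tangent_bundle M) (x, u) f" and h: "smooth_near (tangent_bundle M) (x, u) h" for f h
    by (rule DERIV_unique[OF c[OF TM.B.smooth_add[OF f h]] DERIV_add[OF c[OF f] c[OF h]]])
  moreover have "?V (\<lambda>q. r * f q) = r * ?V f"
    if f: "smooth_near (tangent_bundle M) (x, u) f" for f r
    by (rule DERIV_unique[OF c[OF TM.B.smooth_cmult[OF f]] DERIV_cmult[OF c[OF f]]])
  moreover have "?V (\<lambda>q. f q * h q) = f (x, u) * ?V h + h (x, u) * ?V f"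
    if f: "smooth_near (tangent_bundle M) (x, u) f" and h: "smooth_near (tangent_bundle M) (x, u) h" for f h
    using DERIV_unique[OF c[OF TM.B.smooth_mult[OF f h]] DERIV_mult[OF c[OF f] c[OF h]]] by simp
  ultimately show ?thesis
    unfolding tangent_space_def linear_on_def plus_fun_def scaleR_fun_def by (simp add: vertical_lift_def)
qed

lemma vl_values:
  assumes p: "(x, u) \<in> points (tangent_bundle M)" and Y: "Y \<in> tangent_space M x"
  shows vl_base: "smooth_near M x f \<Longrightarrow> vertical_lift M (x, u) Y (\<lambda>q. f (fst q)) = 0"
    and vl_lf: "vector_field_near M x Z \<Longrightarrow> vertical_lift M (x, u) Y (TM.lf Z) = g x (Z x) Y"
    and vl_nf: "vertical_lift M (x, u) Y TM.nf = 2 * g x u Y"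
    and vl_fibre: "smooth_near M x h \<Longrightarrow> vertical_lift M (x, u) Y (\<lambda>q. snd q h) = Y h"
proof -
  note x = TM.B_points[OF p]
  note c = vertical_curve[OF p Y]
  show "vertical_lift M (x, u) Y (\<lambda>q. f (fst q)) = 0" if f: "smooth_near M x f"
    using DERIV_unique[OF c[OF TM.smooth_base[OF p f]]] by simp
  show "vertical_lift M (x, u) Y (TM.lf Z) = g x (Z x) Y" if Z: "vector_field_near M x Z"
  proof (rule DERIV_unique[OF c[OF TM.smooth_lf[OF p Z]]])
    show "((\<lambda>t. TM.lf Z (x, u + t *\<^sub>R Y)) has_real_derivative g x (Z x) Y) (at 0)"
      using vf_tan[OF Z] x Y
      by (auto simp: TM.lf_def g_add_right g_scale_right T_scale intro!: derivative_eq_intros)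
  qed
  show "vertical_lift M (x, u) Y TM.nf = 2 * g x u Y"
  proof (rule DERIV_unique[OF c[OF TM.smooth_nf[OF p]]])
    show "((\<lambda>t. TM.nf (x, u + t *\<^sub>R Y)) has_real_derivative 2 * g x u Y) (at 0)"
      using x Y g_sym[OF x(1) Y x(2)]
      by (auto simp: TM.nf_def g_add_right g_scale_right g_add_left g_scale_left T_scale T_add intro!: derivative_eq_intros)
  qed
  show "vertical_lift M (x, u) Y (\<lambda>q. snd q h) = Y h" if h: "smooth_near M x h"
  proof (rule DERIV_unique[OF c[OF TM.smooth_fibre[OF p h]]])
    show "((\<lambda>t. snd (x, u + t *\<^sub>R Y) h) has_real_derivative Y h) (at 0)"
      by (auto intro!: derivative_eq_intros)
  qed
qed

text \<open>The radial retraction onto unit vectors. \<open>to_unit\<close> is composition with it,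
  and its derivative reduces to that of the squared norm.\<close>

definition nrm :: "'a \<times> 'a tvec \<Rightarrow> 'a \<times> 'a tvec" where
  "nrm q = (fst q, inverse (sqrt (TM.nf q)) *\<^sub>R snd q)"

lemma to_unit_apply:
  "to_unit M g p W f = (if smooth_near (unit_tangent_bundle M g) p f then W (\<lambda>q. f (nrm q)) else 0)"
  by (simp add: to_unit_def case_prod_beta' nrm_def TM.nf_def)

lemma ev_nf_pos:
  assumes p: "(x, u) \<in> points (unit_tangent_bundle M g)"
  shows "eventually (\<lambda>q. TM.nf q > 0) (nhdf (tangent_bundle M) (x, u))"
proof -
  have "eventually (\<lambda>q. TM.nf q \<in> {0<..}) (nhdf (tangent_bundle M) (x, u))"
    by (rule TM.B.smooth_ev_open[OF UT_TM[OF p]])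
      (use p TM.smooth_nf[OF UT_TM[OF p]] in \<open>auto simp: TM.nf_def[of "(x, u)"] UT_points\<close>)
  then show ?thesis by simp
qed

lemma smooth_nrm:
  assumes p: "(x, u) \<in> points (unit_tangent_bundle M g)" and f: "smooth_near (unit_tangent_bundle M g) (x, u) f"
  shows "smooth_near (tangent_bundle M) (x, u) (\<lambda>q. f (nrm q))"
proof -
  note pT = UT_TM[OF p]
  have x: "x \<in> points M" "u \<in> tangent_space M x" "g x u u = 1" using p by (auto simp: UT_points)
  obtain U \<phi> where U: "(U, \<phi>) \<in> charts M" "x \<in> U" using chart_at[OF x(1)] .
  show ?thesis
  proof (rule UT.bundle_pullback[where s = nrm and N' = "tangent_bundle M", OF _ pT _ p U _ _ _ f])
    show "smooth_space (tangent_bundle M)" by (rule TM.B.smooth_space_axioms)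
    show "nrm (x, u) = (x, u)" using x by (simp add: nrm_def TM.nf_def)
    show "eventually (\<lambda>q. nrm q \<in> points (unit_tangent_bundle M g) \<and> fst (nrm q) \<in> U) (nhdf (tangent_bundle M) (x, u))"
      using ev_nf_pos[OF p] TM.ev_bundle[OF pT] TM.ev_base[OF pT ev_domain[OF x(1) U]]
    proof eventually_elim
      case (elim q)
      let ?r = "inverse (sqrt (TM.nf q))"
      have "g (fst q) (?r *\<^sub>R snd q) (?r *\<^sub>R snd q) = ?r * ?r * TM.nf q"
        using elim(2) by (simp add: g_scale_left g_scale_right T_scale TM.nf_def)
      also have "\<dots> = 1" using elim(1) by (simp add: field_simps)
      finally show ?case using elim by (simp add: nrm_def UT_points T_scale)
    qed
  next
    fix i :: 'e assume i: "i \<in> Basis"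
    show "smooth_near (tangent_bundle M) (x, u) (\<lambda>q. \<phi> (fst (nrm q)) \<bullet> i)"
      using TM.smooth_base[OF pT smooth_coordinate[OF x(1) U]] by (simp add: nrm_def)
    have "smooth_near (tangent_bundle M) (x, u) (\<lambda>q. inverse (sqrt (TM.nf q)) * snd q (\<lambda>y. \<phi> y \<bullet> i))"
      by (rule TM.B.smooth_mult[OF TM.B.smooth_inverse_sqrt[OF TM.smooth_nf[OF pT]] TM.smooth_fibre_coordinate[OF pT U i]])
        (use x in \<open>simp add: TM.nf_def\<close>)
    then show "smooth_near (tangent_bundle M) (x, u) (\<lambda>q. snd (nrm q) (\<lambda>y. \<phi> y \<bullet> i))"
      by (simp add: nrm_def)
  qed
qed

lemma to_unit_tan:
  assumes p: "(x, u) \<in> points (unit_tangent_bundle M g)" and W: "W \<in> tangent_space (tangent_bundle M) (x, u)"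
  shows "to_unit M g (x, u) W \<in> tangent_space (unit_tangent_bundle M g) (x, u)"
proof -
  note s = smooth_nrm[OF p]
  have n: "nrm (x, u) = (x, u)" using p by (simp add: nrm_def TM.nf_def UT_points)
  let ?W = "to_unit M g (x, u) W"
  have "?W (\<lambda>q. f q + h q) = ?W f + ?W h"
    if f: "smooth_near (unit_tangent_bundle M g) (x, u) f" and h: "smooth_near (unit_tangent_bundle M g) (x, u) h" for f h
    using TM.B.tan_add[OF W s[OF f] s[OF h]] UT.B.smooth_add[OF f h] f h by (simp add: to_unit_apply)
  moreover have "?W (\<lambda>q. r * f q) = r * ?W f"
    if f: "smooth_near (unit_tangent_bundle M g) (x, u) f" for f r
    using TM.B.tan_cmult[OF W s[OF f]] UT.B.smooth_cmult[OF f] f by (simp add: to_unit_apply)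
  moreover have "?W (\<lambda>q. f q * h q) = f (x, u) * ?W h + h (x, u) * ?W f"
    if f: "smooth_near (unit_tangent_bundle M g) (x, u) f" and h: "smooth_near (unit_tangent_bundle M g) (x, u) h" for f h
    using TM.B.tan_mult[OF W s[OF f] s[OF h]] UT.B.smooth_mult[OF f h] f h n by (simp add: to_unit_apply)
  ultimately show ?thesis
    unfolding tangent_space_def linear_on_def plus_fun_def scaleR_fun_def by (simp add: to_unit_apply)
qed

text \<open>Composed with \<open>nrm\<close>, a function linear on the fibres gets multiplied by the
  inverse square root of the squared norm, whose derivative at a unit vector is minus half that of
  the squared norm. The correction vanishes for horizontal lifts and removes the radial component of
  vertical ones.\<close>

lemma to_unit_values:
  assumes p: "(x, u) \<in> points (unit_tangent_bundle M g)" and W: "W \<in> tangent_space (tangent_bundle M) (x, u)"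
  shows to_unit_base: "smooth_near M x f \<Longrightarrow> to_unit M g (x, u) W (\<lambda>q. f (fst q)) = W (\<lambda>q. f (fst q))"
    and to_unit_fibre: "smooth_near M x h \<Longrightarrow> to_unit M g (x, u) W (\<lambda>q. snd q h) = W (\<lambda>q. snd q h) - u h * W TM.nf / 2"
    and to_unit_lf: "vector_field_near M x Z \<Longrightarrow> to_unit M g (x, u) W (TM.lf Z) = W (TM.lf Z) - g x (Z x) u * W TM.nf / 2"
proof -
  note pT = UT_TM[OF p]
  have x: "x \<in> points M" "u \<in> tangent_space M x" "g x u u = 1" using p by (auto simp: UT_points)
  have n: "smooth_near (tangent_bundle M) (x, u) TM.nf" "TM.nf (x, u) = 1"
    using TM.smooth_nf[OF pT] x by (auto simp: TM.nf_def)
  note r = TM.B.smooth_inverse_sqrt[OF n(1)] and Wr = TM.B.tan_inverse_sqrt[OF n W]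
  show "to_unit M g (x, u) W (\<lambda>q. f (fst q)) = W (\<lambda>q. f (fst q))" if "smooth_near M x f"
    using UT.smooth_base[OF p that] by (simp add: to_unit_apply nrm_def)
  show "to_unit M g (x, u) W (\<lambda>q. snd q h) = W (\<lambda>q. snd q h) - u h * W TM.nf / 2" if h: "smooth_near M x h"
    using UT.smooth_fibre[OF p h] TM.B.tan_mult[OF W r TM.smooth_fibre[OF pT h]] Wr n
    by (simp add: to_unit_apply nrm_def)
  show "to_unit M g (x, u) W (TM.lf Z) = W (TM.lf Z) - g x (Z x) u * W TM.nf / 2" if Z: "vector_field_near M x Z"
  proof -
    have "eventually (\<lambda>q. TM.lf Z (nrm q) = inverse (sqrt (TM.nf q)) * TM.lf Z q) (nhdf (tangent_bundle M) (x, u))"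
      using TM.ev_bundle[OF pT] TM.ev_base[OF pT vf_ev[OF Z]]
      by eventually_elim (simp add: TM.lf_def nrm_def g_scale_right)
    from TM.B.tan_local[OF W pT this]
    show ?thesis using UT.smooth_lf[OF p Z] TM.B.tan_mult[OF W r TM.smooth_lf[OF pT Z]] Wr n
      by (simp add: to_unit_apply TM.lf_def)
  qed
qed

section \<open>Lifts to the unit tangent bundle\<close>

abbreviation "UTM \<equiv> unit_tangent_bundle M g"
abbreviation "H \<equiv> unit_hlift M g D"
abbreviation "V \<equiv> unit_vlift M g"

lemma H_values:
  assumes p: "(x, u) \<in> points UTM" and X: "X \<in> tangent_space M x"
  shows H_tan: "H (x, u) X \<in> tangent_space UTM (x, u)"
    and H_base: "smooth_near M x f \<Longrightarrow> H (x, u) X (\<lambda>q. f (fst q)) = X f"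
    and H_lf: "vector_field_near M x Z \<Longrightarrow> H (x, u) X (TM.lf Z) = g x (D x X Z) u"
    and H_fibre: "(U, \<phi>) \<in> charts M \<Longrightarrow> x \<in> U \<Longrightarrow> i \<in> Basis \<Longrightarrow> H (x, u) X (\<lambda>q. snd q (\<lambda>y. \<phi> y \<bullet> i)) =
     - (\<Sum>j\<in>Basis. u (\<lambda>y. \<phi> y \<bullet> j) * D x X (cfield U \<phi> j) (\<lambda>y. \<phi> y \<bullet> i))"
  unfolding unit_hlift_def using UT.B_points(1)[OF p] smooth_coordinate[of x U \<phi> i]
  by (simp_all add: to_unit_tan[OF p hl_tan[OF UT_TM[OF p] X]] to_unit_values[OF p hl_tan[OF UT_TM[OF p] X]]
      hl_values[OF UT_TM[OF p] X] hl_fibre[OF UT_TM[OF p] X])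

lemma V_values:
  assumes p: "(x, u) \<in> points UTM" and Y: "Y \<in> tangent_space M x"
  shows V_tan: "V (x, u) Y \<in> tangent_space UTM (x, u)"
    and V_base: "smooth_near M x f \<Longrightarrow> V (x, u) Y (\<lambda>q. f (fst q)) = 0"
    and V_lf: "vector_field_near M x Z \<Longrightarrow> V (x, u) Y (TM.lf Z) = g x (Z x) Y - g x (Z x) u * g x u Y"
    and V_fibre: "smooth_near M x h \<Longrightarrow> V (x, u) Y (\<lambda>q. snd q h) = Y h - u h * g x u Y"
  unfolding unit_vlift_def
  by (simp_all add: to_unit_tan[OF p vl_tan[OF UT_TM[OF p] Y]] to_unit_values[OF p vl_tan[OF UT_TM[OF p] Y]]
      vl_values[OF UT_TM[OF p] Y])

lemma H_add: "H p (X + Y) = H p X + H p Y" and H_scale: "H p (r *\<^sub>R X) = r *\<^sub>R H p X"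
  by (cases p; simp add: fun_eq_iff unit_hlift_def to_unit_apply horizontal_lift_apply)+

lemma H_sum: "H p (\<Sum>i\<in>I. f i) = (\<Sum>i\<in>I. H p (f i))"
  using H_scale[of p 0] by (induction I rule: infinite_finite_induct) (auto simp: H_add)

text \<open>\<open>V\<close> is defined by differentiation along a line in direction of its
  argument, which does not exhibit additivity; the values on a determining family of functions
  do.\<close>

lemma V_add:
  assumes p: "(x, u) \<in> points UTM" and T: "X \<in> tangent_space M x" "Y \<in> tangent_space M x"
  shows "V (x, u) (X + Y) = V (x, u) X + V (x, u) Y"
proof (rule UT.bundle_tan_eqI_lf[OF V_tan[OF p T_add[OF T]] subspace_add[OF subspace_tangent_space V_tan[OF p T(1)] V_tan[OF p T(2)]] p])
  note x = UT.B_points[OF p]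
  fix f assume "smooth_near M x f"
  then show "V (x, u) (X + Y) (\<lambda>q. f (fst q)) = (V (x, u) X + V (x, u) Y) (\<lambda>q. f (fst q))"
    by (simp add: V_base[OF p] T T_add)
next
  note x = UT.B_points[OF p]
  fix Z assume Z: "vector_field_near M x Z"
  then show "V (x, u) (X + Y) (UT.lf Z) = (V (x, u) X + V (x, u) Y) (UT.lf Z)"
    using x T vf_tan[OF Z] by (simp add: V_lf[OF p] T_add g_add_right algebra_simps)
qed

lemma V_scale:
  assumes p: "(x, u) \<in> points UTM" and X: "X \<in> tangent_space M x"
  shows "V (x, u) (r *\<^sub>R X) = r *\<^sub>R V (x, u) X"
proof (rule UT.bundle_tan_eqI_lf[OF V_tan[OF p T_scale[OF X]] subspace_scale[OF subspace_tangent_space V_tan[OF p X]] p])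
  fix f assume "smooth_near M x f"
  then show "V (x, u) (r *\<^sub>R X) (\<lambda>q. f (fst q)) = (r *\<^sub>R V (x, u) X) (\<lambda>q. f (fst q))"
    by (simp add: V_base[OF p] X T_scale)
next
  note x = UT.B_points[OF p]
  fix Z assume Z: "vector_field_near M x Z"
  then show "V (x, u) (r *\<^sub>R X) (UT.lf Z) = (r *\<^sub>R V (x, u) X) (UT.lf Z)"
    using x X vf_tan[OF Z] by (simp add: V_lf[OF p] T_scale g_scale_right algebra_simps)
qed

text \<open>The vertical lift of \<open>u\<close> is radial, and \<open>to_unit\<close> discards
  it.\<close>

lemma V_self:
  assumes p: "(x, u) \<in> points UTM"
  shows "V (x, u) u = 0"
proof -
  have x: "x \<in> points M" "u \<in> tangent_space M x" "g x u u = 1" using p by (auto simp: UT_points)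
  show ?thesis
    by (rule UT.bundle_tan_eqI_lf[OF V_tan[OF p x(2)] subspace_0[OF subspace_tangent_space] p])
      (simp_all add: V_base[OF p x(2)] V_lf[OF p x(2)] x)
qed

lemma V_sum:
  assumes p: "(x, u) \<in> points UTM" and f: "\<And>i. i \<in> I \<Longrightarrow> f i \<in> tangent_space M x"
  shows "V (x, u) (\<Sum>i\<in>I. f i) = (\<Sum>i\<in>I. V (x, u) (f i))"
  using f V_scale[OF p T_zero, of 0]
  by (induction I rule: infinite_finite_induct) (auto simp: V_add[OF p] T_sum)

definition hfield :: "('a \<Rightarrow> 'a tvec) \<Rightarrow> 'a \<times> 'a tvec \<Rightarrow> ('a \<times> 'a tvec) tvec" where
  "hfield X q = H q (X (fst q))"

definition vfield :: "('a \<Rightarrow> 'a tvec) \<Rightarrow> 'a \<times> 'a tvec \<Rightarrow> ('a \<times> 'a tvec) tvec" where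
  "vfield X q = V q (X (fst q))"

lemma ev_UT:
  assumes p: "(x, u) \<in> points UTM" and X: "vector_field_near M x X"
  shows "eventually (\<lambda>q. q \<in> points UTM \<and> fst q \<in> points M \<and> snd q \<in> tangent_space M (fst q)
     \<and> X (fst q) \<in> tangent_space M (fst q)) (nhdf UTM (x, u))"
  using UT.ev_bundle[OF p] UT.ev_base[OF p vf_ev[OF X]] by eventually_elim simp

lemma hfield_vf:
  assumes p: "(x, u) \<in> points UTM" and X: "vector_field_near M x X"
  shows "vector_field_near UTM (x, u) (hfield X)"
proof -
  note x = UT.B_points[OF p]
  obtain U \<phi> where U: "(U, \<phi>) \<in> charts M" "x \<in> U" using chart_at[OF x(1)] .
  have pU: "(x, u) \<in> Sigma U (tangent_space M)" using U x by auto
  note c = smooth_coordinate[OF x(1) U]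
  show ?thesis
  proof (rule UT.B.vfI_chart[OF p UT.B_chart[OF U(1)] pU])
    show "eventually (\<lambda>q. hfield X q \<in> tangent_space UTM q) (nhdf UTM (x, u))"
      using ev_UT[OF p X] by eventually_elim (metis H_tan hfield_def prod.collapse)
    fix i :: "'e \<times> 'e" assume "i \<in> Basis"
    then consider j where "j \<in> Basis" "i = (j, 0)" | j where "j \<in> Basis" "i = (0, j)" by (auto simp: Basis_prod_def)
    then show "smooth_near UTM (x, u) (\<lambda>q. hfield X q (\<lambda>r. bchart \<phi> r \<bullet> i))"
    proof cases
      case 1
      have "eventually (\<lambda>q. X (fst q) (\<lambda>y. \<phi> y \<bullet> j) = hfield X q (\<lambda>r. bchart \<phi> r \<bullet> i)) (nhdf UTM (x, u))"
        using ev_UT[OF p X] UT.ev_base[OF p smooth_near_ev[OF c, of j]]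
      proof eventually_elim
        case (elim q)
        then show ?case using H_base[of "fst q" "snd q" "X (fst q)" "\<lambda>y. \<phi> y \<bullet> j"] by (simp add: hfield_def bchart_fst 1)
      qed
      then show ?thesis by (rule UT.B.smooth_near_cong[OF UT.smooth_base[OF p vf_smooth[OF X c]]])
    next
      case 2
      have s: "smooth_near UTM (x, u) (\<lambda>q. - 1 * (\<Sum>k\<in>Basis. snd q (\<lambda>y. \<phi> y \<bullet> k) *
          D (fst q) (X (fst q)) (cfield U \<phi> k) (\<lambda>y. \<phi> y \<bullet> j)))"
        by (intro UT.B.smooth_cmult UT.B.smooth_sum[OF p] UT.B.smooth_mult UT.smooth_fibre_coordinate[OF p U]
            UT.smooth_base[OF p vf_smooth[OF D_vf[OF cfield_vf[OF U] X] c]])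
      have "eventually (\<lambda>q. - 1 * (\<Sum>k\<in>Basis. snd q (\<lambda>y. \<phi> y \<bullet> k) *
          D (fst q) (X (fst q)) (cfield U \<phi> k) (\<lambda>y. \<phi> y \<bullet> j)) = hfield X q (\<lambda>r. bchart \<phi> r \<bullet> i)) (nhdf UTM (x, u))"
        using ev_UT[OF p X] UT.ev_base[OF p ev_domain[OF x(1) U]]
      proof eventually_elim
        case (elim q)
        then show ?case using H_fibre[of "fst q" "snd q" "X (fst q)" U \<phi> j] U 2 by (simp add: hfield_def bchart_snd)
      qed
      then show ?thesis by (rule UT.B.smooth_near_cong[OF s])
    qed
  qed
qed

lemma vfield_vf:
  assumes p: "(x, u) \<in> points UTM" and X: "vector_field_near M x X"
  shows "vector_field_near UTM (x, u) (vfield X)"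
proof -
  note x = UT.B_points[OF p]
  obtain U \<phi> where U: "(U, \<phi>) \<in> charts M" "x \<in> U" using chart_at[OF x(1)] .
  have pU: "(x, u) \<in> Sigma U (tangent_space M)" using U x by auto
  note c = smooth_coordinate[OF x(1) U]
  show ?thesis
  proof (rule UT.B.vfI_chart[OF p UT.B_chart[OF U(1)] pU])
    show "eventually (\<lambda>q. vfield X q \<in> tangent_space UTM q) (nhdf UTM (x, u))"
      using ev_UT[OF p X] by eventually_elim (metis V_tan vfield_def prod.collapse)
    fix i :: "'e \<times> 'e" assume "i \<in> Basis"
    then consider j where "j \<in> Basis" "i = (j, 0)" | j where "j \<in> Basis" "i = (0, j)" by (auto simp: Basis_prod_def)
    then show "smooth_near UTM (x, u) (\<lambda>q. vfield X q (\<lambda>r. bchart \<phi> r \<bullet> i))"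
    proof cases
      case 1
      have "eventually (\<lambda>q. 0 = vfield X q (\<lambda>r. bchart \<phi> r \<bullet> i)) (nhdf UTM (x, u))"
        using ev_UT[OF p X] UT.ev_base[OF p smooth_near_ev[OF c, of j]]
      proof eventually_elim
        case (elim q)
        then show ?case using V_base[of "fst q" "snd q" "X (fst q)" "\<lambda>y. \<phi> y \<bullet> j"] by (simp add: vfield_def bchart_fst 1)
      qed
      then show ?thesis by (rule UT.B.smooth_near_cong[OF UT.B.smooth_const[OF p]])
    next
      case 2
      have s: "smooth_near UTM (x, u) (\<lambda>q. X (fst q) (\<lambda>y. \<phi> y \<bullet> j) - snd q (\<lambda>y. \<phi> y \<bullet> j) * UT.lf X q)"
        by (intro UT.B.smooth_diff UT.B.smooth_mult UT.smooth_fibre_coordinate[OF p U 2(1)]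
            UT.smooth_base[OF p vf_smooth[OF X c]] UT.smooth_lf[OF p X])
      have "eventually (\<lambda>q. X (fst q) (\<lambda>y. \<phi> y \<bullet> j) - snd q (\<lambda>y. \<phi> y \<bullet> j) * UT.lf X q
          = vfield X q (\<lambda>r. bchart \<phi> r \<bullet> i)) (nhdf UTM (x, u))"
        using ev_UT[OF p X] UT.ev_base[OF p smooth_near_ev[OF c, of j]]
      proof eventually_elim
        case (elim q)
        then show ?case using V_fibre[of "fst q" "snd q" "X (fst q)" "\<lambda>y. \<phi> y \<bullet> j"] g_sym[of "fst q" "snd q" "X (fst q)"] 2
          by (simp add: vfield_def bchart_snd UT.lf_def)
      qed
      then show ?thesis by (rule UT.B.smooth_near_cong[OF s])
    qed
  qed
qed

end

lemma (in curvature_like) sum1: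
  assumes "\<And>i. i \<in> I \<Longrightarrow> a i \<in> T" "b \<in> T" "c \<in> T" "d \<in> T"
  shows "R (\<Sum>i\<in>I. r i *\<^sub>R a i) b c d = (\<Sum>i\<in>I. r i * R (a i) b c d)"
  using assms(1)
proof (induction I rule: infinite_finite_induct)
  case (insert i I)
  have "(\<Sum>i\<in>I. r i *\<^sub>R a i) \<in> T"
    by (rule subspace_sum[OF subspace]) (use insert.prems in \<open>auto intro: T_closed\<close>)
  then show ?case using insert assms by (simp add: add1 scale1 T_closed)
qed (use scale1[of 0 b c d 0] assms subspace_0[OF subspace] in auto)

section \<open>Brackets of lifted fields\<close>

context riemannian
begin

text \<open>The values are given on a neighbourhood, not just at \<open>(x, u)\<close>, because a
  Lie bracket differentiates them once more.\<close>

lemma field_values: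
  assumes p: "(x, u) \<in> points UTM" and X: "vector_field_near M x X"
  shows hfield_base: "smooth_near M x f \<Longrightarrow> eventually (\<lambda>q. hfield X q (\<lambda>r. f (fst r)) = X (fst q) f) (nhdf UTM (x, u))"
    and hfield_lf: "vector_field_near M x Z \<Longrightarrow>
      eventually (\<lambda>q. hfield X q (UT.lf Z) = UT.lf (\<lambda>y. D y (X y) Z) q) (nhdf UTM (x, u))"
    and vfield_base: "smooth_near M x f \<Longrightarrow> eventually (\<lambda>q. vfield X q (\<lambda>r. f (fst r)) = 0) (nhdf UTM (x, u))"
    and vfield_lf: "vector_field_near M x Z \<Longrightarrow>
      eventually (\<lambda>q. vfield X q (UT.lf Z) = g (fst q) (X (fst q)) (Z (fst q)) - UT.lf X q * UT.lf Z q) (nhdf UTM (x, u))"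
proof -
  note e = ev_UT[OF p X]
  show "eventually (\<lambda>q. hfield X q (\<lambda>r. f (fst r)) = X (fst q) f) (nhdf UTM (x, u))" if f: "smooth_near M x f"
    using e UT.ev_base[OF p smooth_near_ev[OF f]]
  proof eventually_elim
    case (elim q)
    then show ?case using H_base[of "fst q" "snd q" "X (fst q)" f] by (simp add: hfield_def)
  qed
  show "eventually (\<lambda>q. vfield X q (\<lambda>r. f (fst r)) = 0) (nhdf UTM (x, u))" if f: "smooth_near M x f"
    using e UT.ev_base[OF p smooth_near_ev[OF f]]
  proof eventually_elim
    case (elim q)
    then show ?case using V_base[of "fst q" "snd q" "X (fst q)" f] by (simp add: vfield_def)
  qed
  show "eventually (\<lambda>q. hfield X q (UT.lf Z) = UT.lf (\<lambda>y. D y (X y) Z) q) (nhdf UTM (x, u))"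
    if Z: "vector_field_near M x Z"
    using e UT.ev_base[OF p vf_near[OF Z]]
  proof eventually_elim
    case (elim q)
    then show ?case using H_lf[of "fst q" "snd q" "X (fst q)" Z] by (simp add: hfield_def UT.lf_def)
  qed
  show "eventually (\<lambda>q. vfield X q (UT.lf Z) = g (fst q) (X (fst q)) (Z (fst q)) - UT.lf X q * UT.lf Z q) (nhdf UTM (x, u))"
    if Z: "vector_field_near M x Z"
    using e UT.ev_base[OF p vf_near[OF Z]]
  proof eventually_elim
    case (elim q)
    then show ?case
      using V_lf[of "fst q" "snd q" "X (fst q)" Z] g_sym[of "fst q" "X (fst q)" "snd q"]
        g_sym[of "fst q" "X (fst q)" "Z (fst q)"] vf_tan[of "fst q" Z]
      by (simp add: vfield_def UT.lf_def)
  qed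
qed

text \<open>On \<open>lf Z\<close> the commutator yields <R(X,Y)Z, u> plus the value of the lift of
  [X, Y]. Skewness of the curvature moves R(X,Y) from \<open>Z\<close> to \<open>u\<close>, whose
  extension is \<open>W\<close>; this is the origin of the minus sign.\<close>

lemma lie_hfield_hfield:
  assumes p: "(x, u) \<in> points UTM" and X: "vector_field_near M x X" and Y: "vector_field_near M x Y"
    and W: "vector_field_near M x W" "W x = u"
  shows "lie_bracket UTM (hfield X) (hfield Y) (x, u) =
    H (x, u) (lie_bracket M X Y x) - V (x, u) (curvature M D X Y W x)"
proof -
  note x = UT.B_points[OF p]
  note hX = hfield_vf[OF p X] and hY = hfield_vf[OF p Y]
  note tX = UT.B.vf_tan[OF hX] and tY = UT.B.vf_tan[OF hY]
  note L = lie_tan[OF X Y] and C = curvature_vf_tan[OF X Y W(1)]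
  \<comment> \<open>R(X,Y)u is orthogonal to \<open>u\<close>, so the projection contained in
    \<open>V\<close> does not alter it.\<close>
  have CW: "g x u (curvature M D X Y W x) = 0"
    using curvature_metric[OF X Y W(1) W(1)] g_sym[OF x C] W(2) by simp
  show ?thesis
  proof (rule UT.bundle_tan_eqI_lf[OF UT.B.lie_tan[OF hX hY] subspace_diff[OF subspace_tangent_space H_tan[OF p L] V_tan[OF p C]] p])
    fix f assume f: "smooth_near M x f"
    note fX = vf_smooth[OF X f] and fY = vf_smooth[OF Y f]
    have "lie_bracket UTM (hfield X) (hfield Y) (x, u) (\<lambda>q. f (fst q)) =
        hfield X (x, u) (\<lambda>q. Y (fst q) f) - hfield Y (x, u) (\<lambda>q. X (fst q) f)"
      unfolding UT.B.lie_apply[OF UT.smooth_base[OF p f]] UT.B.tan_local[OF tX p hfield_base[OF p Y f]]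
        UT.B.tan_local[OF tY p hfield_base[OF p X f]] ..
    also have "\<dots> = lie_bracket M X Y x f"
      using UT.B.ev_at[OF hfield_base[OF p X fY] p] UT.B.ev_at[OF hfield_base[OF p Y fX] p] f by (simp add: lie_apply)
    finally show "lie_bracket UTM (hfield X) (hfield Y) (x, u) (\<lambda>q. f (fst q)) =
        (H (x, u) (lie_bracket M X Y x) - V (x, u) (curvature M D X Y W x)) (\<lambda>q. f (fst q))"
      by (simp add: H_base[OF p L f] V_base[OF p C f])
  next
    fix Z assume Z: "vector_field_near M x Z"
    note DX = D_vf[OF Z X] and DY = D_vf[OF Z Y]
    have "lie_bracket UTM (hfield X) (hfield Y) (x, u) (UT.lf Z) =
        hfield X (x, u) (UT.lf (\<lambda>y. D y (Y y) Z)) - hfield Y (x, u) (UT.lf (\<lambda>y. D y (X y) Z))"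
      unfolding UT.B.lie_apply[OF UT.smooth_lf[OF p Z]] UT.B.tan_local[OF tX p hfield_lf[OF p Y Z]]
        UT.B.tan_local[OF tY p hfield_lf[OF p X Z]] ..
    also have "\<dots> = g x (D x (X x) (\<lambda>y. D y (Y y) Z)) u - g x (D x (Y x) (\<lambda>y. D y (X y) Z)) u"
      by (simp add: hfield_def H_lf[OF p vf_tan[OF X] DY] H_lf[OF p vf_tan[OF Y] DX])
    also have "\<dots> = g x (curvature M D X Y Z x) u + g x (D x (lie_bracket M X Y x) Z) u"
      unfolding curvature_def
      by (simp add: g_diff_left x T_diff D_tan[OF DY vf_tan[OF X]] D_tan[OF DX vf_tan[OF Y]] D_tan[OF Z L])
    also have "g x (curvature M D X Y Z x) u = - g x (Z x) (curvature M D X Y W x)"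
      using curvature_metric[OF X Y Z W(1)] W(2) g_sym[OF x(1) vf_tan[OF Z] C] by simp
    finally show "lie_bracket UTM (hfield X) (hfield Y) (x, u) (UT.lf Z) =
        (H (x, u) (lie_bracket M X Y x) - V (x, u) (curvature M D X Y W x)) (UT.lf Z)"
      by (simp add: H_lf[OF p L Z] V_lf[OF p C Z] CW)
  qed
qed

lemma lie_hfield_vfield:
  assumes p: "(x, u) \<in> points UTM" and X: "vector_field_near M x X" and Y: "vector_field_near M x Y"
  shows "lie_bracket UTM (hfield X) (vfield Y) (x, u) = V (x, u) (D x (X x) Y)"
proof -
  note x = UT.B_points[OF p]
  note hX = hfield_vf[OF p X] and vY = vfield_vf[OF p Y]
  note tX = UT.B.vf_tan[OF hX] and tY = UT.B.vf_tan[OF vY]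
  note DXY = D_vf[OF Y X] and dXY = D_tan[OF Y vf_tan[OF X]]
  show ?thesis
  proof (rule UT.bundle_tan_eqI_lf[OF UT.B.lie_tan[OF hX vY] V_tan[OF p dXY] p])
    fix f assume f: "smooth_near M x f"
    note fX = vf_smooth[OF X f]
    have "lie_bracket UTM (hfield X) (vfield Y) (x, u) (\<lambda>q. f (fst q)) =
        hfield X (x, u) (\<lambda>q. 0) - vfield Y (x, u) (\<lambda>q. X (fst q) f)"
      unfolding UT.B.lie_apply[OF UT.smooth_base[OF p f]] UT.B.tan_local[OF tX p vfield_base[OF p Y f]]
        UT.B.tan_local[OF tY p hfield_base[OF p X f]] ..
    then show "lie_bracket UTM (hfield X) (vfield Y) (x, u) (\<lambda>q. f (fst q)) = V (x, u) (D x (X x) Y) (\<lambda>q. f (fst q))"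
      using UT.B.ev_at[OF vfield_base[OF p Y fX] p] UT.B.tan_const[OF tX p] by (simp add: V_base[OF p dXY f])
  next
    fix Z assume Z: "vector_field_near M x Z"
    note DXZ = D_vf[OF Z X]
    note lY = UT.smooth_lf[OF p Y] and lZ = UT.smooth_lf[OF p Z] and gYZ = g_smooth[OF Y Z]
    have hZ: "hfield X (x, u) (UT.lf Z) = UT.lf (\<lambda>y. D y (X y) Z) (x, u)"
      and hY: "hfield X (x, u) (UT.lf Y) = UT.lf (\<lambda>y. D y (X y) Y) (x, u)"
      and hg: "hfield X (x, u) (\<lambda>q. g (fst q) (Y (fst q)) (Z (fst q))) = g x (D x (X x) Y) (Z x) + g x (Y x) (D x (X x) Z)"
      using UT.B.ev_at[OF hfield_lf[OF p X Z] p] UT.B.ev_at[OF hfield_lf[OF p X Y] p]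
        UT.B.ev_at[OF hfield_base[OF p X gYZ] p] D_metric[OF Y Z vf_tan[OF X]] by simp_all
    have "lie_bracket UTM (hfield X) (vfield Y) (x, u) (UT.lf Z) =
        hfield X (x, u) (\<lambda>q. g (fst q) (Y (fst q)) (Z (fst q)) - UT.lf Y q * UT.lf Z q)
        - vfield Y (x, u) (UT.lf (\<lambda>y. D y (X y) Z))"
      unfolding UT.B.lie_apply[OF lZ] UT.B.tan_local[OF tX p vfield_lf[OF p Y Z]]
        UT.B.tan_local[OF tY p hfield_lf[OF p X Z]] ..
    also have "\<dots> = g x (D x (X x) Y) (Z x) - UT.lf (\<lambda>y. D y (X y) Y) (x, u) * UT.lf Z (x, u)"
      unfolding UT.B.tan_diff[OF tX UT.smooth_base[OF p gYZ] UT.B.smooth_mult[OF lY lZ]] UT.B.tan_mult[OF tX lY lZ] hZ hY hg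
        UT.B.ev_at[OF vfield_lf[OF p Y DXZ] p] by simp
    finally show "lie_bracket UTM (hfield X) (vfield Y) (x, u) (UT.lf Z) = V (x, u) (D x (X x) Y) (UT.lf Z)"
      using g_sym[OF x(1) dXY vf_tan[OF Z]] g_sym[OF x(1) dXY x(2)] by (simp add: V_lf[OF p dXY Z] UT.lf_def)
  qed
qed

text \<open>On the tangent bundle vertical lifts of fields on \<open>M\<close> commute. The
  right-hand side comes from projecting them to the unit sphere in the fibre, and it supplies the
  constant curvature term in the torsion.\<close>

lemma lie_vfield_vfield:
  assumes p: "(x, u) \<in> points UTM" and X: "vector_field_near M x X" and Y: "vector_field_near M x Y"
  shows "lie_bracket UTM (vfield X) (vfield Y) (x, u) = g x (X x) u *\<^sub>R V (x, u) (Y x) - g x (Y x) u *\<^sub>R V (x, u) (X x)"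
proof -
  note x = UT.B_points[OF p]
  note vX = vfield_vf[OF p X] and vY = vfield_vf[OF p Y]
  note tX = UT.B.vf_tan[OF vX] and tY = UT.B.vf_tan[OF vY]
  note X' = vf_tan[OF X] and Y' = vf_tan[OF Y]
  show ?thesis
  proof (rule UT.bundle_tan_eqI_lf[OF UT.B.lie_tan[OF vX vY] _ p])
    show "g x (X x) u *\<^sub>R V (x, u) (Y x) - g x (Y x) u *\<^sub>R V (x, u) (X x) \<in> tangent_space UTM (x, u)"
      by (intro subspace_diff[OF subspace_tangent_space] subspace_scale[OF subspace_tangent_space] V_tan[OF p] X' Y')
  next
    fix f assume f: "smooth_near M x f"
    have "lie_bracket UTM (vfield X) (vfield Y) (x, u) (\<lambda>q. f (fst q)) = vfield X (x, u) (\<lambda>q. 0) - vfield Y (x, u) (\<lambda>q. 0)"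
      unfolding UT.B.lie_apply[OF UT.smooth_base[OF p f]] UT.B.tan_local[OF tX p vfield_base[OF p Y f]]
        UT.B.tan_local[OF tY p vfield_base[OF p X f]] ..
    then show "lie_bracket UTM (vfield X) (vfield Y) (x, u) (\<lambda>q. f (fst q)) =
        (g x (X x) u *\<^sub>R V (x, u) (Y x) - g x (Y x) u *\<^sub>R V (x, u) (X x)) (\<lambda>q. f (fst q))"
      using UT.B.tan_const[OF tX p] UT.B.tan_const[OF tY p] by (simp add: V_base[OF p X' f] V_base[OF p Y' f])
  next
    fix Z assume Z: "vector_field_near M x Z"
    note lX = UT.smooth_lf[OF p X] and lY = UT.smooth_lf[OF p Y] and lZ = UT.smooth_lf[OF p Z]
    have v0: "vfield X (x, u) (\<lambda>q. g (fst q) (Y (fst q)) (Z (fst q))) = 0"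
        "vfield Y (x, u) (\<lambda>q. g (fst q) (X (fst q)) (Z (fst q))) = 0"
      using UT.B.ev_at[OF vfield_base[OF p X g_smooth[OF Y Z]] p] UT.B.ev_at[OF vfield_base[OF p Y g_smooth[OF X Z]] p]
      by simp_all
    have "lie_bracket UTM (vfield X) (vfield Y) (x, u) (UT.lf Z) =
        vfield X (x, u) (\<lambda>q. g (fst q) (Y (fst q)) (Z (fst q)) - UT.lf Y q * UT.lf Z q)
        - vfield Y (x, u) (\<lambda>q. g (fst q) (X (fst q)) (Z (fst q)) - UT.lf X q * UT.lf Z q)"
      unfolding UT.B.lie_apply[OF lZ] UT.B.tan_local[OF tX p vfield_lf[OF p Y Z]]
        UT.B.tan_local[OF tY p vfield_lf[OF p X Z]] ..
    then show "lie_bracket UTM (vfield X) (vfield Y) (x, u) (UT.lf Z) =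
        (g x (X x) u *\<^sub>R V (x, u) (Y x) - g x (Y x) u *\<^sub>R V (x, u) (X x)) (UT.lf Z)"
      unfolding UT.B.tan_diff[OF tX UT.smooth_base[OF p g_smooth[OF Y Z]] UT.B.smooth_mult[OF lY lZ]]
        UT.B.tan_diff[OF tY UT.smooth_base[OF p g_smooth[OF X Z]] UT.B.smooth_mult[OF lX lZ]]
        UT.B.tan_mult[OF tX lY lZ] UT.B.tan_mult[OF tY lX lZ] v0
        UT.B.ev_at[OF vfield_lf[OF p X Y] p] UT.B.ev_at[OF vfield_lf[OF p X Z] p]
        UT.B.ev_at[OF vfield_lf[OF p Y X] p] UT.B.ev_at[OF vfield_lf[OF p Y Z] p]
      using g_sym[OF x(1) X' Y'] g_sym[OF x X'] g_sym[OF x Y'] g_sym[OF x(1) X' vf_tan[OF Z]] g_sym[OF x(1) Y' vf_tan[OF Z]]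
      by (simp add: V_lf[OF p X' Z] V_lf[OF p Y' Z] UT.lf_def algebra_simps)
  qed
qed

text \<open>The geodesic flow field. It is not of the form \<open>hfield X\<close>, since the lifted
  vector depends on the fibre point.\<close>

definition geo :: "'a \<times> 'a tvec \<Rightarrow> ('a \<times> 'a tvec) tvec" where
  "geo q = H q (snd q)"

lemma geo_expand:
  assumes p: "(x, u) \<in> points UTM" and U: "(U, \<phi>) \<in> charts M" "x \<in> U"
  shows "eventually (\<lambda>q. (\<Sum>i\<in>Basis. snd q (\<lambda>y. \<phi> y \<bullet> i) *\<^sub>R hfield (cfield U \<phi> i) q) = geo q) (nhdf UTM (x, u))"
  using UT.ev_bundle[OF p] UT.ev_base[OF p ev_domain[OF UT.B_points(1)[OF p] U]]
proof eventually_elim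
  case (elim q)
  have "geo q = H q (\<Sum>i\<in>Basis. snd q (\<lambda>y. \<phi> y \<bullet> i) *\<^sub>R cfield U \<phi> i (fst q))"
    unfolding geo_def using tan_expand[OF U(1) elim(2), of "snd q"] elim(1) by simp
  then show ?case by (simp add: H_sum H_scale hfield_def)
qed

lemma geo_vf:
  assumes p: "(x, u) \<in> points UTM"
  shows "vector_field_near UTM (x, u) geo"
proof -
  obtain U \<phi> where U: "(U, \<phi>) \<in> charts M" "x \<in> U" using chart_at[OF UT.B_points(1)[OF p]] .
  have "vector_field_near UTM (x, u) (\<lambda>q. \<Sum>i\<in>Basis. snd q (\<lambda>y. \<phi> y \<bullet> i) *\<^sub>R hfield (cfield U \<phi> i) q)"
    by (intro UT.B.vf_sum[OF p] UT.B.vf_scale hfield_vf[OF p cfield_vf[OF U]] UT.smooth_fibre_coordinate[OF p U])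
  then show ?thesis using geo_expand[OF p U] by (rule UT.B.vf_cong)
qed

text \<open>The Leibniz rule for the expansion \<open>geo_expand\<close>: its coefficients are the
  fibre coordinates, and \<open>W\<close> differentiates them.\<close>

lemma lie_geo:
  assumes p: "(x, u) \<in> points UTM" and U: "(U, \<phi>) \<in> charts M" "x \<in> U" and W: "vector_field_near UTM (x, u) W"
  shows "lie_bracket UTM geo W (x, u) =
    (\<Sum>i\<in>Basis. u (\<lambda>y. \<phi> y \<bullet> i) *\<^sub>R lie_bracket UTM (hfield (cfield U \<phi> i)) W (x, u)
       - W (x, u) (\<lambda>q. snd q (\<lambda>y. \<phi> y \<bullet> i)) *\<^sub>R H (x, u) (cfield U \<phi> i x))"
proof -
  let ?F = "\<lambda>i q. snd q (\<lambda>y. \<phi> y \<bullet> i) *\<^sub>R hfield (cfield U \<phi> i) q"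
  note h = hfield_vf[OF p cfield_vf[OF U]] and s = UT.smooth_fibre_coordinate[OF p U]
  have F: "vector_field_near UTM (x, u) (?F i)" if "i \<in> Basis" for i
    by (rule UT.B.vf_scale[OF h s[OF that]])
  have "lie_bracket UTM (\<lambda>q. \<Sum>i\<in>Basis. ?F i q) W (x, u) = lie_bracket UTM geo W (x, u)"
    by (rule UT.B.lie_cong[OF UT.B.vf_sum[OF p F] W geo_expand[OF p U]]) auto
  moreover have "lie_bracket UTM (\<lambda>q. \<Sum>i\<in>Basis. ?F i q) W (x, u) = (\<Sum>i\<in>Basis. lie_bracket UTM (?F i) W (x, u))"
    by (rule UT.B.lie_sum_left[OF F W])
  moreover have "lie_bracket UTM (?F i) W (x, u) = u (\<lambda>y. \<phi> y \<bullet> i) *\<^sub>R lie_bracket UTM (hfield (cfield U \<phi> i)) W (x, u)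
       - W (x, u) (\<lambda>q. snd q (\<lambda>y. \<phi> y \<bullet> i)) *\<^sub>R H (x, u) (cfield U \<phi> i x)" if "i \<in> Basis" for i
    using UT.B.lie_scale_left[OF h W s[OF that]] by (simp add: hfield_def)
  ultimately show ?thesis by simp
qed

text \<open>The horizontal terms arise because the vertical field differentiates the fibre
  coordinates in \<open>geo_expand\<close>, giving the components of \<open>Y\<close> minus its part
  along \<open>u\<close>.\<close>

lemma lie_geo_vfield:
  assumes p: "(x, u) \<in> points UTM" and Y: "vector_field_near M x Y"
  shows "lie_bracket UTM geo (vfield Y) (x, u) =
    V (x, u) (D x u Y) - H (x, u) (Y x) + g x (Y x) u *\<^sub>R H (x, u) u"
proof -
  note x = UT.B_points[OF p]
  obtain U \<phi> where U: "(U, \<phi>) \<in> charts M" "x \<in> U" using chart_at[OF x(1)] .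
  note cx = cfield_tan[OF U]
  note eu = tan_expand[OF U x(2)] and eY = tan_expand[OF U vf_tan[OF Y]]
  have "V (x, u) (D x u Y) = V (x, u) (D x (\<Sum>i\<in>Basis. u (\<lambda>y. \<phi> y \<bullet> i) *\<^sub>R cfield U \<phi> i x) Y)" using eu by simp
  also have "D x (\<Sum>i\<in>Basis. u (\<lambda>y. \<phi> y \<bullet> i) *\<^sub>R cfield U \<phi> i x) Y = (\<Sum>i\<in>Basis. u (\<lambda>y. \<phi> y \<bullet> i) *\<^sub>R D x (cfield U \<phi> i x) Y)"
    by (subst D_dir_sum[OF Y T_scale[OF cx]]) (simp add: D_dir_scale[OF Y cx])
  also have "V (x, u) \<dots> = (\<Sum>i\<in>Basis. u (\<lambda>y. \<phi> y \<bullet> i) *\<^sub>R V (x, u) (D x (cfield U \<phi> i x) Y))"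
    by (subst V_sum[OF p T_scale[OF D_tan[OF Y cx]]]) (simp add: V_scale[OF p D_tan[OF Y cx]])
  finally have 1: "V (x, u) (D x u Y) = (\<Sum>i\<in>Basis. u (\<lambda>y. \<phi> y \<bullet> i) *\<^sub>R V (x, u) (D x (cfield U \<phi> i x) Y))" .
  have Hs: "H (x, u) v = (\<Sum>i\<in>Basis. v (\<lambda>y. \<phi> y \<bullet> i) *\<^sub>R H (x, u) (cfield U \<phi> i x))" if "v \<in> tangent_space M x" for v
  proof -
    have "H (x, u) v = H (x, u) (\<Sum>i\<in>Basis. v (\<lambda>y. \<phi> y \<bullet> i) *\<^sub>R cfield U \<phi> i x)" using tan_expand[OF U that] by simp
    then show ?thesis by (simp add: H_sum H_scale)
  qed
  have vi: "vfield Y (x, u) (\<lambda>q. snd q (\<lambda>y. \<phi> y \<bullet> i)) = Y x (\<lambda>y. \<phi> y \<bullet> i) - u (\<lambda>y. \<phi> y \<bullet> i) * g x (Y x) u" for i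
    using V_fibre[OF p vf_tan[OF Y] smooth_coordinate[OF x(1) U]] g_sym[OF x(1) vf_tan[OF Y] x(2)] by (simp add: vfield_def)
  show ?thesis
    unfolding lie_geo[OF p U vfield_vf[OF p Y]] lie_hfield_vfield[OF p cfield_vf[OF U] Y] vi 1 Hs[OF x(2)] Hs[OF vf_tan[OF Y]]
    by (simp add: sum_subtractf sum.distrib scaleR_diff_left scaleR_sum_right algebra_simps)
qed

text \<open>The vertical part \<open>C\<close> is described by its inner products, which is all that
  is used of it. \<open>S\<close> stays unspecified: in the Killing equation it is paired with a
  vertical vector, and for \<open>b = 0\<close> that pairing vanishes.\<close>

lemma lie_geo_hfield:
  assumes p: "(x, u) \<in> points UTM" and X: "vector_field_near M x X"
  obtains S C where "S \<in> tangent_space M x" "C \<in> tangent_space M x"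
    "lie_bracket UTM geo (hfield X) (x, u) = H (x, u) S - V (x, u) C"
    "\<And>w. w \<in> tangent_space M x \<Longrightarrow> g x C w = Rm x u (X x) u w"
proof -
  note x = UT.B_points[OF p]
  interpret R: curvature_like "tangent_space M x" "Rm x" by (rule Rm_curvature_like[OF x(1)])
  obtain U \<phi> where U: "(U, \<phi>) \<in> charts M" "x \<in> U" using chart_at[OF x(1)] .
  obtain W where W: "vector_field_near M x W" "W x = u" using extension[OF x] .
  note cx = cfield_tan[OF U] and cv = cfield_vf[OF U]
  define S where "S = (\<Sum>i\<in>Basis. u (\<lambda>y. \<phi> y \<bullet> i) *\<^sub>R lie_bracket M (cfield U \<phi> i) X x
       - hfield X (x, u) (\<lambda>q. snd q (\<lambda>y. \<phi> y \<bullet> i)) *\<^sub>R cfield U \<phi> i x)"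
  define C where "C = (\<Sum>i\<in>Basis. u (\<lambda>y. \<phi> y \<bullet> i) *\<^sub>R curvature M D (cfield U \<phi> i) X W x)"
  note t = curvature_vf_tan[OF cv X W(1)]
  have S: "S \<in> tangent_space M x" unfolding S_def by (intro T_sum T_diff T_scale lie_tan[OF cv X] cx)
  have C: "C \<in> tangent_space M x" unfolding C_def by (intro T_sum T_scale t)
  have HS: "H (x, u) S = (\<Sum>i\<in>Basis. u (\<lambda>y. \<phi> y \<bullet> i) *\<^sub>R H (x, u) (lie_bracket M (cfield U \<phi> i) X x)
       - hfield X (x, u) (\<lambda>q. snd q (\<lambda>y. \<phi> y \<bullet> i)) *\<^sub>R H (x, u) (cfield U \<phi> i x))"
    unfolding S_def H_sum
  proof (rule sum.cong[OF refl])
    fix i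
    show "H (x, u) (u (\<lambda>y. \<phi> y \<bullet> i) *\<^sub>R lie_bracket M (cfield U \<phi> i) X x
       - hfield X (x, u) (\<lambda>q. snd q (\<lambda>y. \<phi> y \<bullet> i)) *\<^sub>R cfield U \<phi> i x) =
       u (\<lambda>y. \<phi> y \<bullet> i) *\<^sub>R H (x, u) (lie_bracket M (cfield U \<phi> i) X x)
       - hfield X (x, u) (\<lambda>q. snd q (\<lambda>y. \<phi> y \<bullet> i)) *\<^sub>R H (x, u) (cfield U \<phi> i x)"
      using H_add[of "(x, u)" "u (\<lambda>y. \<phi> y \<bullet> i) *\<^sub>R lie_bracket M (cfield U \<phi> i) X x"
          "(- hfield X (x, u) (\<lambda>q. snd q (\<lambda>y. \<phi> y \<bullet> i))) *\<^sub>R cfield U \<phi> i x"]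
      unfolding H_scale by simp
  qed
  have VC: "V (x, u) C = (\<Sum>i\<in>Basis. u (\<lambda>y. \<phi> y \<bullet> i) *\<^sub>R V (x, u) (curvature M D (cfield U \<phi> i) X W x))"
    unfolding C_def by (subst V_sum[OF p T_scale[OF t]]) (simp add: V_scale[OF p t])
  have "lie_bracket UTM geo (hfield X) (x, u) = H (x, u) S - V (x, u) C"
    unfolding lie_geo[OF p U hfield_vf[OF p X]] lie_hfield_hfield[OF p cv X W] HS VC
    by (simp add: sum_subtractf[symmetric] scaleR_diff_right algebra_simps)
  moreover have "g x C w = Rm x u (X x) u w" if w: "w \<in> tangent_space M x" for w
  proof -
    have "g x C w = (\<Sum>i\<in>Basis. g x (u (\<lambda>y. \<phi> y \<bullet> i) *\<^sub>R curvature M D (cfield U \<phi> i) X W x) w)"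
      unfolding C_def by (rule g_sum_left[OF x(1) w T_scale[OF t]])
    also have "\<dots> = (\<Sum>i\<in>Basis. u (\<lambda>y. \<phi> y \<bullet> i) * Rm x (cfield U \<phi> i x) (X x) u w)"
      by (simp add: g_scale_left[OF x(1) w t] Rm_eq[OF cv X W(1) w] W(2))
    also have "\<dots> = Rm x (\<Sum>i\<in>Basis. u (\<lambda>y. \<phi> y \<bullet> i) *\<^sub>R cfield U \<phi> i x) (X x) u w"
      by (rule R.sum1[symmetric]) (use cx vf_tan[OF X] x w in auto)
    also have "\<dots> = Rm x u (X x) u w" using tan_expand[OF U x(2)] by simp
    finally show ?thesis .
  qed
  ultimately show ?thesis using that S C by blast
qed

text \<open>Horizontal and vertical vectors span the tangent space. The coefficients are written as
  values of \<open>w\<close> and \<open>z\<close> on coordinate functions so that they depend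
  smoothly on the base point when \<open>w\<close> is a field.\<close>

lemma UT_decompose:
  assumes p: "(x, u) \<in> points UTM" and w: "w \<in> tangent_space UTM (x, u)"
    and U: "(U, \<phi>) \<in> charts M" "x \<in> U"
  defines "z \<equiv> w - (\<Sum>i\<in>Basis. w (\<lambda>q. \<phi> (fst q) \<bullet> i) *\<^sub>R H (x, u) (cfield U \<phi> i x))"
  shows "z = (\<Sum>i\<in>Basis. z (\<lambda>q. snd q (\<lambda>y. \<phi> y \<bullet> i)) *\<^sub>R V (x, u) (cfield U \<phi> i x))"
proof -
  note x = UT.B_points[OF p]
  note cx = cfield_tan[OF U]
  \<comment> \<open>The image of \<open>w\<close> under the differential of the bundle projection.
    Subtracting its horizontal lift leaves a vertical vector.\<close>
  define X where "X = (\<lambda>f. if smooth_near M x f then w (\<lambda>q. f (fst q)) else 0)"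
  note s = UT.smooth_base[OF p]
  have "X (\<lambda>q. f q + h q) = X f + X h" if f: "smooth_near M x f" and h: "smooth_near M x h" for f h
    using UT.B.tan_add[OF w s[OF f] s[OF h]] smooth_add[OF f h] f h by (simp add: X_def)
  moreover have "X (\<lambda>q. r * f q) = r * X f" if f: "smooth_near M x f" for f r
    using UT.B.tan_cmult[OF w s[OF f]] smooth_cmult[OF f] f by (simp add: X_def)
  moreover have "X (\<lambda>q. f q * h q) = f x * X h + h x * X f"
    if f: "smooth_near M x f" and h: "smooth_near M x h" for f h
    using UT.B.tan_mult[OF w s[OF f] s[OF h]] smooth_mult[OF f h] f h by (simp add: X_def)
  ultimately have X: "X \<in> tangent_space M x"
    unfolding tangent_space_def linear_on_def plus_fun_def scaleR_fun_def by (simp add: X_def)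
  have "H (x, u) X = H (x, u) (\<Sum>i\<in>Basis. X (\<lambda>y. \<phi> y \<bullet> i) *\<^sub>R cfield U \<phi> i x)" using tan_expand[OF U X] by simp
  then have "z = w - H (x, u) X"
    unfolding z_def by (simp add: H_sum H_scale X_def smooth_coordinate[OF x(1) U])
  then have z: "z \<in> tangent_space UTM (x, u)" and zb: "\<And>f. smooth_near M x f \<Longrightarrow> z (\<lambda>q. f (fst q)) = 0"
    using subspace_diff[OF subspace_tangent_space w H_tan[OF p X]] H_base[OF p X] by (auto simp: X_def)
  define Y where "Y = (\<Sum>j\<in>Basis. z (\<lambda>q. snd q (\<lambda>y. \<phi> y \<bullet> j)) *\<^sub>R cfield U \<phi> j x)"
  have Y: "Y \<in> tangent_space M x" unfolding Y_def by (intro T_sum T_scale cx)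
  let ?d = "\<lambda>i q. snd q (\<lambda>y. \<phi> y \<bullet> i)" and ?l = "\<lambda>i. UT.lf (cfield U \<phi> i)"
  have d: "smooth_near UTM (x, u) (?d i)" if "i \<in> Basis" for i using that by (rule UT.smooth_fibre_coordinate[OF p U])
  have l: "smooth_near UTM (x, u) (?l i)" for i by (rule UT.smooth_lf[OF p cfield_vf[OF U]])
  \<comment> \<open>Differentiating the constraint that the squared norm is 1 along \<open>z\<close>
    gives 2 <u, Y> = 0. Hence \<open>V (x, u) Y\<close> has no projection term and equals
    \<open>z\<close>.\<close>
  have "eventually (\<lambda>q. (\<Sum>i\<in>Basis. ?d i q * ?l i q) = 1) (nhdf UTM (x, u))"
    using UT.nf_expand[OF p U] UT.B.ev_points[OF p]
    by eventually_elim (auto simp: UT_points UT.nf_def)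
  then have "z (\<lambda>q. \<Sum>i\<in>Basis. ?d i q * ?l i q) = z (\<lambda>q. 1)" by (rule UT.B.tan_local[OF z p])
  also have "\<dots> = 0" by (rule UT.B.tan_const[OF z p])
  also have "z (\<lambda>q. \<Sum>i\<in>Basis. ?d i q * ?l i q) = (\<Sum>i\<in>Basis. z (\<lambda>q. ?d i q * ?l i q))"
    by (rule UT.B.tan_sum[OF z p UT.B.smooth_mult[OF d l]])
  also have "\<dots> = (\<Sum>i\<in>Basis. g x (u (\<lambda>y. \<phi> y \<bullet> i) *\<^sub>R cfield U \<phi> i x) Y + g x (z (?d i) *\<^sub>R cfield U \<phi> i x) u)"
  proof (rule sum.cong[OF refl])
    fix i :: 'e assume i: "i \<in> Basis"
    show "z (\<lambda>q. ?d i q * ?l i q) = g x (u (\<lambda>y. \<phi> y \<bullet> i) *\<^sub>R cfield U \<phi> i x) Y + g x (z (?d i) *\<^sub>R cfield U \<phi> i x) u"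
      using UT.B.tan_mult[OF z d[OF i] l] UT.vertical_lf[OF z p U zb, of i]
      by (simp add: g_scale_left[OF x(1) Y cx] g_scale_left[OF x cx] UT.lf_def[of _ "(x, u)"] Y_def[symmetric] mult.commute)
  qed
  also have "\<dots> = g x u Y + g x Y u"
  proof -
    have "g x u Y = g x (\<Sum>i\<in>Basis. u (\<lambda>y. \<phi> y \<bullet> i) *\<^sub>R cfield U \<phi> i x) Y" using tan_expand[OF U x(2)] by simp
    also have "\<dots> = (\<Sum>i\<in>Basis. g x (u (\<lambda>y. \<phi> y \<bullet> i) *\<^sub>R cfield U \<phi> i x) Y)"
      by (rule g_sum_left[OF x(1) Y T_scale[OF cx]])
    finally have "(\<Sum>i\<in>Basis. g x (u (\<lambda>y. \<phi> y \<bullet> i) *\<^sub>R cfield U \<phi> i x) Y) = g x u Y" ..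
    moreover have "(\<Sum>i\<in>Basis. g x (z (?d i) *\<^sub>R cfield U \<phi> i x) u) = g x Y u"
      unfolding Y_def by (rule g_sum_left[OF x T_scale[OF cx], symmetric])
    ultimately show ?thesis by (simp add: sum.distrib)
  qed
  finally have uY: "g x u Y = 0" using g_sym[OF x(1) Y x(2)] by simp
  have "z = V (x, u) Y"
  proof (rule UT.bundle_tan_eqI[OF z V_tan[OF p Y] p U])
    fix i :: 'e assume i: "i \<in> Basis"
    show "z (\<lambda>q. \<phi> (fst q) \<bullet> i) = V (x, u) Y (\<lambda>q. \<phi> (fst q) \<bullet> i)"
      using zb[OF smooth_coordinate[OF x(1) U]] V_base[OF p Y smooth_coordinate[OF x(1) U]] by simp
    show "z (?d i) = V (x, u) Y (?d i)"
      unfolding V_fibre[OF p Y smooth_coordinate[OF x(1) U]] uY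
      using UT.cfield_sum_coordinate[OF U i, of "\<lambda>j. z (?d j)"] by (simp add: Y_def)
  qed
  also have "V (x, u) Y = (\<Sum>i\<in>Basis. z (?d i) *\<^sub>R V (x, u) (cfield U \<phi> i x))"
    unfolding Y_def by (subst V_sum[OF p T_scale[OF cx]]) (simp add: V_scale[OF p cx])
  finally show ?thesis .
qed

text \<open>The vertical coordinate fields are dependent because \<open>V\<close> annihilates
  \<open>u\<close>, so the coefficients are not unique. The explicit ones of
  \<open>UT_decompose\<close> are smooth.\<close>

lemma frame:
  assumes p: "(x, u) \<in> points UTM" and W: "vector_field_near UTM (x, u) W"
    and U: "(U, \<phi>) \<in> charts M" "x \<in> U"
  obtains F K where "\<And>i. i \<in> Basis \<Longrightarrow> smooth_near UTM (x, u) (F i)"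
    "\<And>i. i \<in> Basis \<Longrightarrow> smooth_near UTM (x, u) (K i)"
    "eventually (\<lambda>q. (\<Sum>i\<in>Basis. F i q *\<^sub>R hfield (cfield U \<phi> i) q) + (\<Sum>i\<in>Basis. K i q *\<^sub>R vfield (cfield U \<phi> i) q) = W q)
      (nhdf UTM (x, u))"
proof -
  note x = UT.B_points[OF p]
  define F where "F i q = W q (\<lambda>q. \<phi> (fst q) \<bullet> i)" for i q
  define Z where "Z q = W q - (\<Sum>i\<in>Basis. F i q *\<^sub>R hfield (cfield U \<phi> i) q)" for q
  define K where "K i q = Z q (\<lambda>q. snd q (\<lambda>y. \<phi> y \<bullet> i))" for i q
  have F: "smooth_near UTM (x, u) (F i)" for i
    unfolding F_def by (rule UT.B.vf_smooth[OF W UT.smooth_base[OF p smooth_coordinate[OF x(1) U]]])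
  have Z: "vector_field_near UTM (x, u) Z"
    unfolding Z_def by (intro UT.B.vf_diff[OF W] UT.B.vf_sum[OF p] UT.B.vf_scale hfield_vf[OF p cfield_vf[OF U]] F)
  have K: "smooth_near UTM (x, u) (K i)" if "i \<in> Basis" for i
    unfolding K_def by (rule UT.B.vf_smooth[OF Z UT.smooth_fibre_coordinate[OF p U that]])
  have "eventually (\<lambda>q. (\<Sum>i\<in>Basis. F i q *\<^sub>R hfield (cfield U \<phi> i) q) + (\<Sum>i\<in>Basis. K i q *\<^sub>R vfield (cfield U \<phi> i) q) = W q)
      (nhdf UTM (x, u))"
    using UT.B.ev_points[OF p] UT.B.vf_ev[OF W] UT.ev_base[OF p ev_domain[OF x(1) U]]
  proof eventually_elim
    case (elim q)
    obtain y v where q: "q = (y, v)" by (cases q)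
    have Zq: "Z (y, v) = W (y, v) - (\<Sum>i\<in>Basis. W (y, v) (\<lambda>q. \<phi> (fst q) \<bullet> i) *\<^sub>R H (y, v) (cfield U \<phi> i y))"
      by (simp add: Z_def F_def hfield_def)
    have "Z (y, v) = (\<Sum>i\<in>Basis. K i (y, v) *\<^sub>R vfield (cfield U \<phi> i) (y, v))"
      unfolding K_def vfield_def fst_conv Zq by (rule UT_decompose) (use elim q U in auto)
    then show ?case using q by (simp add: Z_def diff_eq_eq add.commute)
  qed
  then show ?thesis using that F K by blast
qed

end

section \<open>Paracontact metric structures\<close>

text \<open>Bookkeeping for \<open>killing_app\<close>: \<open>A\<close>, \<open>B\<close>,
  \<open>E\<close>, \<open>F\<close> are the iterated derivatives \<xi> V \<eta>(W), \<xi> W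
  \<eta>(V), V \<xi> \<eta>(W), W \<xi> \<eta>(V), while \<open>C\<close> and \<open>D\<close> are
  \<eta> of [V, [\<xi>, W]] and of [[\<xi>, V], W].\<close>

lemma lie_deta_cancel:
  "1/2 * (A - B - (C + D)) - 1/2 * (A - E - F - D) - 1/2 * (E - (B - F) - C) = (0::real)"
  by (simp add: field_simps)

lemma add_neg_scaleR2: "x + (-1 * a) *\<^sub>R y + (-1 * b) *\<^sub>R z = x - a *\<^sub>R y - b *\<^sub>R z"
  for x y z :: "'v::real_vector"
  by simp

locale paracontact = smooth_space N for N :: "('p, 'e::euclidean_space) space" +
  fixes n :: nat and \<phi> :: "'p endo_field" and \<xi> :: "'p \<Rightarrow> 'p tvec" and \<eta> :: "'p \<Rightarrow> 'p tvec \<Rightarrow> real"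
    and G :: "'p \<Rightarrow> 'p tvec \<Rightarrow> 'p tvec \<Rightarrow> real"
  assumes pm: "paracontact_metric N n \<phi> \<xi> \<eta> G"
begin

abbreviation "T \<equiv> tangent_space N"
abbreviation "vf \<equiv> vector_field_near N"
abbreviation "lie \<equiv> lie_bracket N"
abbreviation "app \<equiv> app_field \<phi>"

section \<open>Pointwise algebra of the structure tensors\<close>

lemma almost_paracontact_properties:
  assumes p: "p \<in> points N"
  shows phi_linear: "linear_on (T p) (\<phi> p)" and phi_image: "\<phi> p ` T p \<subseteq> T p" and eta_linear: "linear_on (T p) (\<eta> p)"
    and xi_vf: "vf p \<xi>" and app_vf: "vf p V \<Longrightarrow> vf p (app V)"
    and eta_smooth: "vf p V \<Longrightarrow> smooth_near N p (\<lambda>q. \<eta> q (V q))"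
    and eta_xi: "\<eta> p (\<xi> p) = 1" and phi_sq: "v \<in> T p \<Longrightarrow> \<phi> p (\<phi> p v) = v - \<eta> p v *\<^sub>R \<xi> p"
  using pm p unfolding paracontact_metric_def almost_paracontact_def Let_def by auto

lemma T_ops: "v \<in> T p \<Longrightarrow> w \<in> T p \<Longrightarrow> v + w \<in> T p" "v \<in> T p \<Longrightarrow> w \<in> T p \<Longrightarrow> v - w \<in> T p"
    "v \<in> T p \<Longrightarrow> r *\<^sub>R v \<in> T p" "0 \<in> T p"
  by (auto intro: subspace_add[OF subspace_tangent_space] subspace_diff[OF subspace_tangent_space]
      subspace_scale[OF subspace_tangent_space] subspace_0[OF subspace_tangent_space])

context fixes p assumes p: "p \<in> points N"
begin

lemma phi_T: "v \<in> T p \<Longrightarrow> \<phi> p v \<in> T p"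
  using phi_image[OF p] by auto

lemma xi_T: "\<xi> p \<in> T p"
  by (rule vf_tan[OF xi_vf[OF p]])

lemma phi_add: "v \<in> T p \<Longrightarrow> w \<in> T p \<Longrightarrow> \<phi> p (v + w) = \<phi> p v + \<phi> p w"
  and phi_scale: "v \<in> T p \<Longrightarrow> \<phi> p (r *\<^sub>R v) = r *\<^sub>R \<phi> p v"
  and eta_add: "v \<in> T p \<Longrightarrow> w \<in> T p \<Longrightarrow> \<eta> p (v + w) = \<eta> p v + \<eta> p w"
  and eta_scale: "v \<in> T p \<Longrightarrow> \<eta> p (r *\<^sub>R v) = r * \<eta> p v"
  using phi_linear[OF p] eta_linear[OF p] unfolding linear_on_def by auto

lemma phi_diff: "v \<in> T p \<Longrightarrow> w \<in> T p \<Longrightarrow> \<phi> p (v - w) = \<phi> p v - \<phi> p w"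
  using phi_add[of v "-1 *\<^sub>R w"] phi_scale[of w "-1"] T_ops(3)[of w p "-1"] by simp

lemma eta_diff: "v \<in> T p \<Longrightarrow> w \<in> T p \<Longrightarrow> \<eta> p (v - w) = \<eta> p v - \<eta> p w"
  using eta_add[of v "-1 *\<^sub>R w"] eta_scale[of w "-1"] T_ops(3)[of w p "-1"] by simp

lemma phi_zero: "\<phi> p 0 = 0"
  using phi_scale[OF T_ops(4), of 0] by simp

lemma phi_minus: "v \<in> T p \<Longrightarrow> \<phi> p (- v) = - \<phi> p v"
  using phi_scale[of v "-1"] by simp

lemma eta_minus: "v \<in> T p \<Longrightarrow> \<eta> p (- v) = - \<eta> p v"
  using eta_scale[of v "-1"] by simp

text \<open>Twofold application of \<phi> kills \<xi>, and the formula for the square at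
  \<phi>(\<xi>) then makes \<phi>(\<xi>) a multiple of \<xi>. Applying \<phi> again, that multiple
  of \<phi>(\<xi>) is 0.\<close>

lemma phi_xi: "\<phi> p (\<xi> p) = 0"
proof -
  let ?a = "\<eta> p (\<phi> p (\<xi> p))"
  have 1: "\<phi> p (\<phi> p (\<xi> p)) = 0" using phi_sq[OF p xi_T] eta_xi[OF p] by simp
  then have 2: "\<phi> p (\<xi> p) = ?a *\<^sub>R \<xi> p" using phi_sq[OF p phi_T[OF xi_T]] phi_zero by simp
  have "?a *\<^sub>R \<phi> p (\<xi> p) = 0" using phi_scale[OF xi_T, of ?a] 1 2 by simp
  then show ?thesis using 2 by force
qed

lemma eta_phi:
  assumes v: "v \<in> T p" shows "\<eta> p (\<phi> p v) = 0"
proof -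
  have "\<phi> p (\<phi> p (\<phi> p v)) = \<phi> p v"
    using phi_sq[OF p v] phi_diff[OF v T_ops(3)[OF xi_T]] phi_scale[OF xi_T] phi_xi by simp
  then have z: "\<eta> p (\<phi> p v) *\<^sub>R \<xi> p = 0" using phi_sq[OF p phi_T[OF v]] by simp
  have "\<eta> p (\<phi> p v) = \<eta> p (\<eta> p (\<phi> p v) *\<^sub>R \<xi> p)" using eta_scale[OF xi_T] eta_xi[OF p] by simp
  also have "\<dots> = 0" unfolding z using eta_scale[OF T_ops(4), of 0] by simp
  finally show ?thesis .
qed

lemma phi_cube: "v \<in> T p \<Longrightarrow> \<phi> p (\<phi> p (\<phi> p v)) = \<phi> p v"
  using phi_sq[OF p phi_T] eta_phi by simp

lemma G_linear: "v \<in> T p \<Longrightarrow> linear_on (T p) (G p v)"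
  and G_sym: "v \<in> T p \<Longrightarrow> w \<in> T p \<Longrightarrow> G p v w = G p w v"
  and G_smooth: "vf p V \<Longrightarrow> vf p W \<Longrightarrow> smooth_near N p (\<lambda>q. G q (V q) (W q))"
  and G_phi: "v \<in> T p \<Longrightarrow> w \<in> T p \<Longrightarrow> G p (\<phi> p v) (\<phi> p w) = - G p v w + \<eta> p v * \<eta> p w"
  and deta: "vf p V \<Longrightarrow> vf p W \<Longrightarrow> exterior_derivative N \<eta> V W p = G p (V p) (\<phi> p (W p))"
  using pm p unfolding paracontact_metric_def pseudo_riemannian_metric_def by auto

lemma G_add: "u \<in> T p \<Longrightarrow> v \<in> T p \<Longrightarrow> w \<in> T p \<Longrightarrow> G p u (v + w) = G p u v + G p u w"
  and G_scale: "u \<in> T p \<Longrightarrow> v \<in> T p \<Longrightarrow> G p u (r *\<^sub>R v) = r * G p u v"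
  using G_linear[of u] unfolding linear_on_def by auto

lemma G_zero: "u \<in> T p \<Longrightarrow> G p u 0 = 0"
  using G_scale[of u 0 0] T_ops(4) by simp

lemma G_xi: "v \<in> T p \<Longrightarrow> G p v (\<xi> p) = \<eta> p v"
  using G_phi[OF _ xi_T, of v] phi_xi eta_xi[OF p] G_zero[OF phi_T] by simp

lemma eta_phi_derivative:
  assumes V: "vf p V" and w: "w \<in> T p"
  shows "w (\<lambda>q. \<eta> q (app V q)) = 0"
proof -
  have "eventually (\<lambda>q. \<eta> q (app V q) = 0) (nhdf N p)"
    using vf_ev[OF V] ev_points[OF p] by eventually_elim (simp add: app_field_def paracontact.eta_phi[OF paracontact_axioms])
  from tan_local[OF w p this] show ?thesis using tan_const[OF w p] by simp
qed

lemma app_xi: "eventually (\<lambda>q. app \<xi> q = 0) (nhdf N p)"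
  using ev_points[OF p] by eventually_elim (simp add: app_field_def paracontact.phi_xi[OF paracontact_axioms])

lemma app_app:
  assumes V: "vf p V"
  shows "eventually (\<lambda>q. app (app V) q = V q - \<eta> q (V q) *\<^sub>R \<xi> q) (nhdf N p)"
  using vf_ev[OF V] ev_points[OF p] by eventually_elim (simp add: app_field_def phi_sq)

lemma lie_app_xi:
  assumes V: "vf p V" shows "lie V (app \<xi>) p = 0"
  using lie_cong[OF V app_vf[OF p xi_vf[OF p]] _ app_xi, of V] lie_swap[of V "\<lambda>q. 0" p] lie_zero_left[OF V] by simp

lemma lie_T: "vf p V \<Longrightarrow> vf p W \<Longrightarrow> lie V W p \<in> T p"
  by (rule lie_tan)

lemma lie_app_app:
  assumes V: "vf p V" and W: "vf p W"
  shows "lie V (app (app W)) p = lie V W p - \<eta> p (W p) *\<^sub>R lie V \<xi> p - V p (\<lambda>q. \<eta> q (W q)) *\<^sub>R \<xi> p"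
proof -
  note f = eta_smooth[OF p W] and x = xi_vf[OF p]
  let ?f = "\<lambda>q. - 1 * \<eta> q (W q)"
  have f': "smooth_near N p ?f" by (rule smooth_cmult[OF f])
  have "lie V (app (app W)) p = lie V (\<lambda>q. W q + ?f q *\<^sub>R \<xi> q) p"
    by (rule lie_cong[OF V app_vf[OF p app_vf[OF p W]]]) (use app_app[OF W] in \<open>auto elim: eventually_mono\<close>)
  also have "\<dots> = lie V W p + lie V (\<lambda>q. ?f q *\<^sub>R \<xi> q) p" by (rule lie_add_right[OF V W vf_scale[OF x f']])
  also have "lie V (\<lambda>q. ?f q *\<^sub>R \<xi> q) p = ?f p *\<^sub>R lie V \<xi> p + V p ?f *\<^sub>R \<xi> p" by (rule lie_scale_right[OF V x f'])
  also have "V p ?f = - 1 * V p (\<lambda>q. \<eta> q (W q))" by (rule tan_cmult[OF vf_tan[OF V] f])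
  finally show ?thesis unfolding add.assoc[symmetric] add_neg_scaleR2 .
qed

text \<open>This is L_\<xi> \<eta> = 0: d\<eta>(\<xi>, V) equals G(\<xi>, \<phi> V) = \<eta>(\<phi>
  V) = 0, and \<eta>(\<xi>) is constant.\<close>

lemma eta_lie:
  assumes V: "vf p V"
  shows "\<eta> p (lie \<xi> V p) = \<xi> p (\<lambda>q. \<eta> q (V q))"
proof -
  note x = xi_vf[OF p]
  have "exterior_derivative N \<eta> \<xi> V p = 0"
    using deta[OF x V] G_sym[OF xi_T phi_T[OF vf_tan[OF V]]] G_xi[OF phi_T[OF vf_tan[OF V]]] eta_phi[OF vf_tan[OF V]] by simp
  moreover have "eventually (\<lambda>q. \<eta> q (\<xi> q) = 1) (nhdf N p)"
    using ev_points[OF p] by eventually_elim (rule eta_xi)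
  from tan_local[OF vf_tan[OF V] p this] have "V p (\<lambda>q. \<eta> q (\<xi> q)) = 0" using tan_const[OF vf_tan[OF V] p] by simp
  ultimately show ?thesis by (simp add: exterior_derivative_def)
qed

definition tors :: "('p \<Rightarrow> 'p tvec) \<Rightarrow> ('p \<Rightarrow> 'p tvec) \<Rightarrow> 'p tvec" where
  "tors V W = nijenhuis N \<phi> V W p - (2 * exterior_derivative N \<eta> V W p) *\<^sub>R \<xi> p"

text \<open>\<open>tors V \<xi> = \<phi> ((L\<^sub>\<xi> \<phi>) V)\<close>, and \<open>(L\<^sub>\<xi> \<phi>) V\<close> is annihilated by \<open>\<eta>\<close>.\<close>

lemma lie_xi_app_of_tors:
  assumes V: "vf p V" and t: "tors V \<xi> = 0"
  shows "lie \<xi> (app V) p = \<phi> p (lie \<xi> V p)"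
proof -
  note x = xi_vf[OF p] and aV = app_vf[OF p V]
  note t1 = lie_T[OF V x] and t2 = lie_T[OF aV x] and t3 = lie_T[OF x aV]
  have "exterior_derivative N \<eta> V \<xi> p = 0" using deta[OF V x] phi_xi G_zero[OF vf_tan[OF V]] by simp
  then have n: "\<phi> p (\<phi> p (lie V \<xi> p)) - \<phi> p (lie (app V) \<xi> p) = 0"
    using t lie_app_xi[OF V] lie_app_xi[OF aV] phi_zero by (simp add: tors_def nijenhuis_def)
  define A where "A = \<phi> p (lie V \<xi> p) - lie (app V) \<xi> p"
  have A: "A \<in> T p" unfolding A_def by (intro T_ops phi_T t1 t2)
  have "\<phi> p A = 0" using n phi_diff[OF phi_T[OF t1] t2] by (simp add: A_def)
  then have "A = \<eta> p A *\<^sub>R \<xi> p" using phi_sq[OF p A] phi_zero by simp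
  moreover have "\<eta> p A = 0"
    using eta_diff[OF phi_T[OF t1] t2] eta_phi[OF t1] lie_swap[of "app V" \<xi> p] eta_minus[OF t3] eta_lie[OF aV]
      eta_phi_derivative[OF V xi_T] by (simp add: A_def)
  ultimately have "A = 0" by simp
  then show ?thesis using lie_swap[of V \<xi> p] lie_swap[of "app V" \<xi> p] phi_minus[OF lie_T[OF x V]] by (simp add: A_def)
qed

text \<open>The square of \<phi> is built from \<eta> and \<xi>, whose Lie derivatives along \<xi>
  vanish. So if L_\<xi> \<phi> vanishes on V, it vanishes on \<phi> V.\<close>

lemma lie_xi_app_app:
  assumes V: "vf p V" and L: "lie \<xi> (app V) p = \<phi> p (lie \<xi> V p)"
  shows "lie \<xi> (app (app V)) p = \<phi> p (lie \<xi> (app V) p)"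
  using lie_app_app[OF xi_vf[OF p] V] phi_sq[OF p lie_T[OF xi_vf[OF p] V]] eta_lie[OF V] lie_swap[of \<xi> \<xi> p] L
  by (simp add: eq_neg_iff_add_eq_0 flip: scaleR_2)

text \<open>Applying \<phi> to the torsion equation for (V, W) removes its \<xi>-term and yields
  \<open>eq2\<close>. Inserted into the torsion at (V, \<phi> W), this leaves a multiple of \<xi>.
  That multiple is -2 d\<eta>(\<phi> V, W) = 2 d\<eta>(V, \<phi> W), because G(\<phi> V, \<phi> W) =
  -G(V, \<phi>(\<phi> W)).\<close>

lemma tors_shift:
  assumes V: "vf p V" and W: "vf p W" and L: "lie \<xi> (app V) p = \<phi> p (lie \<xi> V p)" and t: "tors V W = 0"
  shows "tors V (app W) = 0"
proof -
  note x = xi_vf[OF p] and aV = app_vf[OF p V] and aW = app_vf[OF p W]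
  define a where "a = lie V W p"
  define b where "b = lie (app V) (app W) p"
  define c where "c = lie (app V) W p"
  define e where "e = lie V (app W) p"
  define f where "f = \<eta> p (W p)"
  note Ts = lie_T[OF V W, folded a_def] lie_T[OF aV aW, folded b_def] lie_T[OF aV W, folded c_def] lie_T[OF V aW, folded e_def]
  have L': "lie (app V) \<xi> p = \<phi> p (lie V \<xi> p)"
    using L lie_swap[of "app V" \<xi> p] lie_swap[of V \<xi> p] phi_minus[OF lie_T[OF x V]] by simp
  define r where "r = 2 * exterior_derivative N \<eta> V W p"
  have eq: "\<phi> p (\<phi> p a) + b - \<phi> p c - \<phi> p e = r *\<^sub>R \<xi> p"
    using t by (simp add: tors_def nijenhuis_def a_def b_def c_def e_def r_def)
  have "\<phi> p (\<phi> p (\<phi> p a) + b - \<phi> p c - \<phi> p e) = 0"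
    unfolding eq using phi_scale[OF xi_T] phi_xi by simp
  then have eq2: "\<phi> p b = \<phi> p (\<phi> p c) + \<phi> p (\<phi> p e) - \<phi> p a"
    by (simp add: phi_add phi_diff phi_T Ts T_ops phi_cube algebra_simps)
  have W2: "lie (app V) (app (app W)) p = c - f *\<^sub>R \<phi> p (lie V \<xi> p) - app V p (\<lambda>q. \<eta> q (W q)) *\<^sub>R \<xi> p"
    unfolding lie_app_app[OF aV W] L' c_def f_def ..
  have "\<phi> p (lie V (app (app W)) p) = \<phi> p a - f *\<^sub>R \<phi> p (lie V \<xi> p)"
    unfolding lie_app_app[OF V W] using lie_T[OF V x] xi_T
    by (simp add: phi_diff phi_scale T_ops Ts phi_xi flip: a_def f_def)
  then have nij: "nijenhuis N \<phi> V (app W) p = (\<eta> p c - app V p (\<lambda>q. \<eta> q (W q))) *\<^sub>R \<xi> p"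
    unfolding nijenhuis_def W2 b_def[symmetric] e_def[symmetric] eq2
    by (simp add: phi_sq[OF p Ts(3)] algebra_simps)
  have "2 * exterior_derivative N \<eta> (app V) W p = app V p (\<lambda>q. \<eta> q (W q)) - \<eta> p c"
    using eta_phi_derivative[OF V vf_tan[OF W]] by (simp add: exterior_derivative_def c_def)
  then have "\<eta> p c - app V p (\<lambda>q. \<eta> q (W q)) = - 2 * G p (\<phi> p (V p)) (\<phi> p (W p))"
    using deta[OF aV W] by (simp add: app_field_def)
  moreover have "exterior_derivative N \<eta> V (app W) p = - G p (\<phi> p (V p)) (\<phi> p (W p))"
  proof -
    note v = vf_tan[OF V] and w = vf_tan[OF W]
    have "G p (V p) (\<phi> p (\<phi> p (W p))) = G p (V p) (W p + (- \<eta> p (W p)) *\<^sub>R \<xi> p)" using phi_sq[OF p w] by simp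
    also have "\<dots> = G p (V p) (W p) - \<eta> p (W p) * \<eta> p (V p)"
      by (simp only: G_add[OF v w T_ops(3)[OF xi_T]] G_scale[OF v xi_T] G_xi[OF v])
    finally show ?thesis using deta[OF V aW] G_phi[OF v w] by (simp add: app_field_def)
  qed
  ultimately show ?thesis using nij by (simp add: tors_def)
qed

section \<open>The torsion as a skew tensor\<close>

lemma tors_swap:
  assumes V: "vf p V" and W: "vf p W" shows "tors V W = - tors W V"
proof -
  note aV = app_vf[OF p V] and aW = app_vf[OF p W]
  have "exterior_derivative N \<eta> V W p = - exterior_derivative N \<eta> W V p"
    using lie_swap[of V W p] eta_minus[OF lie_T[OF W V]] by (simp add: exterior_derivative_def field_simps)
  then show ?thesis
    unfolding tors_def nijenhuis_def lie_swap[of V W p] lie_swap[of "app V" "app W" p] lie_swap[of "app V" W p] lie_swap[of V "app W" p]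
    by (simp add: phi_minus phi_T lie_T V W aV aW algebra_simps)
qed

lemma app_scale:
  assumes V: "vf p V" shows "eventually (\<lambda>q. app (\<lambda>q. f q *\<^sub>R V q) q = f q *\<^sub>R app V q) (nhdf N p)"
  using vf_ev[OF V] ev_points[OF p] by eventually_elim (simp add: app_field_def paracontact.phi_scale[OF paracontact_axioms])

lemma app_add:
  assumes V: "vf p V" and W: "vf p W" shows "eventually (\<lambda>q. app (\<lambda>q. V q + W q) q = app V q + app W q) (nhdf N p)"
  using vf_ev[OF V] vf_ev[OF W] ev_points[OF p] by eventually_elim (simp add: app_field_def paracontact.phi_add[OF paracontact_axioms])

lemma app_cong:
  assumes "eventually (\<lambda>q. V q = V' q) (nhdf N p)" shows "eventually (\<lambda>q. app V q = app V' q) (nhdf N p)"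
  using assms by eventually_elim (simp add: app_field_def)

lemma tors_cong:
  assumes V: "vf p V" and W: "vf p W" and e: "eventually (\<lambda>q. V q = V' q) (nhdf N p)"
  shows "tors V W = tors V' W"
proof -
  have V': "vf p V'" using V e by (rule vf_cong)
  have r: "eventually (\<lambda>q. X q = X q) (nhdf N p)" for X :: "'p \<Rightarrow> 'p tvec" by simp
  note aV = app_vf[OF p V] and aW = app_vf[OF p W] and ea = app_cong[OF e]
  show ?thesis
    unfolding tors_def nijenhuis_def deta[OF V W] deta[OF V' W] lie_cong[OF V W e r] lie_cong[OF aV W ea r]
      lie_cong[OF aV aW ea r] lie_cong[OF V aW e r] ev_at[OF e p] ..
qed

lemma tors_add:
  assumes V: "vf p V" and V': "vf p V'" and W: "vf p W"
  shows "tors (\<lambda>q. V q + V' q) W = tors V W + tors V' W"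
proof -
  note aV = app_vf[OF p V] and aV' = app_vf[OF p V'] and aW = app_vf[OF p W] and s = vf_add[OF V V']
  have r: "eventually (\<lambda>q. X q = X q) (nhdf N p)" for X :: "'p \<Rightarrow> 'p tvec" by simp
  note l = lie_cong[OF app_vf[OF p s] W app_add[OF V V'] r] lie_cong[OF app_vf[OF p s] aW app_add[OF V V'] r]
  have "G p (V p + V' p) (\<phi> p (W p)) = G p (V p) (\<phi> p (W p)) + G p (V' p) (\<phi> p (W p))"
    using G_sym[OF phi_T[OF vf_tan[OF W]]] G_add[OF phi_T[OF vf_tan[OF W]] vf_tan[OF V] vf_tan[OF V']] vf_tan[OF V] vf_tan[OF V']
      T_ops(1)[OF vf_tan[OF V] vf_tan[OF V']] by simp
  then show ?thesis
    unfolding tors_def nijenhuis_def l deta[OF s W] deta[OF V W] deta[OF V' W] lie_add_left[OF V V' W] lie_add_left[OF V V' aW]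
      lie_add_left[OF aV aV' W] lie_add_left[OF aV aV' aW]
    by (simp add: phi_add phi_T lie_T V V' W aV aV' aW algebra_simps)
qed

text \<open>The derivatives of \<open>f\<close> along \<open>W\<close> come from the brackets of V
  and of \<phi> V with \<open>W\<close>, those along \<phi> W from the other two brackets; within
  each pair they cancel.\<close>

lemma tors_scale:
  assumes V: "vf p V" and W: "vf p W" and f: "smooth_near N p f"
  shows "tors (\<lambda>q. f q *\<^sub>R V q) W = f p *\<^sub>R tors V W"
proof -
  note aV = app_vf[OF p V] and aW = app_vf[OF p W] and s = vf_scale[OF V f]
  have r: "eventually (\<lambda>q. X q = X q) (nhdf N p)" for X :: "'p \<Rightarrow> 'p tvec" by simp
  note l = lie_cong[OF app_vf[OF p s] W app_scale[OF V] r] lie_cong[OF app_vf[OF p s] aW app_scale[OF V] r]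
  have g: "G p (f p *\<^sub>R V p) (\<phi> p (W p)) = f p * G p (V p) (\<phi> p (W p))"
    using G_sym[OF phi_T[OF vf_tan[OF W]]] G_scale[OF phi_T[OF vf_tan[OF W]] vf_tan[OF V]] vf_tan[OF V]
      T_ops(3)[OF vf_tan[OF V]] by simp
  have a: "app V p = \<phi> p (V p)" by (simp add: app_field_def)
  show ?thesis
    unfolding tors_def nijenhuis_def l deta[OF s W] deta[OF V W] g lie_scale_left[OF V W f] lie_scale_left[OF V aW f]
      lie_scale_left[OF aV W f] lie_scale_left[OF aV aW f] a
    by (simp add: phi_diff phi_scale phi_T T_ops lie_T vf_tan V W aV aW algebra_simps)
qed

lemma tors_sum_zero:
  assumes V: "\<And>i. i \<in> I \<Longrightarrow> vf p (V i)" and W: "vf p W" and f: "\<And>i. i \<in> I \<Longrightarrow> smooth_near N p (f i)"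
    and t: "\<And>i. i \<in> I \<Longrightarrow> tors (V i) W = 0"
  shows "tors (\<lambda>q. \<Sum>i\<in>I. f i q *\<^sub>R V i q) W = 0"
proof -
  have z: "tors (\<lambda>q. 0) W = 0" using tors_scale[OF vf_zero[OF p] W smooth_const[OF p], of 0] by simp
  show ?thesis using V f t
  proof (induction I rule: infinite_finite_induct)
    case (insert i I)
    have "tors (\<lambda>q. \<Sum>i\<in>insert i I. f i q *\<^sub>R V i q) W = tors (\<lambda>q. f i q *\<^sub>R V i q + (\<Sum>i\<in>I. f i q *\<^sub>R V i q)) W"
      using insert.hyps by simp
    also have "\<dots> = tors (\<lambda>q. f i q *\<^sub>R V i q) W + tors (\<lambda>q. \<Sum>i\<in>I. f i q *\<^sub>R V i q) W"
      by (rule tors_add[OF vf_scale vf_sum[OF p vf_scale] W]) (use insert.prems in auto)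
    also have "tors (\<lambda>q. f i q *\<^sub>R V i q) W = 0"
      using tors_scale[of "V i" W "f i"] insert.prems[of i] W by (metis insertI1 scaleR_zero_right)
    also have "tors (\<lambda>q. \<Sum>i\<in>I. f i q *\<^sub>R V i q) W = 0"
      by (rule insert.IH) (use insert.prems in auto)
    finally show ?case by (simp only: add_0_left)
  qed (use z in simp_all)
qed

text \<open>It suffices to test the torsion on half of a frame \<open>H i\<close>, \<open>\<phi> (H i)\<close>: the Lie derivative of \<open>\<phi>\<close>
  vanishes because \<open>\<xi>\<close> is a combination of the \<open>H i\<close>, and then \<open>tors_shift\<close> produces the rest.\<close>

lemma tors_zero_of_frame:
  assumes H: "\<And>i. i \<in> I \<Longrightarrow> vf p (H i)" and HH: "\<And>i j. i \<in> I \<Longrightarrow> j \<in> I \<Longrightarrow> tors (H i) (H j) = 0"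
    and c: "\<And>i. i \<in> I \<Longrightarrow> smooth_near N p (c i)" "eventually (\<lambda>q. (\<Sum>i\<in>I. c i q *\<^sub>R H i q) = \<xi> q) (nhdf N p)"
    and fr: "\<And>W. vf p W \<Longrightarrow> \<exists>F K. (\<forall>i\<in>I. smooth_near N p (F i) \<and> smooth_near N p (K i)) \<and>
       eventually (\<lambda>q. (\<Sum>i\<in>I. F i q *\<^sub>R H i q) + (\<Sum>i\<in>I. K i q *\<^sub>R app (H i) q) = W q) (nhdf N p)"
    and V: "vf p V" and W: "vf p W"
  shows "tors V W = 0"
proof -
  note aH = app_vf[OF p H]
  have Hx: "tors (H i) \<xi> = 0" if i: "i \<in> I" for i
  proof -
    have "tors (\<lambda>q. \<Sum>i\<in>I. c i q *\<^sub>R H i q) (H i) = 0" by (rule tors_sum_zero[OF H H[OF i] c(1) HH[OF _ i]])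
    then have "tors \<xi> (H i) = 0" using tors_cong[OF vf_sum[OF p vf_scale[OF H c(1)]] H[OF i] c(2)] by simp
    then show ?thesis using tors_swap[OF H[OF i] xi_vf[OF p]] by simp
  qed
  have L: "lie \<xi> (app (H i)) p = \<phi> p (lie \<xi> (H i) p)" if i: "i \<in> I" for i
    by (rule lie_xi_app_of_tors[OF H[OF i] Hx[OF i]])
  have HA: "tors (H i) (app (H j)) = 0" if "i \<in> I" "j \<in> I" for i j
    by (rule tors_shift[OF H[OF that(1)] H[OF that(2)] L[OF that(1)] HH[OF that]])
  have AH: "tors (app (H i)) (H j) = 0" if "i \<in> I" "j \<in> I" for i j
    using tors_swap[OF aH[OF that(1)] H[OF that(2)]] HA[OF that(2,1)] by simp
  have AA: "tors (app (H i)) (app (H j)) = 0" if "i \<in> I" "j \<in> I" for i j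
    by (rule tors_shift[OF aH[OF that(1)] H[OF that(2)] lie_xi_app_app[OF H[OF that(1)] L[OF that(1)]] AH[OF that]])
  have red: "tors V W = 0" if V: "vf p V" and W: "vf p W" and 1: "\<And>i. i \<in> I \<Longrightarrow> tors (H i) W = 0"
    and 2: "\<And>i. i \<in> I \<Longrightarrow> tors (app (H i)) W = 0" for V W
  proof -
    obtain F K where F: "\<And>i. i \<in> I \<Longrightarrow> smooth_near N p (F i)" and K: "\<And>i. i \<in> I \<Longrightarrow> smooth_near N p (K i)"
      and e: "eventually (\<lambda>q. (\<Sum>i\<in>I. F i q *\<^sub>R H i q) + (\<Sum>i\<in>I. K i q *\<^sub>R app (H i) q) = V q) (nhdf N p)"
      using fr[OF V] by blast
    have s: "vf p (\<lambda>q. \<Sum>i\<in>I. F i q *\<^sub>R H i q)" "vf p (\<lambda>q. \<Sum>i\<in>I. K i q *\<^sub>R app (H i) q)"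
      by (rule vf_sum[OF p vf_scale[OF H F]] vf_sum[OF p vf_scale[OF aH K]]; assumption)+
    have "tors V W = tors (\<lambda>q. (\<Sum>i\<in>I. F i q *\<^sub>R H i q) + (\<Sum>i\<in>I. K i q *\<^sub>R app (H i) q)) W"
      by (rule tors_cong[OF vf_add[OF s] W e, symmetric])
    also have "\<dots> = tors (\<lambda>q. \<Sum>i\<in>I. F i q *\<^sub>R H i q) W + tors (\<lambda>q. \<Sum>i\<in>I. K i q *\<^sub>R app (H i) q) W"
      by (rule tors_add[OF s W])
    also have "tors (\<lambda>q. \<Sum>i\<in>I. F i q *\<^sub>R H i q) W = 0" by (rule tors_sum_zero[OF H W F 1])
    also have "tors (\<lambda>q. \<Sum>i\<in>I. K i q *\<^sub>R app (H i) q) W = 0" by (rule tors_sum_zero[OF aH W K 2])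
    finally show ?thesis by (simp only: add_0_left)
  qed
  have "tors V (H j) = 0" if "j \<in> I" for j
    by (rule red[OF V H[OF that] HH[OF _ that] AH[OF _ that]])
  moreover have "tors V (app (H j)) = 0" if "j \<in> I" for j
    by (rule red[OF V aH[OF that] HA[OF _ that] AA[OF _ that]])
  ultimately have "tors W V = 0"
    using tors_swap[OF V H] tors_swap[OF V aH] by (intro red[OF W V]) auto
  then show ?thesis using tors_swap[OF V W] by simp
qed

lemma lie_neg_right:
  assumes V: "vf p V" and W: "vf p W" and Z: "vf p Z"
  shows "lie V (lie W Z) p = - lie V (lie Z W) p"
proof -
  have "lie V (lie W Z) p = lie V (\<lambda>q. (-1) *\<^sub>R lie Z W q) p"
    using lie_swap[of W Z] by (intro arg_cong[where f = "\<lambda>F. lie V F p"]) auto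
  also have "\<dots> = - lie V (lie Z W) p"
    using lie_scale_right[OF V vf_lie[OF Z W] smooth_const[OF p], of "-1"] tan_const[OF vf_tan[OF V] p, of "-1"] by simp
  finally show ?thesis .
qed

text \<open>Since \<open>L\<^sub>\<xi> \<eta> = 0\<close>, also \<open>L\<^sub>\<xi> (d\<eta>) = 0\<close>; as \<open>d\<eta> = G(\<cdot>, \<phi> \<cdot>)\<close> this makes \<open>L\<^sub>\<xi> G\<close> vanish on the image
  of \<open>\<phi>\<close> once \<open>L\<^sub>\<xi> \<phi> = 0\<close>.\<close>

lemma killing_app:
  assumes V: "vf p V" and W: "vf p W" and L: "lie \<xi> (app W) p = \<phi> p (lie \<xi> W p)"
  shows "lie_derivative_metric N \<xi> G V (app W) p = 0"
proof -
  note x = xi_vf[OF p]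
  note xV = vf_lie[OF x V] and xW = vf_lie[OF x W] and VW = vf_lie[OF V W]
  note sV = eta_smooth[OF p V] and sW = eta_smooth[OF p W] and sVW = eta_smooth[OF p VW]
  have ev_lie: "eventually (\<lambda>q. \<eta> q (lie \<xi> X q) = \<xi> q (\<lambda>r. \<eta> r (X r))) (nhdf N p)" if X: "vf p X" for X
    using vf_near[OF X] ev_points[OF p] by eventually_elim (rule paracontact.eta_lie[OF paracontact_axioms])
  have "eventually (\<lambda>q. G q (V q) (app W q) =
      1/2 * (V q (\<lambda>r. \<eta> r (W r)) - W q (\<lambda>r. \<eta> r (V r)) - \<eta> q (lie V W q))) (nhdf N p)"
    using vf_near[OF V] vf_near[OF W] ev_points[OF p]
  proof eventually_elim
    case (elim q)
    show ?case using paracontact.deta[OF paracontact_axioms elim(3,1,2)] by (simp add: app_field_def exterior_derivative_def)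
  qed
  from tan_local[OF xi_T p this]
  have "\<xi> p (\<lambda>q. G q (V q) (app W q)) =
      1/2 * \<xi> p (\<lambda>q. V q (\<lambda>r. \<eta> r (W r)) - W q (\<lambda>r. \<eta> r (V r)) - \<eta> q (lie V W q))"
    using tan_cmult[OF xi_T smooth_diff[OF smooth_diff[OF vf_smooth[OF V sW] vf_smooth[OF W sV]] sVW], of "1/2"] by simp
  also have "\<xi> p (\<lambda>q. V q (\<lambda>r. \<eta> r (W r)) - W q (\<lambda>r. \<eta> r (V r)) - \<eta> q (lie V W q)) =
      \<xi> p (\<lambda>q. V q (\<lambda>r. \<eta> r (W r))) - \<xi> p (\<lambda>q. W q (\<lambda>r. \<eta> r (V r))) - \<eta> p (lie \<xi> (lie V W) p)"
    unfolding tan_diff[OF xi_T smooth_diff[OF vf_smooth[OF V sW] vf_smooth[OF W sV]] sVW]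
      tan_diff[OF xi_T vf_smooth[OF V sW] vf_smooth[OF W sV]] eta_lie[OF VW] ..
  finally have 1: "\<xi> p (\<lambda>q. G q (V q) (app W q)) = 1/2 * (\<xi> p (\<lambda>q. V q (\<lambda>r. \<eta> r (W r)))
      - \<xi> p (\<lambda>q. W q (\<lambda>r. \<eta> r (V r))) - \<eta> p (lie \<xi> (lie V W) p))" .
  have 2: "G p (lie \<xi> V p) (app W p) = 1/2 * (lie \<xi> V p (\<lambda>q. \<eta> q (W q)) - W p (\<lambda>q. \<xi> q (\<lambda>r. \<eta> r (V r))) - \<eta> p (lie (lie \<xi> V) W p))"
    using deta[OF xV W] tan_local[OF vf_tan[OF W] p ev_lie[OF V]] by (simp add: exterior_derivative_def app_field_def)
  have 3: "G p (V p) (lie \<xi> (app W) p) = 1/2 * (V p (\<lambda>q. \<xi> q (\<lambda>r. \<eta> r (W r))) - lie \<xi> W p (\<lambda>q. \<eta> q (V q)) - \<eta> p (lie V (lie \<xi> W) p))"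
    unfolding L using deta[OF V xW] tan_local[OF vf_tan[OF V] p ev_lie[OF W]] by (simp add: exterior_derivative_def)
  have "lie \<xi> (lie V W) p = lie V (lie \<xi> W) p + lie (lie \<xi> V) W p"
    using jacobi[OF x V W] lie_neg_right[OF V W x] lie_swap[of "lie \<xi> V" W p] by (simp add: algebra_simps)
  then have 4: "\<eta> p (lie \<xi> (lie V W) p) = \<eta> p (lie V (lie \<xi> W) p) + \<eta> p (lie (lie \<xi> V) W p)"
    using eta_add[OF lie_T[OF V xW] lie_T[OF xV W]] by simp
  show ?thesis
    unfolding lie_derivative_metric_def 1 2 3 4 lie_apply[OF sV] lie_apply[OF sW] by (rule lie_deta_cancel)
qed

text \<open>Split W into \<phi>(\<phi> W) and \<eta>(W) \<xi>. The first part is covered by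
  \<open>killing_app\<close>; on the second, G(V, \<xi>) = \<eta>(V) and L_\<xi> \<eta> = 0 make the
  remaining terms cancel.\<close>

lemma killing_of_tors:
  assumes t: "\<And>V W. vf p V \<Longrightarrow> vf p W \<Longrightarrow> tors V W = 0" and V: "vf p V" and W: "vf p W"
  shows "lie_derivative_metric N \<xi> G V W p = 0"
proof -
  note x = xi_vf[OF p] and f = eta_smooth[OF p W] and aW = app_vf[OF p W]
  note aaW = app_vf[OF p aW] and sV = eta_smooth[OF p V]
  let ?f = "\<lambda>q. \<eta> q (W q)"
  note v = vf_tan[OF V] and xv = lie_T[OF x V]
  have k: "lie_derivative_metric N \<xi> G V (app (app W)) p = 0"
    by (rule killing_app[OF V aW lie_xi_app_of_tors[OF aW t[OF aW x]]])
  have Wp: "W p = app (app W) p + ?f p *\<^sub>R \<xi> p" using ev_at[OF app_app[OF W] p] by simp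
  have "eventually (\<lambda>q. G q (V q) (W q) = G q (V q) (app (app W) q) + ?f q * \<eta> q (V q)) (nhdf N p)"
    using app_app[OF W] vf_ev[OF V] vf_ev[OF aaW] ev_points[OF p]
  proof eventually_elim
    case (elim q)
    have "W q = app (app W) q + ?f q *\<^sub>R \<xi> q" using elim(1) by simp
    from arg_cong[OF this, of "G q (V q)"] have "G q (V q) (W q) = G q (V q) (app (app W) q + ?f q *\<^sub>R \<xi> q)" .
    also have "\<dots> = G q (V q) (app (app W) q) + ?f q * \<eta> q (V q)"
      using paracontact.G_add[OF paracontact_axioms elim(4,2,3) T_ops(3)[OF paracontact.xi_T[OF paracontact_axioms elim(4)]]]
        paracontact.G_scale[OF paracontact_axioms elim(4,2) paracontact.xi_T[OF paracontact_axioms elim(4)]]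
        paracontact.G_xi[OF paracontact_axioms elim(4,2)] by simp
    finally show ?case .
  qed
  from tan_local[OF xi_T p this]
  have 1: "\<xi> p (\<lambda>q. G q (V q) (W q)) = \<xi> p (\<lambda>q. G q (V q) (app (app W) q)) + (?f p * \<xi> p (\<lambda>q. \<eta> q (V q)) + \<eta> p (V p) * \<xi> p ?f)"
    unfolding tan_add[OF xi_T G_smooth[OF V aaW] smooth_mult[OF f sV]] tan_mult[OF xi_T f sV] .
  have 2: "G p (lie \<xi> V p) (W p) = G p (lie \<xi> V p) (app (app W) p) + ?f p * \<eta> p (lie \<xi> V p)"
    by (rule arg_cong[OF Wp, of "G p (lie \<xi> V p)", THEN trans])
      (simp only: G_add[OF xv vf_tan[OF aaW] T_ops(3)[OF xi_T]] G_scale[OF xv xi_T] G_xi[OF xv])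
  have l: "lie \<xi> W p = lie \<xi> (app (app W)) p + \<xi> p ?f *\<^sub>R \<xi> p"
    using lie_app_app[OF x W] lie_swap[of \<xi> \<xi> p] by (simp add: eq_neg_iff_add_eq_0 flip: scaleR_2)
  have 3: "G p (V p) (lie \<xi> W p) = G p (V p) (lie \<xi> (app (app W)) p) + \<xi> p ?f * \<eta> p (V p)"
    unfolding l using G_add[OF v lie_T[OF x aaW] T_ops(3)[OF xi_T]] G_scale[OF v xi_T] G_xi[OF v] by simp
  show ?thesis
    using k unfolding lie_derivative_metric_def 1 2 3 eta_lie[OF V] by simp
qed

end

end

section \<open>The $g$-natural structures\<close>

locale g_natural_paracontact = riemannian M g D for M :: "('a, 'e::euclidean_space) space" and g D +
  fixes n :: nat and a b c d \<rho> :: real and \<phi> :: "('a \<times> 'a tvec) endo_field"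
    and \<xi> :: "'a \<times> 'a tvec \<Rightarrow> ('a \<times> 'a tvec) tvec" and \<eta> :: "'a \<times> 'a tvec \<Rightarrow> ('a \<times> 'a tvec) tvec \<Rightarrow> real"
    and G :: "'a \<times> 'a tvec \<Rightarrow> ('a \<times> 'a tvec) tvec \<Rightarrow> ('a \<times> 'a tvec) tvec \<Rightarrow> real"
  assumes dim: "DIM('e) = n + 1" "n \<ge> 1" and a0: "a \<noteq> 0"
    and pmetric: "paracontact_metric (unit_tangent_bundle M g) n \<phi> \<xi> \<eta> G"
    and gnat: "g_natural_metric M g D a b c d G"
    and rho: "\<rho> > 0" "a + c + d = - 4 * (a * (a + c) - b\<^sup>2)" "a + c + d = 1 / \<rho>\<^sup>2"
    and tensors: "\<forall>(x, u) \<in> points (unit_tangent_bundle M g).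
           let H = unit_hlift M g D (x, u); T = tangential_lift M g D a b c d (x, u) in
           \<xi> (x, u) = \<rho> *\<^sub>R H u \<and>
           (\<forall>X\<in>tangent_space M x.
              \<eta> (x, u) (H X) = 1 / \<rho> * g x X u \<and>
              \<eta> (x, u) (T X) = b * \<rho> * g x X u \<and>
              \<phi> (x, u) (H X) = (1 / (2 * \<rho> * (a * (a + c) - b\<^sup>2))) *\<^sub>R
                (- b *\<^sub>R H X + (a + c) *\<^sub>R T X + (b * d / (a + c + d) * g x X u) *\<^sub>R H u) \<and>
              \<phi> (x, u) (T X) = (1 / (2 * \<rho> * (a * (a + c) - b\<^sup>2))) *\<^sub>R
                (- a *\<^sub>R H X + b *\<^sub>R T X + ((a * (a + c + d) - b\<^sup>2) / (a + c + d) * g x X u) *\<^sub>R H u))"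
begin

sublocale P: paracontact "unit_tangent_bundle M g" n \<phi> \<xi> \<eta> G
  by (intro paracontact.intro UT.B.smooth_space_axioms paracontact_axioms.intro pmetric)

context fixes x u assumes p: "(x, u) \<in> points UTM"
begin

lemma xu: "x \<in> points M" "u \<in> tangent_space M x" "g x u u = 1"
  using p by (auto simp: UT_points)

lemma xi_geo: "\<xi> (x, u) = \<rho> *\<^sub>R geo (x, u)"
  using tensors p unfolding Let_def geo_def by fastforce

text \<open>The definition prescribes the metric on vertical lifts of vectors orthogonal to
  \<open>u\<close> only. \<open>V\<close> ignores the component along \<open>u\<close>, so every
  vector may be replaced by its orthogonal projection \<open>orth\<close>.\<close>

lemma G_values:
  assumes X: "X \<in> tangent_space M x" and Y: "Y \<in> tangent_space M x"
  shows G_HH: "G (x, u) (H (x, u) X) (H (x, u) Y) = (a + c) * g x X Y + d * g x X u * g x Y u"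
    and G_HV: "G (x, u) (H (x, u) X) (V (x, u) Y) = b * (g x X Y - g x X u * g x Y u)"
    and G_VV: "G (x, u) (V (x, u) X) (V (x, u) Y) = a * (g x X Y - g x X u * g x Y u)"
proof -
  have gn: "\<And>X X'. X \<in> tangent_space M x \<Longrightarrow> X' \<in> tangent_space M x \<Longrightarrow>
      G (x, u) (H (x, u) X) (H (x, u) X') = (a + c) * g x X X' + d * g x X u * g x X' u"
    "\<And>X Y. X \<in> tangent_space M x \<Longrightarrow> Y \<in> tangent_space M x \<Longrightarrow> g x Y u = 0 \<Longrightarrow>
      G (x, u) (H (x, u) X) (V (x, u) Y) = b * g x X Y"
    "\<And>Y Y'. Y \<in> tangent_space M x \<Longrightarrow> Y' \<in> tangent_space M x \<Longrightarrow> g x Y u = 0 \<Longrightarrow> g x Y' u = 0 \<Longrightarrow>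
      G (x, u) (V (x, u) Y) (V (x, u) Y') = a * g x Y Y'"
    using gnat p unfolding g_natural_metric_def Let_def by fastforce+
  define orth where "orth Y = Y + (- g x Y u) *\<^sub>R u" for Y
  have oT: "orth Y \<in> tangent_space M x" and ou: "g x (orth Y) u = 0" and Vo: "V (x, u) (orth Y) = V (x, u) Y"
    if "Y \<in> tangent_space M x" for Y
  proof -
    note s = T_scale[OF xu(2), of "- g x Y u"]
    show "orth Y \<in> tangent_space M x" unfolding orth_def by (rule T_add[OF that s])
    show "g x (orth Y) u = 0" unfolding orth_def
      using g_add_left[OF xu(1,2) that s] g_scale_left[OF xu(1,2,2), of "- g x Y u"] xu(3) by simp
    show "V (x, u) (orth Y) = V (x, u) Y" unfolding orth_def V_add[OF p that s] V_scale[OF p xu(2)] V_self[OF p] by simp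
  qed
  show "G (x, u) (H (x, u) X) (H (x, u) Y) = (a + c) * g x X Y + d * g x X u * g x Y u" by (rule gn(1)[OF X Y])
  have gXo: "g x X' (orth Y) = g x X' Y - g x X' u * g x Y u" if "X' \<in> tangent_space M x" for X'
    unfolding orth_def using g_add_right[OF xu(1) that Y T_scale[OF xu(2), of "- g x Y u"]]
      g_scale_right[OF xu(1) that xu(2), of "- g x Y u"] by simp
  show "G (x, u) (H (x, u) X) (V (x, u) Y) = b * (g x X Y - g x X u * g x Y u)"
    using gn(2)[OF X oT[OF Y] ou[OF Y]] unfolding Vo[OF Y] gXo[OF X] .
  have "g x (orth X) (orth Y) = g x (orth X) Y" using gXo[OF oT[OF X]] ou[OF X] by simp
  also have "\<dots> = g x X Y - g x X u * g x Y u" unfolding orth_def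
    using g_add_left[OF xu(1) Y X T_scale[OF xu(2), of "- g x X u"]] g_scale_left[OF xu(1) Y xu(2), of "- g x X u"] g_sym[OF xu(1) Y xu(2)]
    by simp
  finally show "G (x, u) (V (x, u) X) (V (x, u) Y) = a * (g x X Y - g x X u * g x Y u)"
    using gn(3)[OF oT[OF X] oT[OF Y] ou[OF X] ou[OF Y]] unfolding Vo[OF Y] Vo[OF X] by simp
qed

section \<open>The Killing equation for the geodesic flow\<close>

lemma killing_geo:
  assumes K: "lie_derivative_metric UTM \<xi> G X Y (x, u) = 0"
    and X: "vector_field_near UTM (x, u) X" and Y: "vector_field_near UTM (x, u) Y"
  shows "lie_derivative_metric UTM geo G X Y (x, u) = 0"
proof -
  note gv = geo_vf[OF p] and sc = UT.B.smooth_const[OF p, of \<rho>]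
  have e: "eventually (\<lambda>q. \<xi> q = \<rho> *\<^sub>R geo q) (nhdf UTM (x, u))"
    using UT.B.ev_points[OF p] by eventually_elim (metis g_natural_paracontact.xi_geo[OF g_natural_paracontact_axioms] prod.collapse)
  have l: "lie_bracket UTM \<xi> Z (x, u) = \<rho> *\<^sub>R lie_bracket UTM geo Z (x, u)" if Z: "vector_field_near UTM (x, u) Z" for Z
    using UT.B.lie_cong[OF P.xi_vf[OF p] Z e, of Z] UT.B.lie_scale_left[OF gv Z sc] UT.B.tan_const[OF UT.B.vf_tan[OF Z] p] by simp
  note tX = UT.B.vf_tan[OF X] and tY = UT.B.vf_tan[OF Y] and lX = UT.B.lie_tan[OF gv X] and lY = UT.B.lie_tan[OF gv Y]
  have "\<rho> * lie_derivative_metric UTM geo G X Y (x, u) = lie_derivative_metric UTM \<xi> G X Y (x, u)"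
    unfolding lie_derivative_metric_def l[OF X] l[OF Y] xi_geo
    using P.G_scale[OF p tX lY, of \<rho>] P.G_scale[OF p tY lX, of \<rho>] P.G_sym[OF p tY lX] P.G_sym[OF p tY P.T_ops(3)[OF lX], of \<rho>]
    by (simp add: algebra_simps)
  then show ?thesis using K rho(1) by simp
qed

lemma lie_geo_par:
  assumes Y: "Y \<in> tangent_space M x" "g x Y u = 0"
  shows "lie_bracket UTM geo (vfield (par x Y)) (x, u) = (- 1) *\<^sub>R H (x, u) Y"
proof -
  note P = par[OF xu(1) Y(1)]
  have "V (x, u) 0 = 0" using V_scale[OF p T_zero, of 0] by simp
  then show ?thesis unfolding lie_geo_vfield[OF p P(1)] P(2) P(3)[OF xu(2)] Y(2) by simp
qed

text \<open>Extending \<open>Y\<close> to be parallel at \<open>x\<close> makes the derivative of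
  the metric term along the geodesic flow vanish. What remains are two equal brackets, each
  contributing the horizontal lift of -Y, paired with the vertical lift of \<open>Y\<close>.\<close>

lemma killing_vertical:
  assumes K: "\<And>X Y. vector_field_near UTM (x, u) X \<Longrightarrow> vector_field_near UTM (x, u) Y \<Longrightarrow>
      lie_derivative_metric UTM \<xi> G X Y (x, u) = 0"
    and Y: "Y \<in> tangent_space M x" "g x Y u = 0"
  shows "b * g x Y Y = 0"
proof -
  define Z where "Z = par x Y"
  note P = par[OF xu(1) Y(1), folded Z_def]
  note v = vfield_vf[OF p P(1)] and gt = UT.B.vf_tan[OF geo_vf[OF p]]
  have geoH: "geo (x, u) = H (x, u) u" by (simp add: geo_def)
  note gs = UT.smooth_base[OF p g_smooth[OF P(1) P(1)]] and ls = UT.smooth_lf[OF p P(1)]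
  have "geo (x, u) (\<lambda>q. g (fst q) (Z (fst q)) (Z (fst q))) = 0"
    unfolding geoH H_base[OF p xu(2) g_smooth[OF P(1) P(1)]] D_metric[OF P(1) P(1) xu(2)] P(3)[OF xu(2)] P(2)
    using g_zero_left[OF xu(1) Y(1)] g_zero_right[OF xu(1) Y(1)] by simp
  moreover have "geo (x, u) (UT.lf Z) = 0"
    unfolding geoH H_lf[OF p xu(2) P(1)] P(3)[OF xu(2)] by (rule g_zero_left[OF xu(1,2)])
  moreover have "eventually (\<lambda>q. G q (vfield Z q) (vfield Z q) =
      a * (g (fst q) (Z (fst q)) (Z (fst q)) - UT.lf Z q * UT.lf Z q)) (nhdf UTM (x, u))"
    using ev_UT[OF p P(1)]
  proof eventually_elim
    case (elim q)
    then show ?case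
      using g_natural_paracontact.G_VV[OF g_natural_paracontact_axioms, of "fst q" "snd q" "Z (fst q)" "Z (fst q)"]
      by (simp add: vfield_def UT.lf_def)
  qed
  from UT.B.tan_local[OF gt p this] have "geo (x, u) (\<lambda>q. G q (vfield Z q) (vfield Z q)) =
      a * (geo (x, u) (\<lambda>q. g (fst q) (Z (fst q)) (Z (fst q))) - (UT.lf Z (x, u) * geo (x, u) (UT.lf Z) + UT.lf Z (x, u) * geo (x, u) (UT.lf Z)))"
    unfolding UT.B.tan_cmult[OF gt UT.B.smooth_diff[OF gs UT.B.smooth_mult[OF ls ls]]]
      UT.B.tan_diff[OF gt gs UT.B.smooth_mult[OF ls ls]] UT.B.tan_mult[OF gt ls ls] .
  ultimately have 0: "geo (x, u) (\<lambda>q. G q (vfield Z q) (vfield Z q)) = 0" by simp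
  note HY = H_tan[OF p Y(1)] and VY = V_tan[OF p Y(1)]
  have vp: "vfield Z (x, u) = V (x, u) Y" by (simp add: vfield_def P(2))
  have "G (x, u) (V (x, u) Y) ((- 1) *\<^sub>R H (x, u) Y) = - b * g x Y Y"
    using P.G_scale[OF p VY HY, of "-1"] P.G_sym[OF p VY HY] G_HV[OF Y(1) Y(1)] Y(2) by simp
  then have "lie_derivative_metric UTM geo G (vfield Z) (vfield Z) (x, u) = 2 * (b * g x Y Y)"
    unfolding lie_derivative_metric_def 0 vp lie_geo_par[OF Y, folded Z_def]
    using P.G_sym[OF p VY P.T_ops(3)[OF HY], of "-1"] by simp
  then show ?thesis using killing_geo[OF K[OF v v] v v] by simp
qed

text \<open>For \<open>b = 0\<close> horizontal and vertical lifts are orthogonal everywhere, so the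
  derivative term is zero. The bracket with the horizontal field gives the curvature term with
  factor \<open>a\<close>, the bracket with the vertical field gives the factor
  \<open>a + c\<close>.\<close>

lemma killing_curvature:
  assumes K: "\<And>X Y. vector_field_near UTM (x, u) X \<Longrightarrow> vector_field_near UTM (x, u) Y \<Longrightarrow>
      lie_derivative_metric UTM \<xi> G X Y (x, u) = 0"
    and b: "b = 0" and Y: "Y \<in> tangent_space M x" "g x Y u = 0"
  shows "Rm x Y u u Y = (a + c) / a * g x Y Y"
proof -
  define Z where "Z = par x Y"
  note P = par[OF xu(1) Y(1), folded Z_def]
  note v = vfield_vf[OF p P(1)] and h = hfield_vf[OF p P(1)] and gt = UT.B.vf_tan[OF geo_vf[OF p]]
  interpret R: curvature_like "tangent_space M x" "Rm x" by (rule Rm_curvature_like[OF xu(1)])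
  have "eventually (\<lambda>q. G q (hfield Z q) (vfield Z q) = 0) (nhdf UTM (x, u))"
    using ev_UT[OF p P(1)]
  proof eventually_elim
    case (elim q)
    then show ?case
      using g_natural_paracontact.G_HV[OF g_natural_paracontact_axioms, of "fst q" "snd q" "Z (fst q)" "Z (fst q)"] b
      by (simp add: vfield_def hfield_def)
  qed
  from UT.B.tan_local[OF gt p this] have 0: "geo (x, u) (\<lambda>q. G q (hfield Z q) (vfield Z q)) = 0"
    using UT.B.tan_const[OF gt p] by simp
  have vp: "vfield Z (x, u) = V (x, u) Y" "hfield Z (x, u) = H (x, u) Y" by (simp_all add: vfield_def hfield_def P(2))
  obtain S C where S: "S \<in> tangent_space M x" and C: "C \<in> tangent_space M x"
    and l: "lie_bracket UTM geo (hfield Z) (x, u) = H (x, u) S - V (x, u) C"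
    and gC: "\<And>w. w \<in> tangent_space M x \<Longrightarrow> g x C w = Rm x u (Z x) u w"
    using lie_geo_hfield[OF p P(1)] by blast
  note HY = H_tan[OF p Y(1)] and VY = V_tan[OF p Y(1)] and HS = H_tan[OF p S] and VC = V_tan[OF p C]
  have "G (x, u) (V (x, u) Y) (H (x, u) S + (- 1) *\<^sub>R V (x, u) C) = - a * g x C Y"
    using P.G_add[OF p VY HS P.T_ops(3)[OF VC], of "-1"] P.G_scale[OF p VY VC, of "-1"] P.G_sym[OF p VY HS]
      G_HV[OF S Y(1)] G_VV[OF Y(1) C] b Y(2) g_sym[OF xu(1) C Y(1)] by simp
  then have 1: "G (x, u) (H (x, u) S - V (x, u) C) (V (x, u) Y) = - a * g x C Y"
    using P.G_sym[OF p VY P.T_ops(2)[OF HS VC]] by simp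
  have 2: "G (x, u) (H (x, u) Y) ((- 1) *\<^sub>R H (x, u) Y) = - ((a + c) * g x Y Y)"
    using P.G_scale[OF p HY HY, of "-1"] G_HH[OF Y(1) Y(1)] Y(2) by simp
  have "lie_derivative_metric UTM geo G (hfield Z) (vfield Z) (x, u) = a * g x C Y + (a + c) * g x Y Y"
    unfolding lie_derivative_metric_def 0 vp l lie_geo_par[OF Y, folded Z_def] 1 2 by simp
  then have "a * g x C Y + (a + c) * g x Y Y = 0" using killing_geo[OF K[OF h v] h v] by simp
  moreover have "g x C Y = - Rm x Y u u Y"
    using gC[OF Y(1)] P(2) R.skew1[OF xu(2) Y(1) xu(2) Y(1)] by simp
  ultimately show ?thesis using a0 by (simp add: field_simps)
qed

end

text \<open>The assumption \<open>n \<ge> 1\<close> enters here through two distinct basis vectors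
  \<open>i\<close> and \<open>j\<close>. Orthonormalising along \<open>i\<close> leaves the j-th
  coordinate of \<open>Y\<close> equal to 1, so \<open>Y\<close> is nonzero; this turns the vertical
  Killing equation into \<open>b = 0\<close>.\<close>

lemma orthogonal_vector:
  obtains x u Y where "(x, u) \<in> points UTM" "Y \<in> tangent_space M x" "g x Y u = 0" "Y \<noteq> 0"
proof -
  have "points M \<noteq> {}" using mfd by (simp add: smooth_manifold_def)
  then obtain x where x: "x \<in> points M" by auto
  obtain U \<psi> where U: "(U, \<psi>) \<in> charts M" "x \<in> U" using chart_at[OF x] .
  obtain i where i: "i \<in> (Basis :: 'e set)" using nonempty_Basis by (metis ex_in_conv)
  have "card (Basis - {i} :: 'e set) > 0" using dim i by (simp add: card_Diff_singleton)
  then have "Basis - {i} \<noteq> ({} :: 'e set)" by (metis card.empty less_irrefl)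
  then obtain j where j: "j \<in> (Basis :: 'e set)" "j \<noteq> i" by auto
  let ?c = "\<lambda>i. cfield U \<psi> i x"
  note cx = cfield_tan[OF U]
  have ii: "?c i (\<lambda>r. \<psi> r \<bullet> i) = 1" "?c i (\<lambda>r. \<psi> r \<bullet> j) = 0" "?c j (\<lambda>r. \<psi> r \<bullet> j) = 1"
    using i j by (simp_all add: cfield_coordinate[OF U] inner_Basis)
  then have "?c i \<noteq> 0" by auto
  then have pos: "g x (?c i) (?c i) > 0" by (rule g_pos[OF x cx])
  define s where "s = sqrt (g x (?c i) (?c i))"
  have s: "s > 0" "s * s = g x (?c i) (?c i)" using pos by (auto simp: s_def)
  define u where "u = (1 / s) *\<^sub>R ?c i"
  have u: "u \<in> tangent_space M x" unfolding u_def by (rule T_scale[OF cx])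
  have u1: "g x u u = 1" using s pos by (simp add: u_def g_scale_left g_scale_right x cx T_scale)
  define Y where "Y = ?c j - g x (?c j) u *\<^sub>R u"
  have Y: "Y \<in> tangent_space M x" unfolding Y_def by (intro T_diff T_scale u cx)
  have "g x Y u = 0" using u1 by (simp add: Y_def g_diff_left g_scale_left x u cx T_scale)
  moreover have "Y (\<lambda>r. \<psi> r \<bullet> j) = 1" by (simp add: Y_def u_def ii)
  then have "Y \<noteq> 0" by auto
  ultimately show ?thesis using that[of x u Y] Y x u u1 by (simp add: UT_points)
qed

lemma killing_imp_constant_curvature:
  assumes K: "killing_field UTM G \<xi>"
  shows "b = 0 \<and> constant_sectional_curvature M g D ((a + c) / a) \<and> (a + c) / a < 0"
proof -
  have K': "lie_derivative_metric UTM \<xi> G X Y (x, u) = 0"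
    if "(x, u) \<in> points UTM" "vector_field_near UTM (x, u) X" "vector_field_near UTM (x, u) Y" for x u X Y
    using K that unfolding killing_field_def by blast
  obtain x u Y where o: "(x, u) \<in> points UTM" "Y \<in> tangent_space M x" "g x Y u = 0" "Y \<noteq> 0"
    by (rule orthogonal_vector)
  have "b * g x Y Y = 0" by (rule killing_vertical[OF o(1) K'[OF o(1)] o(2,3)])
  then have b: "b = 0" using g_pos[OF _ o(2,4)] UT.B_points[OF o(1)] by simp
  have "constant_sectional_curvature M g D ((a + c) / a)"
  proof (rule constant_sectional_curvatureI)
    fix x u Y assume "x \<in> points M" "u \<in> tangent_space M x" "g x u u = 1" and Y: "Y \<in> tangent_space M x" "g x Y u = 0"
    then have p: "(x, u) \<in> points UTM" by (simp add: UT_points)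
    show "Rm x Y u u Y = (a + c) / a * g x Y Y" by (rule killing_curvature[OF p K'[OF p] b Y])
  qed
  moreover have "(a + c) / a < 0"
  proof -
    have "1 / \<rho>\<^sup>2 > 0" using rho(1) by simp
    moreover have "1 / \<rho>\<^sup>2 = - 4 * (a * (a + c))" using rho(2,3) b by simp
    ultimately have "a * (a + c) < 0" by linarith
    then show ?thesis by (auto simp: mult_less_0_iff divide_less_0_iff)
  qed
  ultimately show ?thesis using b by simp
qed

text \<open>The four terms of the Nijenhuis torsion on two horizontal lifts: \<open>ha\<close>,
  \<open>hb\<close> are lifts of covariant derivatives, \<open>vx\<close>, \<open>vy\<close> the
  vertical lifts, \<open>h\<close> the lift of \<open>u\<close>. The horizontal terms cancel because
  [X, Y] is the difference of the covariant derivatives, the vertical ones by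
  \<open>K = - \<kappa>\<close>.\<close>

lemma curvature_cancel:
  fixes hb ha vx vy h :: "'v::real_vector"
  assumes "K = - \<kappa>"
  shows "hb - ha - \<kappa> *\<^sub>R (gy *\<^sub>R vx - gx *\<^sub>R vy) - (gB - gA) *\<^sub>R h + K *\<^sub>R (gx *\<^sub>R vy - gy *\<^sub>R vx)
    + (ha - gA *\<^sub>R h) - (hb - gB *\<^sub>R h) = 0"
  unfolding assms by (simp add: algebra_simps)

section \<open>The case b = 0: constant curvature makes the torsion vanish\<close>

context
  assumes b: "b = 0"
begin

text \<open>For \<open>b = 0\<close> the constant alpha is a (a + c), and \<phi> maps X^h to
  \<open>k1\<close> times X^v and, for Y orthogonal to u, Y^v to \<open>k2\<close> times Y^h.
  Accordingly \<open>k1 * k2 = 1\<close>, while \<open>k1 * k1\<close> is minus the curvature in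
  question.\<close>

definition "k1 = 1 / (2 * \<rho> * a)"
definition "k2 = - 1 / (2 * \<rho> * (a + c))"

lemma constants: "k1 * k1 = - ((a + c) / a)" "k1 * k2 = 1" "k1 \<noteq> 0" "a + c \<noteq> 0" "a + c + d \<noteq> 0"
proof -
  have 1: "1 / \<rho>\<^sup>2 = - 4 * (a * (a + c))" using rho(2,3) b by simp
  have r: "\<rho> \<noteq> 0" using rho(1) by simp
  show ac: "a + c \<noteq> 0" using 1 r by auto
  show "a + c + d \<noteq> 0" using rho(3) r by simp
  show "k1 \<noteq> 0" using r a0 by (simp add: k1_def)
  have "k1 * k1 = 1 / \<rho>\<^sup>2 / (4 * a * a)" by (simp add: k1_def power2_eq_square)
  also have "\<dots> = - ((a + c) / a)" unfolding 1 using a0 by (simp add: field_simps)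
  finally show "k1 * k1 = - ((a + c) / a)" .
  have "k1 * k2 = - (1 / \<rho>\<^sup>2) / (4 * (a * (a + c)))" by (simp add: k1_def k2_def power2_eq_square)
  also have "\<dots> = 1" unfolding 1 using a0 ac by simp
  finally show "k1 * k2 = 1" .
qed

context fixes x u assumes p: "(x, u) \<in> points UTM"
begin

lemma tangential_lift_V: "tangential_lift M g D a b c d (x, u) X = V (x, u) X"
proof
  fix f
  show "tangential_lift M g D a b c d (x, u) X f = V (x, u) X f"
    using fun_cong[OF V_self[OF p], of f] b
    by (auto simp: tangential_lift_def unit_vlift_def to_unit_apply)
qed

lemma tensor_values:
  assumes X: "X \<in> tangent_space M x"
  shows phi_H: "\<phi> (x, u) (H (x, u) X) = k1 *\<^sub>R V (x, u) X"
    and phi_V: "\<phi> (x, u) (V (x, u) X) = k2 *\<^sub>R (H (x, u) X - g x X u *\<^sub>R H (x, u) u)"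
    and eta_H: "\<eta> (x, u) (H (x, u) X) = 1 / \<rho> * g x X u" and eta_V: "\<eta> (x, u) (V (x, u) X) = 0"
proof -
  have t: "\<eta> (x, u) (H (x, u) X) = 1 / \<rho> * g x X u" "\<eta> (x, u) (V (x, u) X) = b * \<rho> * g x X u"
    "\<phi> (x, u) (H (x, u) X) = (1 / (2 * \<rho> * (a * (a + c) - b\<^sup>2))) *\<^sub>R
       (- b *\<^sub>R H (x, u) X + (a + c) *\<^sub>R V (x, u) X + (b * d / (a + c + d) * g x X u) *\<^sub>R H (x, u) u)"
    "\<phi> (x, u) (V (x, u) X) = (1 / (2 * \<rho> * (a * (a + c) - b\<^sup>2))) *\<^sub>R
       (- a *\<^sub>R H (x, u) X + b *\<^sub>R V (x, u) X + ((a * (a + c + d) - b\<^sup>2) / (a + c + d) * g x X u) *\<^sub>R H (x, u) u)"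
    using tensors[rule_format, OF p] X unfolding Let_def prod.case tangential_lift_V by blast+
  show "\<eta> (x, u) (H (x, u) X) = 1 / \<rho> * g x X u" by (rule t(1))
  show "\<eta> (x, u) (V (x, u) X) = 0" using t(2) b by simp
  have gen: "1 / (2 * r * (a * s)) * s = 1 / (2 * r * a)" "1 / (2 * r * (a * s)) * (- a) = - 1 / (2 * r * s)"
    if "s \<noteq> 0" "r \<noteq> 0" for r s
    using a0 that by (simp_all add: field_simps)
  have k: "1 / (2 * \<rho> * (a * (a + c) - b\<^sup>2)) * (a + c) = k1" "1 / (2 * \<rho> * (a * (a + c) - b\<^sup>2)) * (- a) = k2"
    "(a * (a + c + d) - b\<^sup>2) / (a + c + d) = a"
    using b constants(4,5) rho(1) gen[of "a + c" \<rho>] by (simp_all add: k1_def k2_def)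
  show "\<phi> (x, u) (H (x, u) X) = k1 *\<^sub>R V (x, u) X"
    unfolding t(3) k(1)[symmetric] using b by simp
  have "- a *\<^sub>R H (x, u) X + b *\<^sub>R V (x, u) X + (a * g x X u) *\<^sub>R H (x, u) u =
      (- a) *\<^sub>R (H (x, u) X - g x X u *\<^sub>R H (x, u) u)"
    using b by (simp add: algebra_simps)
  then show "\<phi> (x, u) (V (x, u) X) = k2 *\<^sub>R (H (x, u) X - g x X u *\<^sub>R H (x, u) u)"
    unfolding t(4) k(3) k(2)[symmetric] by (simp only: scaleR_scaleR)
qed

lemma app_hfield:
  assumes X: "vector_field_near M x X"
  shows "eventually (\<lambda>q. P.app (hfield X) q = k1 *\<^sub>R vfield X q) (nhdf UTM (x, u))"
  using ev_UT[OF p X]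
proof eventually_elim
  case (elim q)
  then show ?case
    using g_natural_paracontact.phi_H[OF g_natural_paracontact_axioms b, of "fst q" "snd q" "X (fst q)"]
    by (simp add: app_field_def hfield_def vfield_def)
qed

text \<open>Constant curvature expresses R(X,Y)u by \<open>X\<close>, \<open>Y\<close> and their
  products with \<open>u\<close>, the same combination as in the bracket of vertical lifts, which
  enters with factor \<open>k1 * k1\<close>. The term with d\<eta> is zero because \<phi> Y^h is
  vertical, hence orthogonal to X^h.\<close>

lemma tors_hfield:
  assumes K: "constant_sectional_curvature M g D ((a + c) / a)"
    and X: "vector_field_near M x X" and Y: "vector_field_near M x Y"
  shows "P.tors (x, u) (hfield X) (hfield Y) = 0"
proof -
  note xu = xu[OF p]
  note tX = vf_tan[OF X] and tY = vf_tan[OF Y]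
  note hX = hfield_vf[OF p X] and hY = hfield_vf[OF p Y] and vX = vfield_vf[OF p X] and vY = vfield_vf[OF p Y]
  note sc = UT.B.smooth_const[OF p, of k1]
  obtain W where W: "vector_field_near M x W" "W x = u" using extension[OF xu(1,2)] .
  define L where "L = lie_bracket M X Y x"
  define A where "A = D x (Y x) X"
  define B where "B = D x (X x) Y"
  define C where "C = curvature M D X Y W x"
  have L: "L \<in> tangent_space M x" unfolding L_def by (rule lie_tan[OF X Y])
  have A: "A \<in> tangent_space M x" unfolding A_def by (rule D_tan[OF X tY])
  have B: "B \<in> tangent_space M x" unfolding B_def by (rule D_tan[OF Y tX])
  have C: "C \<in> tangent_space M x" unfolding C_def by (rule curvature_vf_tan[OF X Y W(1)])
  have LBA: "L = B - A" using D_torsion[OF X Y] by (simp add: L_def A_def B_def)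
  have CXY: "C = ((a + c) / a * g x (Y x) u) *\<^sub>R X x - ((a + c) / a * g x (X x) u) *\<^sub>R Y x"
  proof (rule g_eqI[OF xu(1) C])
    show "((a + c) / a * g x (Y x) u) *\<^sub>R X x - ((a + c) / a * g x (X x) u) *\<^sub>R Y x \<in> tangent_space M x"
      by (intro T_diff T_scale tX tY)
    fix w assume w: "w \<in> tangent_space M x"
    show "g x C w = g x (((a + c) / a * g x (Y x) u) *\<^sub>R X x - ((a + c) / a * g x (X x) u) *\<^sub>R Y x) w"
      using Rm_eq[OF X Y W(1) w] Rm_constant_curvature[OF K xu(1) tX tY xu(2) w]
      by (simp add: C_def W(2) g_diff_left[OF xu(1) w T_scale[OF tX] T_scale[OF tY]] g_scale_left[OF xu(1) w] tX tY right_diff_distrib)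
  qed
  have VC: "V (x, u) C = ((a + c) / a) *\<^sub>R (g x (Y x) u *\<^sub>R V (x, u) (X x) - g x (X x) u *\<^sub>R V (x, u) (Y x))"
    unfolding CXY using V_add[OF p T_scale[OF tX] T_scale[OF tY], of "(a + c) / a * g x (Y x) u" "- ((a + c) / a * g x (X x) u)"]
      V_scale[OF p tX] V_scale[OF p tY, of "- ((a + c) / a * g x (X x) u)"] by (simp add: scaleR_diff_right)
  have HL: "H (x, u) L = H (x, u) B - H (x, u) A"
    unfolding LBA using H_add[of "(x, u)" B "(-1) *\<^sub>R A"] H_scale[of "(x, u)" "-1" A] by simp
  have gL: "g x L u = g x B u - g x A u" unfolding LBA by (rule g_diff_left[OF xu(1,2) B A])
  have r: "eventually (\<lambda>q. Z q = Z q) (nhdf UTM (x, u))" for Z :: "'a \<times> 'a tvec \<Rightarrow> ('a \<times> 'a tvec) tvec" by simp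
  have sl: "lie_bracket UTM (\<lambda>q. k1 *\<^sub>R Z q) Z' (x, u) = k1 *\<^sub>R lie_bracket UTM Z Z' (x, u)"
    and sr: "lie_bracket UTM Z (\<lambda>q. k1 *\<^sub>R Z' q) (x, u) = k1 *\<^sub>R lie_bracket UTM Z Z' (x, u)"
    if "vector_field_near UTM (x, u) Z" "vector_field_near UTM (x, u) Z'" for Z Z'
    using UT.B.lie_scale_left[OF that sc] UT.B.lie_scale_right[OF that sc] UT.B.tan_const[OF UT.B.vf_tan[OF that(1)] p]
      UT.B.tan_const[OF UT.B.vf_tan[OF that(2)] p] by simp_all
  note aX = P.app_vf[OF p hX] and aY = P.app_vf[OF p hY] and eX = app_hfield[OF X] and eY = app_hfield[OF Y]
  have L1: "lie_bracket UTM (hfield X) (hfield Y) (x, u) = H (x, u) L - V (x, u) C"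
    unfolding L_def C_def by (rule lie_hfield_hfield[OF p X Y W])
  have L2: "lie_bracket UTM (P.app (hfield X)) (P.app (hfield Y)) (x, u) =
      (k1 * k1) *\<^sub>R (g x (X x) u *\<^sub>R V (x, u) (Y x) - g x (Y x) u *\<^sub>R V (x, u) (X x))"
    unfolding UT.B.lie_cong[OF aX aY eX eY] sl[OF vX UT.B.vf_scale[OF vY sc]] sr[OF vX vY] lie_vfield_vfield[OF p X Y]
    by (rule scaleR_scaleR)
  have L3: "lie_bracket UTM (P.app (hfield X)) (hfield Y) (x, u) = (- k1) *\<^sub>R V (x, u) A"
    unfolding UT.B.lie_cong[OF aX hY eX r] sl[OF vX hY] UT.B.lie_swap[of "vfield X" "hfield Y" "(x, u)"] lie_hfield_vfield[OF p Y X] A_def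
    by simp
  have L4: "lie_bracket UTM (hfield X) (P.app (hfield Y)) (x, u) = k1 *\<^sub>R V (x, u) B"
    unfolding UT.B.lie_cong[OF hX aY r eY] sr[OF hX vY] lie_hfield_vfield[OF p X Y] B_def ..
  note HLt = H_tan[OF p L] and VCt = V_tan[OF p C]
  have "\<phi> (x, u) (\<phi> (x, u) (H (x, u) L - V (x, u) C)) =
      H (x, u) L - V (x, u) C - (1 / \<rho> * g x L u) *\<^sub>R (\<rho> *\<^sub>R H (x, u) u)"
    unfolding P.phi_sq[OF p P.T_ops(2)[OF HLt VCt]] P.eta_diff[OF p HLt VCt] eta_H[OF L] eta_V[OF C] xi_geo[OF p] geo_def by simp
  also have "(1 / \<rho> * g x L u) *\<^sub>R (\<rho> *\<^sub>R H (x, u) u) = g x L u *\<^sub>R H (x, u) u" using rho(1) by simp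
  finally have 1: "\<phi> (x, u) (\<phi> (x, u) (H (x, u) L - V (x, u) C)) = H (x, u) L - V (x, u) C - g x L u *\<^sub>R H (x, u) u" .
  have 3: "\<phi> (x, u) ((- k1) *\<^sub>R V (x, u) A) = - (H (x, u) A - g x A u *\<^sub>R H (x, u) u)"
    unfolding P.phi_scale[OF p V_tan[OF p A]] phi_V[OF A] scaleR_scaleR using constants(2) by simp
  have 4: "\<phi> (x, u) (k1 *\<^sub>R V (x, u) B) = H (x, u) B - g x B u *\<^sub>R H (x, u) u"
    unfolding P.phi_scale[OF p V_tan[OF p B]] phi_V[OF B] scaleR_scaleR constants(2) by simp
  have "nijenhuis UTM \<phi> (hfield X) (hfield Y) (x, u) = 0"
    unfolding nijenhuis_def L1 L2 L3 L4 1 3 4 unfolding HL gL VC diff_minus_eq_add by (rule curvature_cancel[OF constants(1)])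
  moreover have "exterior_derivative UTM \<eta> (hfield X) (hfield Y) (x, u) = 0"
    unfolding P.deta[OF p hX hY] unfolding hfield_def fst_conv phi_H[OF tY] P.G_scale[OF p H_tan[OF p tX] V_tan[OF p tY]]
      G_HV[OF p tX tY] b by simp
  ultimately show ?thesis unfolding P.tors_def[OF p] by simp
qed

lemma constant_curvature_imp_tors:
  assumes K: "constant_sectional_curvature M g D ((a + c) / a)"
    and X: "vector_field_near UTM (x, u) X" and Y: "vector_field_near UTM (x, u) Y"
  shows "P.tors (x, u) X Y = 0"
proof -
  obtain U \<psi> where U: "(U, \<psi>) \<in> charts M" "x \<in> U" using chart_at[OF xu(1)[OF p]] .
  note cv = cfield_vf[OF U]
  define h where "h i = hfield (cfield U \<psi> i)" for i
  have h: "vector_field_near UTM (x, u) (h i)" for i unfolding h_def by (rule hfield_vf[OF p cv])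
  show ?thesis
  \<comment> \<open>The coefficients \<open>c\<close> are those of \<xi> = \<rho> u^h in the lifted
    coordinate fields.\<close>
  proof (rule P.tors_zero_of_frame[OF p, where I = Basis and H = h and c = "\<lambda>i q. \<rho> * snd q (\<lambda>y. \<psi> y \<bullet> i)"])
    show "vector_field_near UTM (x, u) (h i)" for i by (rule h)
    show "P.tors (x, u) (h i) (h j) = 0" for i j unfolding h_def by (rule tors_hfield[OF K cv cv])
    show "smooth_near UTM (x, u) (\<lambda>q. \<rho> * snd q (\<lambda>y. \<psi> y \<bullet> i))" if "i \<in> Basis" for i
      by (rule UT.B.smooth_cmult[OF UT.smooth_fibre_coordinate[OF p U that]])
    show "eventually (\<lambda>q. (\<Sum>i\<in>Basis. (\<rho> * snd q (\<lambda>y. \<psi> y \<bullet> i)) *\<^sub>R h i q) = \<xi> q) (nhdf UTM (x, u))"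
      using geo_expand[OF p U] UT.B.ev_points[OF p]
    proof eventually_elim
      case (elim q)
      have "\<xi> q = \<rho> *\<^sub>R geo q" using xi_geo[of "fst q" "snd q"] elim(2) by simp
      then show ?case unfolding elim(1)[symmetric] scaleR_sum_right scaleR_scaleR h_def by simp
    qed
    fix W assume W: "vector_field_near UTM (x, u) W"
    obtain F K where F: "\<And>i. i \<in> Basis \<Longrightarrow> smooth_near UTM (x, u) (F i)"
      and K: "\<And>i. i \<in> Basis \<Longrightarrow> smooth_near UTM (x, u) (K i)"
      and e: "eventually (\<lambda>q. (\<Sum>i\<in>Basis. F i q *\<^sub>R hfield (cfield U \<psi> i) q) + (\<Sum>i\<in>Basis. K i q *\<^sub>R vfield (cfield U \<psi> i) q) = W q)
        (nhdf UTM (x, u))"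
      using frame[OF p W U] by blast
    have "eventually (\<lambda>q. \<forall>i\<in>Basis. P.app (h i) q = k1 *\<^sub>R vfield (cfield U \<psi> i) q) (nhdf UTM (x, u))"
      unfolding h_def by (intro eventually_ball_finite ballI app_hfield[OF cv] finite_Basis)
    \<comment> \<open>Dividing by \<open>k1\<close> rewrites the vertical fields of
      \<open>frame\<close> as \<phi> of the horizontal ones, the form that
      \<open>tors_zero_of_frame\<close> expects.\<close>
    with e have e': "eventually (\<lambda>q. (\<Sum>i\<in>Basis. F i q *\<^sub>R h i q) + (\<Sum>i\<in>Basis. (1 / k1 * K i q) *\<^sub>R P.app (h i) q) = W q)
        (nhdf UTM (x, u))"
    proof eventually_elim
      case (elim q)
      have "(\<Sum>i\<in>Basis. (1 / k1 * K i q) *\<^sub>R P.app (h i) q) = (\<Sum>i\<in>Basis. K i q *\<^sub>R vfield (cfield U \<psi> i) q)"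
        using elim(2) constants(3) by (intro sum.cong refl) simp
      then show ?case using elim(1) by (simp only: h_def)
    qed
    have s: "\<forall>i\<in>Basis. smooth_near UTM (x, u) (F i) \<and> smooth_near UTM (x, u) (\<lambda>q. 1 / k1 * K i q)"
      by (intro ballI conjI F UT.B.smooth_cmult K)
    show "\<exists>F K. (\<forall>i\<in>Basis. smooth_near UTM (x, u) (F i) \<and> smooth_near UTM (x, u) (K i)) \<and>
       eventually (\<lambda>q. (\<Sum>i\<in>Basis. F i q *\<^sub>R h i q) + (\<Sum>i\<in>Basis. K i q *\<^sub>R P.app (h i) q) = W q) (nhdf UTM (x, u))"
      by (rule exI[where x = F], rule exI[where x = "\<lambda>i q. 1 / k1 * K i q"], rule conjI[OF s e'])
  qed (rule X Y)+
qed

end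

end

end

theorem theorem3:
  fixes M :: "('a, 'e::euclidean_space) space"
    and g :: "'a \<Rightarrow> 'a tvec \<Rightarrow> 'a tvec \<Rightarrow> real"
    and D :: "'a connection"
    and n :: nat
    and a b c d :: real
    and \<phi> :: "('a \<times> 'a tvec) endo_field"
    and \<xi> :: "'a \<times> 'a tvec \<Rightarrow> ('a \<times> 'a tvec) tvec"
    and \<eta> :: "'a \<times> 'a tvec \<Rightarrow> ('a \<times> 'a tvec) tvec \<Rightarrow> real"
    and G :: "'a \<times> 'a tvec \<Rightarrow> ('a \<times> 'a tvec) tvec \<Rightarrow> ('a \<times> 'a tvec) tvec \<Rightarrow> real"
  assumes "smooth_manifold M"
    and "DIM('e) = n + 1" and "n \<ge> 1"
    and "riemannian_metric M g"
    and "levi_civita M g D"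
    and "g_natural_paracontact_metric M n g D a b c d \<phi> \<xi> \<eta> G"
    and "a \<noteq> 0"
  shows "(para_sasakian (unit_tangent_bundle M g) n \<phi> \<xi> \<eta> G \<longleftrightarrow>
            k_paracontact (unit_tangent_bundle M g) n \<phi> \<xi> \<eta> G) \<and>
         (k_paracontact (unit_tangent_bundle M g) n \<phi> \<xi> \<eta> G \<longleftrightarrow>
            b = 0 \<and> constant_sectional_curvature M g D ((a + c) / a) \<and> (a + c) / a < 0)"
proof -
  note gp = assms(6)[unfolded g_natural_paracontact_metric_def Let_def]
  then obtain \<rho> where \<rho>: "g_natural_paracontact M g D n a b c d \<rho> \<phi> \<xi> \<eta> G"
    using assms
    unfolding g_natural_paracontact_def g_natural_paracontact_axioms_def riemannian_def riemannian_axioms_def manifold_def Let_def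
    by blast
  interpret g_natural_paracontact M g D n a b c d \<rho> \<phi> \<xi> \<eta> G by (rule \<rho>)
  have S: "para_sasakian UTM n \<phi> \<xi> \<eta> G \<longleftrightarrow>
      (\<forall>p\<in>points UTM. \<forall>V W. vector_field_near UTM p V \<and> vector_field_near UTM p W \<longrightarrow> P.tors p V W = 0)"
    using pmetric by (auto simp: para_sasakian_def P.tors_def)
  have K: "k_paracontact UTM n \<phi> \<xi> \<eta> G \<longleftrightarrow> killing_field UTM G \<xi>"
    using pmetric by (simp add: k_paracontact_def)
  have 1: "killing_field UTM G \<xi>" if s: "para_sasakian UTM n \<phi> \<xi> \<eta> G"
    unfolding killing_field_def
  proof (intro ballI conjI allI impI)
    fix p assume p: "p \<in> points UTM"
    show "vector_field_near UTM p \<xi>" by (rule P.xi_vf[OF p])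
    fix V W assume "vector_field_near UTM p V \<and> vector_field_near UTM p W"
    then show "lie_derivative_metric UTM \<xi> G V W p = 0"
      using s[unfolded S] p by (intro P.killing_of_tors[OF p]) auto
  qed
  have 2: "para_sasakian UTM n \<phi> \<xi> \<eta> G" if "b = 0" "constant_sectional_curvature M g D ((a + c) / a)"
    unfolding S using constant_curvature_imp_tors[OF that(1) _ that(2)] by auto
  show ?thesis using 1 2 killing_imp_constant_curvature K by blast
qed

end
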